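(* Let $k\in\{1,-1\}$. For any $s>\frac12$ there exists $b_0>\frac12$ such that for any $b\in(\frac12,b_0]$ there is a constant $C>0$ such that for all $u\in X^{s,b}$, $$\left\|\left(\frac{\widehat{(uu_{xx})_{xx}}(\xi,\tau)}{\phi(\xi)}\right)^{\vee}\right\|_{X^{s,b-1}}\le C\|u\|_{X^{s,b}}^2$$ and $$\left\|\left(\frac{\widehat{(u^3)_{xx}}(\xi,\tau)}{\phi(\xi)}\right)^{\vee}\right\|_{X^{s,b-1}}\le C\|u\|_{X^{s,b}}^3 .$$
   Context: Write $\langle x\rangle=\sqrt{1+x^2}$ and, for $k=\pm1$, $\phi(\xi)=\sqrt{\xi^6+k\xi^4+\xi^2}$. For $s,b\in\mathbb{R}$, $X^{s,b}$ is the completion of the Schwartz class $S(\mathbb{R}^2)$ (functions $u(x,t)$) with respect to the norm $$\|u\|_{X^{s,b}}=\big\|\langle\xi\rangle^s\langle|\tau|-\phi(\xi)\rangle^b\,\hat u(\xi,\tau)\big\|_{L^2_{\xi,\tau}(\mathbb{R}^2)},$$ where $\hat u$ (also written $\widehat{u}$) is the Fourier transform in both space and time ($\xi$ dual to $x$, $\tau$ dual to $t$), and $\vee$ denotes the inverse Fourier transform in both space and time. The nonlinear expressions on the left-hand sides are understood for Schwartz functions and extended to $X^{s,b}$ by density and continuity. *)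

theory Defs
  imports "HOL-Analysis.Analysis"
begin

text \<open>Functions of \<open>(x, t)\<close>, and of the dual variables \<open>(\<xi>, \<tau>)\<close>, are complex valued functions
  on the type \<open>real \<times> real\<close>.\<close>

definition jbracket :: "real \<Rightarrow> real" where
  "jbracket x = sqrt (1 + x\<^sup>2)"

definition phi :: "real \<Rightarrow> real \<Rightarrow> real" where
  "phi k \<xi> = sqrt (\<xi> ^ 6 + k * \<xi> ^ 4 + \<xi>\<^sup>2)"


subsection \<open>Schwartz functions\<close>

definition dx :: "(real \<times> real \<Rightarrow> complex) \<Rightarrow> (real \<times> real \<Rightarrow> complex)" where
  "dx u = (\<lambda>(x, t). vector_derivative (\<lambda>y. u (y, t)) (at x))"

definition dt :: "(real \<times> real \<Rightarrow> complex) \<Rightarrow> (real \<times> real \<Rightarrow> complex)" where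
  "dt u = (\<lambda>(x, t). vector_derivative (\<lambda>y. u (x, y)) (at t))"

inductive_set partials :: "(real \<times> real \<Rightarrow> complex) \<Rightarrow> (real \<times> real \<Rightarrow> complex) set"
  for u :: "real \<times> real \<Rightarrow> complex" where
  partials_self: "u \<in> partials u"
| partials_dx: "v \<in> partials u \<Longrightarrow> dx v \<in> partials u"
| partials_dt: "v \<in> partials u \<Longrightarrow> dt v \<in> partials u"

definition schwartz :: "(real \<times> real \<Rightarrow> complex) set" where
  "schwartz = {u. \<forall>v \<in> partials u. (\<forall>z. v differentiable (at z)) \<and>
     (\<forall>i j :: nat. bounded (range (\<lambda>(x, t). (x ^ i * t ^ j) *\<^sub>R v (x, t))))}"


subsection \<open>Fourier transform in space and time\<close>

definition fourier :: "(real \<times> real \<Rightarrow> complex) \<Rightarrow> (real \<times> real \<Rightarrow> complex)" where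
  "fourier u = (\<lambda>(\<xi>, \<tau>).
     \<integral>z. exp (- (\<i> * complex_of_real (fst z * \<xi> + snd z * \<tau>))) * u z \<partial>lborel)"

definition inv_fourier :: "(real \<times> real \<Rightarrow> complex) \<Rightarrow> (real \<times> real \<Rightarrow> complex)" where
  "inv_fourier F = (\<lambda>(x, t). complex_of_real (1 / (2 * pi)\<^sup>2) *
     (\<integral>\<zeta>. exp (\<i> * complex_of_real (x * fst \<zeta> + t * snd \<zeta>)) * F \<zeta> \<partial>lborel))"


subsection \<open>The norm\<close>

definition X_weight :: "real \<Rightarrow> real \<Rightarrow> real \<Rightarrow> real \<times> real \<Rightarrow> real" where
  "X_weight k s b = (\<lambda>(\<xi>, \<tau>). jbracket \<xi> powr s * jbracket (\<bar>\<tau>\<bar> - phi k \<xi>) powr b)"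

text \<open>Lebesgue integrals of non-integrable functions are \<open>0\<close> by convention, so \<open>X_norm\<close> is
  only meaningful on \<open>X_fun\<close>. This class of integrable functions with finite norm contains
  the Schwartz functions, but also the functions \<open>op_quad k u\<close> and \<open>op_cubic k u\<close> below, which in
  general are not Schwartz because \<open>phi k\<close> is not smooth at \<open>0\<close>.\<close>

definition X_norm :: "real \<Rightarrow> real \<Rightarrow> real \<Rightarrow> (real \<times> real \<Rightarrow> complex) \<Rightarrow> real" where
  "X_norm k s b u = sqrt (\<integral>\<zeta>. (X_weight k s b \<zeta> * norm (fourier u \<zeta>))\<^sup>2 \<partial>lborel)"

definition X_fun :: "real \<Rightarrow> real \<Rightarrow> real \<Rightarrow> (real \<times> real \<Rightarrow> complex) set" where
  "X_fun k s b = {u. integrable lborel u \<and>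
     integrable lborel (\<lambda>\<zeta>. (X_weight k s b \<zeta> * norm (fourier u \<zeta>))\<^sup>2)}"


subsection \<open>The completion of the Schwartz class\<close>

text \<open>Elements of the completion are equivalence classes of Cauchy sequences.\<close>

definition X_cauchy :: "real \<Rightarrow> real \<Rightarrow> real \<Rightarrow> (nat \<Rightarrow> real \<times> real \<Rightarrow> complex) set" where
  "X_cauchy k s b = {u. (\<forall>n. u n \<in> schwartz) \<and>
     (\<forall>e>0. \<exists>N. \<forall>m\<ge>N. \<forall>n\<ge>N. X_norm k s b (\<lambda>z. u m z - u n z) < e)}"

definition X_rel :: "real \<Rightarrow> real \<Rightarrow> real \<Rightarrow>
    ((nat \<Rightarrow> real \<times> real \<Rightarrow> complex) \<times> (nat \<Rightarrow> real \<times> real \<Rightarrow> complex)) set" where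
  "X_rel k s b = {(u, v). u \<in> X_cauchy k s b \<and> v \<in> X_cauchy k s b \<and>
     (\<lambda>n. X_norm k s b (\<lambda>z. u n z - v n z)) \<longlonglongrightarrow> 0}"

definition X_space :: "real \<Rightarrow> real \<Rightarrow> real \<Rightarrow> (nat \<Rightarrow> real \<times> real \<Rightarrow> complex) set set" where
  "X_space k s b = X_cauchy k s b // X_rel k s b"

definition X_space_norm ::
    "real \<Rightarrow> real \<Rightarrow> real \<Rightarrow> (nat \<Rightarrow> real \<times> real \<Rightarrow> complex) set \<Rightarrow> real" where
  "X_space_norm k s b U = (THE r. \<forall>u\<in>U. (\<lambda>n. X_norm k s b (u n)) \<longlonglongrightarrow> r)"

text \<open>The value \<open>0\<close> off the carrier makes the distance nonnegative and symmetric everywhere,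
  as the locale \<open>Metric_space\<close> requires.\<close>

definition X_space_dist :: "real \<Rightarrow> real \<Rightarrow> real \<Rightarrow>
    (nat \<Rightarrow> real \<times> real \<Rightarrow> complex) set \<Rightarrow> (nat \<Rightarrow> real \<times> real \<Rightarrow> complex) set \<Rightarrow> real" where
  "X_space_dist k s b U V = (if U \<in> X_space k s b \<and> V \<in> X_space k s b
     then THE r. \<forall>u\<in>U. \<forall>v\<in>V. (\<lambda>n. X_norm k s b (\<lambda>z. u n z - v n z)) \<longlonglongrightarrow> r
     else 0)"

definition X_topology ::
    "real \<Rightarrow> real \<Rightarrow> real \<Rightarrow> (nat \<Rightarrow> real \<times> real \<Rightarrow> complex) set topology" where
  "X_topology k s b = Metric_space.mtopology (X_space k s b) (X_space_dist k s b)"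

text \<open>The element of the completion represented by a function \<open>f\<close> in \<open>X_fun k s b\<close>: all
  Cauchy sequences of Schwartz functions that converge to \<open>f\<close>. For a Schwartz function this is the
  class of the constant sequence.\<close>

definition X_embed ::
    "real \<Rightarrow> real \<Rightarrow> real \<Rightarrow> (real \<times> real \<Rightarrow> complex) \<Rightarrow> (nat \<Rightarrow> real \<times> real \<Rightarrow> complex) set" where
  "X_embed k s b f =
     {v \<in> X_cauchy k s b. (\<lambda>n. X_norm k s b (\<lambda>z. v n z - f z)) \<longlonglongrightarrow> 0}"


subsection \<open>The nonlinear expressions\<close>

definition op_quad :: "real \<Rightarrow> (real \<times> real \<Rightarrow> complex) \<Rightarrow> (real \<times> real \<Rightarrow> complex)" where
  "op_quad k u = inv_fourier (\<lambda>(\<xi>, \<tau>).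
     fourier (dx (dx (\<lambda>z. u z * dx (dx u) z))) (\<xi>, \<tau>) / complex_of_real (phi k \<xi>))"

definition op_cubic :: "real \<Rightarrow> (real \<times> real \<Rightarrow> complex) \<Rightarrow> (real \<times> real \<Rightarrow> complex)" where
  "op_cubic k u = inv_fourier (\<lambda>(\<xi>, \<tau>).
     fourier (dx (dx (\<lambda>z. u z ^ 3))) (\<xi>, \<tau>) / complex_of_real (phi k \<xi>))"

text \<open>\<open>T\<close> is the extension by density and continuity, to a map between the completions
  \<open>X_space k s b\<close> and \<open>X_space k s b'\<close>, of the map \<open>N\<close> on Schwartz functions. It is unique
  on \<open>X_space k s b\<close> if it exists.\<close>

definition X_extension :: "real \<Rightarrow> real \<Rightarrow> real \<Rightarrow> real \<Rightarrow>
    ((real \<times> real \<Rightarrow> complex) \<Rightarrow> (real \<times> real \<Rightarrow> complex)) \<Rightarrow>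
    ((nat \<Rightarrow> real \<times> real \<Rightarrow> complex) set \<Rightarrow> (nat \<Rightarrow> real \<times> real \<Rightarrow> complex) set) \<Rightarrow> bool" where
  "X_extension k s b b' N T \<longleftrightarrow>
     (\<forall>u\<in>schwartz. N u \<in> X_fun k s b' \<and> T (X_embed k s b u) = X_embed k s b' (N u)) \<and>
     continuous_map (X_topology k s b) (X_topology k s b') T"

end

theory Submission
  imports Defs "HOL-Probability.Probability" "HOL-Real_Asymp.Real_Asymp"
begin

text \<open>Both nonlinear expressions have the form \<open>phi_op k g\<close> with \<open>g = u * u\<^sub>x\<^sub>x\<close> or \<open>g = u\<^sup>3\<close>, where
  \<open>phi_op k\<close> is the multiplier operator with symbol \<open>- \<xi>\<^sup>2 / \<phi>(\<xi>)\<close>, and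
  \<open>\<xi>\<^sup>2 / \<phi>(\<xi>) \<le> 2 \<bar>\<xi>\<bar> / \<langle>\<xi>\<rangle>\<^sup>2\<close> gains one derivative at high frequency. The transform of a product is a
  convolution, so for Schwartz functions the estimates are weighted \<open>L\<^sup>2\<close> inequalities for
  convolutions of nonnegative functions.

  The cubic term is soft. For \<open>s, b > 1/2\<close> the weight of \<open>X\<^sup>s\<^sup>,\<^sup>b\<close> makes the transform of \<open>u\<close> integrable
  (\<open>X_nn_controls_L1\<close>), \<open>\<langle>\<xi>\<rangle>\<^sup>s\<close> is subadditive up to a constant, and Young's inequality for
  \<open>L\<^sup>1 * L\<^sup>2\<close> finishes (\<open>cubic_estimate\<close>).

  In the quadratic term two derivatives fall on one factor and only one is regained. Let
  \<open>\<xi> = \<xi>\<^sub>1 + \<xi>\<^sub>2\<close> and let \<open>N\<close> be the larger of \<open>\<bar>\<xi>\<^sub>1\<bar>\<close> and \<open>\<bar>\<xi>\<^sub>2\<bar>\<close>. For \<open>N < 4\<close> all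
  frequencies are bounded. For \<open>N \<ge> 4\<close> the dispersion pays for the loss in two different ways.

  \<^item> If one input frequency is at least eight times the other, the phase
  \<open>\<plusminus>\<phi>(\<xi>\<^sub>1) \<plusminus> \<phi>(\<xi> - \<xi>\<^sub>1)\<close> moves with speed at least \<open>\<xi>\<^sup>2 / 2\<close> in \<open>\<xi>\<^sub>1\<close>
  (\<open>transversal_expanding\<close>). Cauchy--Schwarz with the output point frozen then gains \<open>\<xi>\<^sup>-\<^sup>2\<close>
  (\<open>transversal_kernel_integral\<close>), which cancels the squared loss.

  \<^item> If the input frequencies are comparable, the resonance bound
  \<open>\<phi>(c + d) - \<phi>(c) - \<phi>(d) \<ge> d (c + d)\<^sup>2 / 2\<close> for \<open>0 \<le> d \<le> c\<close>, \<open>3 \<le> c + d\<close> (\<open>phi_resonance\<close>) forces one of the three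
  modulations \<open>\<bar>\<tau>\<bar> - \<phi>(\<xi>)\<close> to have size at least \<open>\<bar>\<xi>\<bar> N\<^sup>2 / 96\<close>, whatever the signs of the
  \<open>\<tau>\<close>'s (\<open>modulation_triangle\<close>). Its weight pays \<open>(\<bar>\<xi>\<bar> N\<^sup>2)\<^sup>2\<^sup>b\<^sup>-\<^sup>2\<close> against the loss \<open>N\<^sup>4\<^sup>-\<^sup>4\<^sup>s\<close> in
  the squared kernel; for \<open>b \<le> s \<le> 5/8\<close> the integrable weight \<open>\<langle>\<xi>\<rangle>\<^sup>-\<^sup>3\<^sup>/\<^sup>2\<close> is left
  (\<open>freq_weight_comparable\<close>), and Cauchy--Schwarz with one input point frozen applies.

  Since \<open>\<langle>\<xi>\<^sub>1 + \<xi>\<^sub>2\<rangle> \<le> \<surd>2 \<langle>\<xi>\<^sub>1\<rangle> \<langle>\<xi>\<^sub>2\<rangle>\<close>, an estimate with exponent \<open>s\<^sub>0\<close> implies the one with any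
  \<open>s \<ge> s\<^sub>0\<close>. Hence \<open>b\<^sub>0 = s\<^sub>0 = min s (5/8)\<close> works.

  The rest is the passage to the completion. The symbol behaves like \<open>\<bar>\<xi>\<bar>\<close> at the origin, so
  \<open>phi_op k g\<close> is in general not a Schwartz function. It is still integrable, because
  \<open>\<xi>\<^sup>2 / \<phi> = (1 + \<xi>\<^sup>2) h\<close> where \<open>h\<close> has an integrable inverse transform: \<open>phi_op k g\<close> is a convolution
  with \<open>g - g\<^sub>x\<^sub>x\<close> (\<open>phi_op_props\<close>). It is a limit of Schwartz functions in every \<open>X\<^sup>s\<^sup>,\<^sup>b\<close> norm, because the
  symbol is a bounded pointwise limit of polynomials in \<open>cos (\<pi> \<xi> / n)\<close>, and these act on \<open>g\<close> by
  finite combinations of translations (\<open>phi_op_density\<close>). Applied to differences, the bilinear and trilinear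
  estimates make the nonlinear maps locally Lipschitz, and such maps extend to the completion with the same
  growth bound (\<open>X_extension_exists\<close>).\<close>

section \<open>The bracket and the dispersion relation\<close>

lemma jbracket_ge_1: "1 \<le> jbracket x"
  by (simp add: jbracket_def)

lemma jbracket_pos [simp]: "0 < jbracket x"
  using jbracket_ge_1[of x] by linarith

lemma jbracket_nonneg [simp]: "0 \<le> jbracket x"
  using jbracket_pos less_imp_le by blast

lemma jbracket_neq_0 [simp]: "jbracket x \<noteq> 0"
  using jbracket_pos by (metis less_irrefl)

lemma jbracket_sq: "(jbracket x)\<^sup>2 = 1 + x\<^sup>2"
  by (simp add: jbracket_def)

lemma jbracket_ge_abs: "\<bar>x\<bar> \<le> jbracket x"
  unfolding jbracket_def by (rule real_le_rsqrt) simp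

lemma jbracket_le_abs: "jbracket x \<le> 1 + \<bar>x\<bar>"
  unfolding jbracket_def by (rule real_le_lsqrt) (auto simp: power2_eq_square algebra_simps)

lemma jbracket_minus [simp]: "jbracket (- x) = jbracket x"
  by (simp add: jbracket_def)

lemma jbracket_add_le: "jbracket (x + y) \<le> sqrt 2 * (jbracket x * jbracket y)"
proof -
  have "1 + (x + y)\<^sup>2 \<le> 2 * ((1 + x\<^sup>2) * (1 + y\<^sup>2))"
    using zero_le_power2[of "x - y"] zero_le_power2[of "x * y"] zero_le_power2[of "x"] zero_le_power2[of "y"]
    by (simp add: power2_eq_square algebra_simps)
  then show ?thesis
    unfolding jbracket_def real_sqrt_mult[symmetric] by (rule real_sqrt_le_mono)
qed

lemma jbracket_add_le': "jbracket (x + y) \<le> jbracket x + jbracket y"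
proof -
  have "jbracket (x + y) \<le> sqrt ((jbracket x)\<^sup>2 + (jbracket y)\<^sup>2 + 2 * (\<bar>x\<bar> * \<bar>y\<bar>))"
    unfolding jbracket_sq unfolding jbracket_def
    by (rule real_sqrt_le_mono) (simp add: power2_sum abs_mult[symmetric])
  also have "\<dots> \<le> sqrt ((jbracket x + jbracket y)\<^sup>2)"
    by (intro real_sqrt_le_mono) (auto simp: power2_sum intro!: mult_mono jbracket_ge_abs)
  finally show ?thesis by simp
qed

lemma jbracket_measurable [measurable]: "jbracket \<in> borel_measurable borel"
  unfolding jbracket_def by measurable

lemma phi_measurable [measurable]: "phi k \<in> borel_measurable borel"
  unfolding phi_def by measurable

lemma X_weight_measurable [measurable]: "X_weight k s b \<in> borel_measurable borel"
  unfolding X_weight_def borel_prod[symmetric] by measurable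

text \<open>\<open>\<phi>(\<xi>) = \<bar>\<xi>\<bar> q(\<xi>)\<close> isolates the corner of \<open>\<phi>\<close> at the origin: \<open>q\<close> is smooth and comparable to
  \<open>1 + \<xi>\<^sup>2\<close>.\<close>

definition qphi :: "real \<Rightarrow> real \<Rightarrow> real" where
  "qphi k x = sqrt (x ^ 4 + k * x\<^sup>2 + 1)"

lemma phi_eq_qphi: "phi k x = \<bar>x\<bar> * qphi k x"
proof -
  have "x ^ 6 + k * x ^ 4 + x\<^sup>2 = x\<^sup>2 * (x ^ 4 + k * x\<^sup>2 + 1)"
    by (simp add: algebra_simps power_add[symmetric])
  then show ?thesis
    unfolding phi_def qphi_def by (simp add: real_sqrt_mult)
qed

lemma qphi_sq:
  assumes "\<bar>k\<bar> \<le> 1"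
  shows "(qphi k x)\<^sup>2 = x ^ 4 + k * x\<^sup>2 + 1" "((1 + x\<^sup>2) / 2)\<^sup>2 \<le> x ^ 4 + k * x\<^sup>2 + 1"
proof -
  define z where "z = x\<^sup>2"
  have z: "0 \<le> z" "x ^ 4 = z\<^sup>2" by (auto simp: z_def power_mult[symmetric])
  have "- z \<le> k * z" using assms z(1) by (simp add: abs_le_iff) (metis minus_le_iff mult_minus_left mult_right_mono mult_1)
  then show *: "((1 + x\<^sup>2) / 2)\<^sup>2 \<le> x ^ 4 + k * x\<^sup>2 + 1"
    unfolding z z_def[symmetric] using zero_le_power2[of "z - 1"]
    by (simp add: power2_eq_square field_simps)
  have "0 \<le> x ^ 4 + k * x\<^sup>2 + 1"
    by (rule order_trans[OF zero_le_power2 *])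
  then show "(qphi k x)\<^sup>2 = x ^ 4 + k * x\<^sup>2 + 1" by (simp add: qphi_def)
qed

lemma qphi_ge: assumes "\<bar>k\<bar> \<le> 1" shows "(1 + x\<^sup>2) / 2 \<le> qphi k x"
  unfolding qphi_def by (rule real_le_rsqrt) (rule qphi_sq(2)[OF assms])

lemma qphi_pos: assumes "\<bar>k\<bar> \<le> 1" shows "0 < qphi k x"
proof -
  have "0 < (1 + x\<^sup>2) / 2" by (simp add: add_pos_nonneg)
  then show ?thesis using qphi_ge[OF assms, of x] by linarith
qed

lemma qphi_le: assumes "\<bar>k\<bar> \<le> 1" shows "qphi k x \<le> 1 + x\<^sup>2"
  unfolding qphi_def
proof (rule real_le_lsqrt)
  have "k * x\<^sup>2 \<le> 2 * x\<^sup>2" using assms by (intro mult_right_mono) auto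
  then show "x ^ 4 + k * x\<^sup>2 + 1 \<le> (1 + x\<^sup>2)\<^sup>2"
    by (simp add: power2_eq_square algebra_simps power4_eq_xxxx)
qed auto

lemma qphi_ge': assumes "\<bar>k\<bar> \<le> 1" shows "x\<^sup>2 - 1 / 2 \<le> qphi k x"
  unfolding qphi_def
proof (rule real_le_rsqrt)
  have "- x\<^sup>2 \<le> k * x\<^sup>2" using mult_right_mono[of "-1" k "x\<^sup>2"] assms by auto
  then show "(x\<^sup>2 - 1 / 2)\<^sup>2 \<le> x ^ 4 + k * x\<^sup>2 + 1"
    by (simp add: power2_eq_square algebra_simps power4_eq_xxxx)
qed

lemma qphi_minus [simp]: "qphi k (- x) = qphi k x" "qphi k \<bar>x\<bar> = qphi k x"
  by (auto simp: qphi_def)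

lemma phi_minus [simp]: "phi k (- x) = phi k x" "phi k \<bar>x\<bar> = phi k x"
  by (auto simp: phi_eq_qphi)

lemma phi_nonneg: "\<bar>k\<bar> \<le> 1 \<Longrightarrow> 0 \<le> phi k x"
  using qphi_pos[of k x] by (simp add: phi_eq_qphi)

lemma qphi_diff:
  "\<bar>k\<bar> \<le> 1 \<Longrightarrow> (qphi k x - qphi k y) * (qphi k x + qphi k y) = (x\<^sup>2 - y\<^sup>2) * (x\<^sup>2 + y\<^sup>2 + k)"
  using qphi_sq(1)[of k x] qphi_sq(1)[of k y]
  by (simp add: power2_eq_square algebra_simps power4_eq_xxxx)

text \<open>The polynomial \<open>x\<^sup>4 + k x\<^sup>2 + 1\<close> under the root need not increase on \<open>[0, 1]\<close>, but for \<open>x \<ge> 1\<close> its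
  value at \<open>x\<close> is its maximum on \<open>[0, x]\<close>.\<close>

lemma qphi_mono:
  assumes k: "\<bar>k\<bar> \<le> 1" and "0 \<le> y" "y \<le> x" "1 \<le> x"
  shows "qphi k y \<le> qphi k x"
proof -
  have "0 \<le> (x\<^sup>2 - y\<^sup>2) * (x\<^sup>2 + y\<^sup>2 + k)"
  proof (rule mult_nonneg_nonneg)
    show "0 \<le> x\<^sup>2 - y\<^sup>2" using assms by (simp add: power_mono)
    have "1 \<le> x\<^sup>2" using assms by (simp add: one_le_power)
    then show "0 \<le> x\<^sup>2 + y\<^sup>2 + k" using k zero_le_power2[of y] by linarith
  qed
  then have "0 \<le> (qphi k x - qphi k y) * (qphi k x + qphi k y)"
    by (simp add: qphi_diff[OF k])
  then show ?thesis
    using qphi_pos[OF k, of x] qphi_pos[OF k, of y] by (simp add: zero_le_mult_iff)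
qed

text \<open>Multiplying by \<open>q(x) + q(y)\<close> rationalises the difference of roots; the lower bound
  \<open>q \<ge> (1 + x\<^sup>2) / 2\<close> then absorbs the quartic numerator.\<close>

lemma qphi_abs_diff_le:
  assumes k: "\<bar>k\<bar> \<le> 1" and "0 \<le> y" "y \<le> x"
  shows "\<bar>qphi k x - qphi k y\<bar> \<le> 2 * (x - y) * (x + y)"
proof -
  have pos: "0 < qphi k x + qphi k y"
    using qphi_pos[OF k, of x] qphi_pos[OF k, of y] by linarith
  have p: "(1 + x\<^sup>2 + y\<^sup>2) / 2 \<le> qphi k x + qphi k y"
    using qphi_ge[OF k, of x] qphi_ge[OF k, of y] by (simp add: field_simps)
  have d: "0 \<le> x\<^sup>2 - y\<^sup>2" using assms by (simp add: power_mono)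
  have "\<bar>qphi k x - qphi k y\<bar> * (qphi k x + qphi k y) = \<bar>(qphi k x - qphi k y) * (qphi k x + qphi k y)\<bar>"
    using pos by (simp add: abs_mult)
  also have "\<dots> = (x\<^sup>2 - y\<^sup>2) * \<bar>x\<^sup>2 + y\<^sup>2 + k\<bar>"
    using d by (simp add: qphi_diff[OF k] abs_mult)
  also have "\<dots> \<le> (x\<^sup>2 - y\<^sup>2) * (1 + x\<^sup>2 + y\<^sup>2)"
    using k d zero_le_power2[of x] zero_le_power2[of y] by (intro mult_left_mono) linarith+
  also have "\<dots> \<le> (x\<^sup>2 - y\<^sup>2) * (2 * (qphi k x + qphi k y))"
    using p d by (intro mult_left_mono) auto
  finally have "\<bar>qphi k x - qphi k y\<bar> * (qphi k x + qphi k y) \<le> (2 * (x\<^sup>2 - y\<^sup>2)) * (qphi k x + qphi k y)"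
    by (simp add: algebra_simps)
  then have "\<bar>qphi k x - qphi k y\<bar> \<le> 2 * (x\<^sup>2 - y\<^sup>2)"
    using pos by (simp add: mult_le_cancel_right)
  then show ?thesis by (simp add: power2_eq_square algebra_simps)
qed

text \<open>A mean value inequality that survives at \<open>k = - 1\<close>, where \<open>q\<close> is not monotone near the origin:
  \<open>\<phi>(x) - \<phi>(y) = (x - y) q(x) + y (q(x) - q(y))\<close>, and for \<open>x \<ge> 1\<close> the second term is nonnegative.\<close>

lemma phi_diff_ge:
  assumes k: "\<bar>k\<bar> \<le> 1" and "0 \<le> y" "y \<le> x" "1 \<le> x"
  shows "(x - y) * (x\<^sup>2 - 1 / 2) \<le> phi k x - phi k y"
proof -
  have "phi k x - phi k y = (x - y) * qphi k x + y * (qphi k x - qphi k y)"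
    using assms by (simp add: phi_eq_qphi algebra_simps)
  also have "\<dots> \<ge> (x - y) * (x\<^sup>2 - 1 / 2) + 0"
    using assms qphi_mono[OF assms] qphi_ge'[OF k, of x] by (intro add_mono mult_left_mono) auto
  finally show ?thesis by simp
qed

lemma phi_lipschitz:
  assumes k: "\<bar>k\<bar> \<le> 1" and "\<bar>x\<bar> \<le> r" "\<bar>y\<bar> \<le> r"
  shows "\<bar>phi k x - phi k y\<bar> \<le> (1 + 5 * r\<^sup>2) * \<bar>x - y\<bar>"
proof -
  have *: "\<bar>phi k x - phi k y\<bar> \<le> (1 + 5 * r\<^sup>2) * (x - y)" if "0 \<le> y" "y \<le> x" "x \<le> r" for x y
  proof -
    have "phi k x - phi k y = (x - y) * qphi k x + y * (qphi k x - qphi k y)"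
      using that by (simp add: phi_eq_qphi algebra_simps)
    then have "\<bar>phi k x - phi k y\<bar> \<le> (x - y) * qphi k x + y * \<bar>qphi k x - qphi k y\<bar>"
      using that qphi_pos[OF k, of x] by (metis abs_mult abs_of_nonneg abs_triangle_ineq diff_ge_0_iff_ge less_imp_le)
    also have "\<dots> \<le> (x - y) * (1 + r\<^sup>2) + r * (2 * (x - y) * (r + r))"
    proof (intro add_mono mult_left_mono order_trans[OF qphi_le[OF k]])
      have "y * \<bar>qphi k x - qphi k y\<bar> \<le> y * (2 * (x - y) * (x + y))"
        using qphi_abs_diff_le[OF k] that by (intro mult_left_mono) auto
      also have "\<dots> \<le> r * (2 * (x - y) * (r + r))"
        using that by (intro mult_mono) auto
      finally show "y * \<bar>qphi k x - qphi k y\<bar> \<le> r * (2 * (x - y) * (r + r))" .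
    qed (use that in \<open>auto intro!: power_mono\<close>)
    finally show ?thesis by (simp add: power2_eq_square algebra_simps)
  qed
  have le: "(1 + 5 * r\<^sup>2) * \<bar>\<bar>x\<bar> - \<bar>y\<bar>\<bar> \<le> (1 + 5 * r\<^sup>2) * \<bar>x - y\<bar>"
    by (intro mult_left_mono) (auto simp: add_nonneg_nonneg)
  have "\<bar>phi k \<bar>x\<bar> - phi k \<bar>y\<bar>\<bar> \<le> (1 + 5 * r\<^sup>2) * \<bar>\<bar>x\<bar> - \<bar>y\<bar>\<bar>"
  proof (cases "\<bar>y\<bar> \<le> \<bar>x\<bar>")
    case True
    then show ?thesis using *[of "\<bar>y\<bar>" "\<bar>x\<bar>"] assms by auto
  next
    case False
    then show ?thesis using *[of "\<bar>x\<bar>" "\<bar>y\<bar>"] assms by (auto simp: abs_minus_commute)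
  qed
  with le show ?thesis unfolding phi_minus by linarith
qed

text \<open>The cubic growth of \<open>\<phi>\<close> makes it strongly superadditive. With \<open>a = b + d\<close> the difference is
  \<open>b (q(a) - q(b)) + d (q(a) - q(d))\<close>. The first term is nonnegative, and \<open>d \<le> a / 2\<close> makes the second one
  comparable to \<open>d a\<^sup>2\<close>; \<open>a \<ge> 3\<close> absorbs the lower order terms.\<close>

lemma phi_resonance:
  assumes k: "\<bar>k\<bar> \<le> 1" and "0 \<le> d" "d \<le> b" "3 \<le> b + d"
  shows "d * (b + d)\<^sup>2 / 2 \<le> phi k (b + d) - phi k b - phi k d"
proof -
  define a where "a = b + d"
  \<comment> \<open>\<open>q(a) - q(d) \<ge> (a\<^sup>2 - 1/2) - (1 + d\<^sup>2)\<close>; with \<open>d\<^sup>2 \<le> a\<^sup>2 / 4\<close> this is at least \<open>a\<^sup>2 / 2\<close> if \<open>a\<^sup>2 \<ge> 6\<close>.\<close>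
  have a: "3 \<le> a" "b \<le> a" "d \<le> a / 2" using assms by (auto simp: a_def)
  have "phi k a - phi k b - phi k d = b * (qphi k a - qphi k b) + d * (qphi k a - qphi k d)"
    using assms by (simp add: phi_eq_qphi a_def algebra_simps)
  also have "\<dots> \<ge> 0 + d * (a\<^sup>2 / 2)"
  proof (intro add_mono mult_left_mono)
    show "0 \<le> b * (qphi k a - qphi k b)"
      using qphi_mono[OF k, of b a] a assms by auto
    have "d\<^sup>2 \<le> (a / 2)\<^sup>2" using a assms by (intro power_mono) auto
    moreover have "3\<^sup>2 \<le> a\<^sup>2" using a by (intro power_mono) auto
    ultimately have "a\<^sup>2 / 2 \<le> (a\<^sup>2 - 1/2) - (1 + d\<^sup>2)" by (simp add: power_divide)
    also have "\<dots> \<le> qphi k a - qphi k d"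
      using qphi_ge'[OF k, of a] qphi_le[OF k, of d] by linarith
    finally show "a\<^sup>2 / 2 \<le> qphi k a - qphi k d" .
  qed (use assms in auto)
  finally show ?thesis by (simp add: a_def)
qed

text \<open>The symbol of the operator gains one derivative at high frequency and vanishes at frequency zero.\<close>

lemma sq_div_phi_le:
  assumes k: "\<bar>k\<bar> \<le> 1"
  shows "x\<^sup>2 / phi k x \<le> 2 * \<bar>x\<bar> / (jbracket x)\<^sup>2"
proof (cases "x = 0")
  case False
  have "x\<^sup>2 / phi k x = \<bar>x\<bar> / qphi k x"
    using False qphi_pos[OF k, of x] by (simp add: phi_eq_qphi power2_eq_square field_simps)
  also have "\<dots> \<le> \<bar>x\<bar> / ((1 + x\<^sup>2) / 2)"
    using qphi_ge[OF k, of x] by (intro divide_left_mono mult_pos_pos qphi_pos[OF k]) (auto simp: add_pos_nonneg)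
  finally show ?thesis by (simp add: jbracket_sq mult.commute)
qed (simp add: phi_eq_qphi)

definition jbracket_integral :: "real \<Rightarrow> ennreal" where
  "jbracket_integral p = (\<integral>\<^sup>+y. ennreal (jbracket y powr (- p)) \<partial>lborel)"

lemma jbracket_integral_finite:
  assumes p: "1 < p" shows "jbracket_integral p < \<infinity>"
proof -
  let ?f = "\<lambda>y::real. (1 + y) powr (- p)"
  let ?F = "\<lambda>y::real. - ((1 + y) powr (1 - p)) / (p - 1)"
  have *: "(\<integral>\<^sup>+y. ennreal (?f y) * indicator {0..} y \<partial>lborel) = ennreal (0 - ?F 0)"
  proof (rule nn_integral_FTC_atLeast)
    show "(?F \<longlongrightarrow> 0) at_top"
    proof -
      have "((\<lambda>y::real. (1 + y) powr (1 - p)) \<longlongrightarrow> 0) at_top"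
        by (rule tendsto_neg_powr) (use p in \<open>auto intro!: filterlim_tendsto_add_at_top filterlim_ident tendsto_const\<close>)
      then have "((\<lambda>y::real. - ((1 + y) powr (1 - p)) / (p - 1)) \<longlongrightarrow> - 0 / (p - 1)) at_top"
        by (intro tendsto_intros) (use p in auto)
      then show ?thesis by simp
    qed
    fix x :: real assume "0 \<le> x"
    then show "DERIV ?F x :> ?f x" using p
      by (auto intro!: derivative_eq_intros simp: divide_simps)
         (auto simp: algebra_simps)
  qed auto
  have **: "(\<integral>\<^sup>+y. ennreal (?f (0 + (-1) * y)) * indicator {0..} (0 + (-1) * y) \<partial>lborel) = ennreal (0 - ?F 0)"
    using nn_integral_real_affine[of "\<lambda>y. ennreal (?f y) * indicator {0..} y" "-1" 0] * by simp
  define c where "c = ennreal (2 powr p)"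
  have le: "jbracket y powr (- p) \<le> 2 powr p * (1 + \<bar>y\<bar>) powr (- p)" for y
  proof -
    have "((1 + \<bar>y\<bar>) / 2) \<le> jbracket y"
      using jbracket_ge_1[of y] jbracket_ge_abs[of y] by simp
    then have "jbracket y powr (- p) \<le> ((1 + \<bar>y\<bar>) / 2) powr (- p)"
      using p by (intro powr_mono2') auto
    also have "\<dots> = 2 powr p * (1 + \<bar>y\<bar>) powr (- p)"
      by (simp add: powr_divide powr_minus field_simps)
    finally show ?thesis .
  qed
  have "jbracket_integral p \<le> (\<integral>\<^sup>+y. c * (ennreal (?f y) * indicator {0..} y + ennreal (?f (0 + (-1) * y)) * indicator {0..} (0 + (-1) * y)) \<partial>lborel)"
    unfolding jbracket_integral_def
  proof (intro nn_integral_mono)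
    fix y :: real
    show "ennreal (jbracket y powr (- p)) \<le> c * (ennreal (?f y) * indicator {0..} y + ennreal (?f (0 + (-1) * y)) * indicator {0..} (0 + (-1) * y))"
    proof (cases "0 \<le> y")
      case True
      have "ennreal (jbracket y powr (- p)) \<le> c * (ennreal (?f y) * indicator {0..} y)"
        using le[of y] True by (simp add: c_def ennreal_mult[symmetric] del: ennreal_mult'')
      also have "\<dots> \<le> c * (ennreal (?f y) * indicator {0..} y + ennreal (?f (0 + (-1) * y)) * indicator {0..} (0 + (-1) * y))"
        by (intro mult_left_mono) auto
      finally show ?thesis .
    next
      case False
      have "ennreal (jbracket y powr (- p)) \<le> c * (ennreal (?f (0 + (-1) * y)) * indicator {0..} (0 + (-1) * y))"
        using le[of y] False by (simp add: c_def ennreal_mult[symmetric] del: ennreal_mult'')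
      also have "\<dots> \<le> c * (ennreal (?f y) * indicator {0..} y + ennreal (?f (0 + (-1) * y)) * indicator {0..} (0 + (-1) * y))"
        by (intro mult_left_mono) auto
      finally show ?thesis .
    qed
  qed
  also have "\<dots> = c * (ennreal (0 - ?F 0) + ennreal (0 - ?F 0))"
    using * ** by (simp add: nn_integral_cmult nn_integral_add del: mult_minus1)
  also have "\<dots> < \<infinity>"
    unfolding c_def by (simp add: ennreal_mult_less_top)
  finally show ?thesis .
qed

text \<open>A function that moves with speed at least \<open>l\<close> cannot keep \<open>\<langle>\<psi>\<rangle>\<close> small for long. The
  integrand is replaced by its average over the \<open>y\<close> with \<open>\<bar>\<psi>(x) - y\<bar> \<le> 1/2\<close>, on which \<open>\<langle>\<psi>(x)\<rangle>\<close> and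
  \<open>\<langle>y\<rangle>\<close> agree up to a factor 2, and the integrals are interchanged; for fixed \<open>y\<close> the admissible \<open>x\<close> lie within
  distance \<open>1 / l\<close> of each other.\<close>

lemma expanding_integral:
  fixes \<psi> :: "real \<Rightarrow> real"
  assumes E [measurable]: "E \<in> sets borel" and [measurable]: "\<psi> \<in> borel_measurable borel"
    and l: "0 < l" and exp: "\<And>x y. x \<in> E \<Longrightarrow> y \<in> E \<Longrightarrow> l * \<bar>x - y\<bar> \<le> \<bar>\<psi> x - \<psi> y\<bar>"
    and p: "0 \<le> p"
  shows "(\<integral>\<^sup>+x. indicator E x * ennreal (jbracket (\<psi> x) powr (- p)) \<partial>lborel)
           \<le> ennreal (2 powr p * (2 / l)) * jbracket_integral p"
proof -
  define G where "G x y = indicator E x * (indicator {z. \<bar>z - \<psi> x\<bar> \<le> 1 / 2} y * ennreal (2 powr p * jbracket y powr (- p)))" for x y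
  have G [measurable]: "(\<lambda>(x, y). G x y) \<in> borel_measurable (lborel \<Otimes>\<^sub>M lborel)"
    unfolding G_def indicator_def by measurable
  have pt: "indicator E x * ennreal (jbracket (\<psi> x) powr (- p)) \<le> (\<integral>\<^sup>+y. G x y \<partial>lborel)" for x
  proof -
    have le: "jbracket (\<psi> x) powr (- p) \<le> 2 powr p * jbracket y powr (- p)" if "\<bar>y - \<psi> x\<bar> \<le> 1 / 2" for y
    proof -
      have "(jbracket y)\<^sup>2 \<le> (2 * jbracket (\<psi> x))\<^sup>2"
      proof -
        have "y\<^sup>2 \<le> 2 * (\<psi> x)\<^sup>2 + 2 * (y - \<psi> x)\<^sup>2"
          using zero_le_power2[of "y - 2 * \<psi> x"] by (simp add: power2_eq_square algebra_simps)
        moreover have "(y - \<psi> x)\<^sup>2 \<le> (1/2)\<^sup>2"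
          using that by (metis abs_ge_zero power2_abs power_mono)
        ultimately show ?thesis
          by (simp add: power_mult_distrib jbracket_sq power_divide) (smt (verit) zero_le_power2)
      qed
      then have "jbracket y / 2 \<le> jbracket (\<psi> x)"
        using power2_le_imp_le[of "jbracket y" "2 * jbracket (\<psi> x)"] by simp
      then have "jbracket (\<psi> x) powr (- p) \<le> (jbracket y / 2) powr (- p)"
        using p by (intro powr_mono2') auto
      then show ?thesis by (simp add: powr_divide powr_minus field_simps)
    qed
    have "ennreal (jbracket (\<psi> x) powr (- p)) = (\<integral>\<^sup>+y. ennreal (jbracket (\<psi> x) powr (- p)) * indicator {\<psi> x - 1/2..\<psi> x + 1/2} y \<partial>lborel)"
      by (subst nn_integral_cmult_indicator) auto
    also have "\<dots> \<le> (\<integral>\<^sup>+y. indicator {z. \<bar>z - \<psi> x\<bar> \<le> 1 / 2} y * ennreal (2 powr p * jbracket y powr (- p)) \<partial>lborel)"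
    proof (intro nn_integral_mono)
      fix y
      show "ennreal (jbracket (\<psi> x) powr (- p)) * indicator {\<psi> x - 1/2..\<psi> x + 1/2} y
        \<le> indicator {z. \<bar>z - \<psi> x\<bar> \<le> 1 / 2} y * ennreal (2 powr p * jbracket y powr (- p))"
      proof (cases "\<bar>y - \<psi> x\<bar> \<le> 1 / 2")
        case True
        then show ?thesis using le[OF True] by (simp add: indicator_def ennreal_leI)
      next
        case False
        then have "y \<notin> {\<psi> x - 1/2..\<psi> x + 1/2}" unfolding atLeastAtMost_iff by linarith
        then show ?thesis by simp
      qed
    qed
    finally show ?thesis
      unfolding G_def by (auto simp: indicator_def)
  qed
  have fib: "(\<integral>\<^sup>+x. G x y \<partial>lborel) \<le> ennreal (2 / l) * ennreal (2 powr p * jbracket y powr (- p))" for y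
  proof -
    define A where "A = {x \<in> E. \<bar>y - \<psi> x\<bar> \<le> 1 / 2}"
    have [measurable]: "A \<in> sets borel" unfolding A_def by measurable
    \<comment> \<open>\<open>\<psi>\<close> stays in an interval of length 1 on \<open>A\<close>.\<close>
    have diam: "\<bar>x - x'\<bar> \<le> 1 / l" if "x \<in> A" "x' \<in> A" for x x'
    proof -
      have "l * \<bar>x - x'\<bar> \<le> 1" using exp[of x x'] that unfolding A_def mem_Collect_eq by linarith
      then show ?thesis using l by (simp add: field_simps)
    qed
    have "emeasure lborel A \<le> ennreal (2 / l)"
    proof (cases "A = {}")
      case False
      then obtain x0 where "x0 \<in> A" by auto
      then have "A \<subseteq> {x0 - 1/l..x0 + 1/l}" using diam[of _ x0] by force
      then have "emeasure lborel A \<le> emeasure lborel {x0 - 1/l..x0 + 1/l}"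
        by (intro emeasure_mono) auto
      then show ?thesis using l by (simp add: field_simps)
    qed simp
    moreover have "G x y = ennreal (2 powr p * jbracket y powr (- p)) * indicator A x" for x
      by (auto simp: G_def A_def indicator_def)
    ultimately show ?thesis
      by (simp add: nn_integral_cmult_indicator mult.commute[of "ennreal (2 / l)"] mult_left_mono)
  qed
  have "(\<integral>\<^sup>+x. indicator E x * ennreal (jbracket (\<psi> x) powr (- p)) \<partial>lborel) \<le> (\<integral>\<^sup>+x. \<integral>\<^sup>+y. G x y \<partial>lborel \<partial>lborel)"
    by (intro nn_integral_mono pt)
  also have "\<dots> = (\<integral>\<^sup>+y. \<integral>\<^sup>+x. G x y \<partial>lborel \<partial>lborel)"
    by (rule lborel_pair.Fubini'[symmetric]) measurable
  also have "\<dots> \<le> (\<integral>\<^sup>+y. ennreal (2 / l) * ennreal (2 powr p * jbracket y powr (- p)) \<partial>lborel)"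
    by (intro nn_integral_mono fib)
  also have "\<dots> = (\<integral>\<^sup>+y. ennreal (2 powr p * (2 / l)) * ennreal (jbracket y powr (- p)) \<partial>lborel)"
    using l by (intro nn_integral_cong) (simp add: ennreal_mult'[symmetric] mult_ac)
  also have "\<dots> = ennreal (2 powr p * (2 / l)) * jbracket_integral p"
    unfolding jbracket_integral_def by (rule nn_integral_cmult) measurable
  finally show ?thesis .
qed

section \<open>Weighted convolution inequalities\<close>

lemma borel_measurable_fst_prod [measurable]: "fst \<in> borel_measurable (borel :: (real \<times> real) measure)"
  by (intro borel_measurable_continuous_onI continuous_intros)

lemma borel_measurable_snd_prod [measurable]: "snd \<in> borel_measurable (borel :: (real \<times> real) measure)"
  by (intro borel_measurable_continuous_onI continuous_intros)

lemma lborel_distr_reflect: "distr lborel borel (\<lambda>x. a - x) = (lborel :: 'a::euclidean_space measure)"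
proof -
  have "lborel = density (distr lborel borel (\<lambda>x. a + (-1) *\<^sub>R x)) (\<lambda>_. ennreal (\<bar>-1\<bar> ^ DIM('a)))"
    by (rule lborel_affine) simp
  then show ?thesis by (simp add: density_1)
qed

lemma nn_integral_reflect:
  fixes h :: "'a::euclidean_space \<Rightarrow> ennreal"
  assumes [measurable]: "h \<in> borel_measurable borel"
  shows "(\<integral>\<^sup>+x. h (a - x) \<partial>lborel) = integral\<^sup>N lborel h"
  by (subst (2) lborel_distr_reflect[of a, symmetric]) (simp add: nn_integral_distr)

lemma nn_integral_translate:
  fixes h :: "'a::euclidean_space \<Rightarrow> ennreal"
  assumes [measurable]: "h \<in> borel_measurable borel"
  shows "(\<integral>\<^sup>+x. h (x - a) \<partial>lborel) = integral\<^sup>N lborel h"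
proof -
  have "(\<integral>\<^sup>+x. h (x - a) \<partial>lborel) = (\<integral>\<^sup>+x. h (- a + x) \<partial>lborel)" by simp
  also have "\<dots> = integral\<^sup>N lborel h"
    by (subst (2) lborel_distr_plus[of "- a", symmetric]) (simp add: nn_integral_distr)
  finally show ?thesis .
qed

lemma nn_integral_convolution:
  fixes f g :: "'a::euclidean_space \<Rightarrow> ennreal"
  assumes [measurable]: "f \<in> borel_measurable borel" "g \<in> borel_measurable borel"
  shows "(\<integral>\<^sup>+x. \<integral>\<^sup>+y. f y * g (x - y) \<partial>lborel \<partial>lborel) = integral\<^sup>N lborel f * integral\<^sup>N lborel g"
proof -
  have "(\<integral>\<^sup>+x. \<integral>\<^sup>+y. f y * g (x - y) \<partial>lborel \<partial>lborel) = (\<integral>\<^sup>+y. \<integral>\<^sup>+x. f y * g (x - y) \<partial>lborel \<partial>lborel)"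
    by (rule lborel_pair.Fubini') measurable
  also have "\<dots> = (\<integral>\<^sup>+y. f y * integral\<^sup>N lborel g \<partial>lborel)"
    by (simp add: nn_integral_cmult nn_integral_translate)
  finally show ?thesis by (simp add: nn_integral_multc)
qed

text \<open>The three inequalities that follow bound a bilinear convolution form with kernel \<open>M\<close> by a
  uniform \<open>L\<^sup>2\<close> bound on \<open>M\<close>, with one of the three points \<open>x\<close>, \<open>y\<close>, \<open>x - y\<close> frozen. Which point to freeze
  depends on which of the weights in \<open>M\<close> is integrable.\<close>

lemma convolution_CS_output:
  fixes f g :: "'a::euclidean_space \<Rightarrow> ennreal" and M :: "'a \<Rightarrow> 'a \<Rightarrow> ennreal"
  assumes [measurable]: "f \<in> borel_measurable borel" "g \<in> borel_measurable borel"
    "case_prod M \<in> borel_measurable (borel \<Otimes>\<^sub>M borel)"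
    and M: "\<And>x. (\<integral>\<^sup>+y. (M x y)\<^sup>2 \<partial>lborel) \<le> C"
  shows "(\<integral>\<^sup>+x. (\<integral>\<^sup>+y. M x y * (f y * g (x - y)) \<partial>lborel)\<^sup>2 \<partial>lborel)
    \<le> C * ((\<integral>\<^sup>+x. (f x)\<^sup>2 \<partial>lborel) * (\<integral>\<^sup>+x. (g x)\<^sup>2 \<partial>lborel))"
proof -
  have "(\<integral>\<^sup>+y. M x y * (f y * g (x - y)) \<partial>lborel)\<^sup>2 \<le> C * (\<integral>\<^sup>+y. (f y)\<^sup>2 * (g (x - y))\<^sup>2 \<partial>lborel)" for x
  proof -
    have "(\<integral>\<^sup>+y. M x y * (f y * g (x - y)) \<partial>lborel)\<^sup>2 \<le>
      (\<integral>\<^sup>+y. (M x y)\<^sup>2 \<partial>lborel) * (\<integral>\<^sup>+y. (f y * g (x - y))\<^sup>2 \<partial>lborel)"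
      by (rule Cauchy_Schwarz_nn_integral) measurable
    also have "\<dots> \<le> C * (\<integral>\<^sup>+y. (f y * g (x - y))\<^sup>2 \<partial>lborel)"
      by (intro mult_right_mono M) auto
    finally show ?thesis by (simp add: power_mult_distrib)
  qed
  then have "(\<integral>\<^sup>+x. (\<integral>\<^sup>+y. M x y * (f y * g (x - y)) \<partial>lborel)\<^sup>2 \<partial>lborel)
     \<le> (\<integral>\<^sup>+x. C * (\<integral>\<^sup>+y. (f y)\<^sup>2 * (g (x - y))\<^sup>2 \<partial>lborel) \<partial>lborel)"
    by (intro nn_integral_mono)
  also have "\<dots> = C * (\<integral>\<^sup>+x. \<integral>\<^sup>+y. (f y)\<^sup>2 * (g (x - y))\<^sup>2 \<partial>lborel \<partial>lborel)"
    by (subst nn_integral_cmult) auto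
  also have "(\<integral>\<^sup>+x. \<integral>\<^sup>+y. (f y)\<^sup>2 * (g (x - y))\<^sup>2 \<partial>lborel \<partial>lborel) =
      (\<integral>\<^sup>+x. (f x)\<^sup>2 \<partial>lborel) * (\<integral>\<^sup>+x. (g x)\<^sup>2 \<partial>lborel)"
    by (rule nn_integral_convolution) measurable
  finally show ?thesis .
qed

lemma convolution_CS_first:
  fixes f g :: "'a::euclidean_space \<Rightarrow> ennreal" and M :: "'a \<Rightarrow> 'a \<Rightarrow> ennreal"
  assumes [measurable]: "f \<in> borel_measurable borel" "g \<in> borel_measurable borel"
    "case_prod M \<in> borel_measurable (borel \<Otimes>\<^sub>M borel)"
    and M: "\<And>y. (\<integral>\<^sup>+x. (M x y)\<^sup>2 \<partial>lborel) \<le> C"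
  shows "(\<integral>\<^sup>+x. (\<integral>\<^sup>+y. M x y * (f y * g (x - y)) \<partial>lborel)\<^sup>2 \<partial>lborel)
    \<le> C * ((\<integral>\<^sup>+x. (f x)\<^sup>2 \<partial>lborel) * (\<integral>\<^sup>+x. (g x)\<^sup>2 \<partial>lborel))"
proof -
  let ?G = "\<integral>\<^sup>+x. (g x)\<^sup>2 \<partial>lborel"
  have "(\<integral>\<^sup>+y. M x y * (f y * g (x - y)) \<partial>lborel)\<^sup>2 \<le> (\<integral>\<^sup>+y. (M x y)\<^sup>2 * (f y)\<^sup>2 \<partial>lborel) * ?G" for x
  proof -
    have "(\<integral>\<^sup>+y. (M x y * f y) * g (x - y) \<partial>lborel)\<^sup>2 \<le>
      (\<integral>\<^sup>+y. (M x y * f y)\<^sup>2 \<partial>lborel) * (\<integral>\<^sup>+y. (g (x - y))\<^sup>2 \<partial>lborel)"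
      by (rule Cauchy_Schwarz_nn_integral) measurable
    also have "(\<integral>\<^sup>+y. (g (x - y))\<^sup>2 \<partial>lborel) = ?G"
      by (rule nn_integral_reflect[where h="\<lambda>y. (g y)\<^sup>2"]) measurable
    finally show ?thesis by (simp add: power_mult_distrib mult_ac)
  qed
  then have "(\<integral>\<^sup>+x. (\<integral>\<^sup>+y. M x y * (f y * g (x - y)) \<partial>lborel)\<^sup>2 \<partial>lborel)
     \<le> (\<integral>\<^sup>+x. (\<integral>\<^sup>+y. (M x y)\<^sup>2 * (f y)\<^sup>2 \<partial>lborel) * ?G \<partial>lborel)"
    by (intro nn_integral_mono)
  also have "\<dots> = (\<integral>\<^sup>+x. \<integral>\<^sup>+y. (M x y)\<^sup>2 * (f y)\<^sup>2 \<partial>lborel \<partial>lborel) * ?G"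
    by (subst nn_integral_multc) auto
  also have "(\<integral>\<^sup>+x. \<integral>\<^sup>+y. (M x y)\<^sup>2 * (f y)\<^sup>2 \<partial>lborel \<partial>lborel) = (\<integral>\<^sup>+y. \<integral>\<^sup>+x. (M x y)\<^sup>2 * (f y)\<^sup>2 \<partial>lborel \<partial>lborel)"
    by (rule lborel_pair.Fubini') measurable
  also have "\<dots> \<le> (\<integral>\<^sup>+y. C * (f y)\<^sup>2 \<partial>lborel)"
    by (intro nn_integral_mono) (auto simp: nn_integral_multc intro!: mult_right_mono M)
  also have "\<dots> = C * (\<integral>\<^sup>+y. (f y)\<^sup>2 \<partial>lborel)"
    by (rule nn_integral_cmult) measurable
  finally show ?thesis by (simp add: mult_ac mult_right_mono)
qed

lemma convolution_CS_second:
  fixes f g :: "'a::euclidean_space \<Rightarrow> ennreal" and M :: "'a \<Rightarrow> 'a \<Rightarrow> ennreal"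
  assumes [measurable]: "f \<in> borel_measurable borel" "g \<in> borel_measurable borel"
    "case_prod M \<in> borel_measurable (borel \<Otimes>\<^sub>M borel)"
    and M: "\<And>y. (\<integral>\<^sup>+x. (M x (x - y))\<^sup>2 \<partial>lborel) \<le> C"
  shows "(\<integral>\<^sup>+x. (\<integral>\<^sup>+y. M x y * (f y * g (x - y)) \<partial>lborel)\<^sup>2 \<partial>lborel)
    \<le> C * ((\<integral>\<^sup>+x. (f x)\<^sup>2 \<partial>lborel) * (\<integral>\<^sup>+x. (g x)\<^sup>2 \<partial>lborel))"
proof -
  have "(\<integral>\<^sup>+y. M x y * (f y * g (x - y)) \<partial>lborel) = (\<integral>\<^sup>+y. M x (x - y) * (g y * f (x - y)) \<partial>lborel)" for x
    by (subst nn_integral_reflect[where a=x, symmetric]) (auto simp: mult_ac)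
  then have "(\<integral>\<^sup>+x. (\<integral>\<^sup>+y. M x y * (f y * g (x - y)) \<partial>lborel)\<^sup>2 \<partial>lborel)
     = (\<integral>\<^sup>+x. (\<integral>\<^sup>+y. M x (x - y) * (g y * f (x - y)) \<partial>lborel)\<^sup>2 \<partial>lborel)" by simp
  also have "\<dots> \<le> C * ((\<integral>\<^sup>+x. (g x)\<^sup>2 \<partial>lborel) * (\<integral>\<^sup>+x. (f x)\<^sup>2 \<partial>lborel))"
    by (rule convolution_CS_first[where M="\<lambda>x y. M x (x - y)"]) (use M in measurable)
  finally show ?thesis by (simp add: mult.commute)
qed

text \<open>The modulus in \<open>\<bar>\<tau>\<bar> - \<phi>(\<xi>)\<close> means that there are two characteristic curves, \<open>\<tau> = \<phi>(\<xi>)\<close> and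
  \<open>\<tau> = - \<phi>(\<xi>)\<close>. The weight is bounded by the sum of the weights of the two curves, and only the latter are
  translation invariant in \<open>\<tau>\<close>.\<close>

lemma jbracket_modulation_le:
  assumes "0 \<le> p"
  shows "jbracket (\<bar>y\<bar> - c) powr (- p) \<le> jbracket (y - c) powr (- p) + jbracket (y + c) powr (- p)"
proof (cases "0 \<le> y")
  case False
  then have "jbracket (\<bar>y\<bar> - c) = jbracket (y + c)"
    using jbracket_minus[of "y + c"] by (simp add: minus_add)
  then show ?thesis by simp
qed simp

lemma jbracket_integral_shift:
  "(\<integral>\<^sup>+y. ennreal (jbracket (y - c) powr (- p)) \<partial>lborel) = jbracket_integral p"
  unfolding jbracket_integral_def by (rule nn_integral_translate[where h="\<lambda>y. ennreal (jbracket y powr (- p))"]) measurable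

lemma jbracket_integral_modulation:
  assumes "0 \<le> p"
  shows "(\<integral>\<^sup>+y. ennreal (jbracket (\<bar>y - a\<bar> - c) powr (- p)) \<partial>lborel) \<le> 2 * jbracket_integral p"
proof -
  have "(\<integral>\<^sup>+y. ennreal (jbracket (\<bar>y - a\<bar> - c) powr (- p)) \<partial>lborel)
    \<le> (\<integral>\<^sup>+y. ennreal (jbracket (y - (a + c)) powr (- p)) + ennreal (jbracket (y - (a - c)) powr (- p)) \<partial>lborel)"
    using jbracket_modulation_le[OF assms, of "_ - a" c]
    by (intro nn_integral_mono) (simp add: ennreal_plus[symmetric] algebra_simps ennreal_leI del: ennreal_plus)
  also have "\<dots> = jbracket_integral p + jbracket_integral p"
    by (subst nn_integral_add) (auto simp: jbracket_integral_shift)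
  finally show ?thesis by (simp add: mult_2)
qed

section \<open>Pointwise bounds for the quadratic kernel\<close>

text \<open>The three modulations combine to a resonance function. Since each of \<open>\<bar>\<tau>\<bar>\<close>, \<open>\<bar>\<tau>1\<bar>\<close>, \<open>\<bar>\<tau>2\<bar>\<close> is at most the
  sum of the other two, every one of the differences \<open>\<phi> - \<phi>\<^sub>1 - \<phi>\<^sub>2\<close>, \<open>\<phi>\<^sub>1 - \<phi> - \<phi>\<^sub>2\<close>, \<open>\<phi>\<^sub>2 - \<phi> - \<phi>\<^sub>1\<close> is at most the sum of
  the modulations, and the signs of the \<open>\<tau>\<close>'s do not matter. The largest of the three
  frequencies is the sum of the two others in absolute value, so \<open>phi_resonance\<close> applies to it; its parameter
  \<open>d\<close> is the smallest frequency, which is at least \<open>\<bar>\<xi>\<bar> / 16\<close>.\<close>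

lemma modulation_triangle:
  assumes "\<tau> = \<tau>1 + \<tau>2" and "\<xi> = \<xi>1 + \<xi>2" and k: "\<bar>k\<bar> \<le> 1"
    and N: "N = max \<bar>\<xi>1\<bar> \<bar>\<xi>2\<bar>" "4 \<le> N" "N \<le> 8 * min \<bar>\<xi>1\<bar> \<bar>\<xi>2\<bar>"
  shows "\<bar>\<xi>\<bar> * N\<^sup>2 / 32 \<le> \<bar>\<bar>\<tau>\<bar> - phi k \<xi>\<bar> + \<bar>\<bar>\<tau>1\<bar> - phi k \<xi>1\<bar> + \<bar>\<bar>\<tau>2\<bar> - phi k \<xi>2\<bar>"
proof -
  define S where "S = \<bar>\<bar>\<tau>\<bar> - phi k \<xi>\<bar> + \<bar>\<bar>\<tau>1\<bar> - phi k \<xi>1\<bar> + \<bar>\<bar>\<tau>2\<bar> - phi k \<xi>2\<bar>"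
  have tri: "phi k \<xi> - phi k \<xi>1 - phi k \<xi>2 \<le> S" "phi k \<xi>1 - phi k \<xi> - phi k \<xi>2 \<le> S"
      "phi k \<xi>2 - phi k \<xi> - phi k \<xi>1 \<le> S"
    using assms(1) unfolding S_def by linarith+
  have res: "d * N\<^sup>2 / 2 \<le> S"
    if "0 \<le> d" "d \<le> b" "N \<le> b + d" "phi k (b + d) - phi k b - phi k d \<le> S" for b d
  proof -
    have "d * N\<^sup>2 / 2 \<le> d * (b + d)\<^sup>2 / 2"
      using that(1-3) N(2) by (intro divide_right_mono mult_left_mono power_mono) auto
    also have "\<dots> \<le> phi k (b + d) - phi k b - phi k d"
      using that(1-3) N(2) by (intro phi_resonance[OF k]) auto
    finally show ?thesis using that(4) by linarith
  qed
  have fin: "\<bar>\<xi>\<bar> * N\<^sup>2 / 32 \<le> S" if "\<bar>\<xi>\<bar> / 16 \<le> d" "d * N\<^sup>2 / 2 \<le> S" for d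
  proof -
    have "\<bar>\<xi>\<bar> / 16 * N\<^sup>2 \<le> d * N\<^sup>2" using that(1) by (intro mult_right_mono) auto
    then show ?thesis using that(2) by linarith
  qed
  have *: "\<bar>\<xi>\<bar> * N\<^sup>2 / 32 \<le> S" if ord: "\<bar>a\<bar> \<le> \<bar>c\<bar>" and ac: "{a, c} = {\<xi>1, \<xi>2}" "\<xi> = a + c" for a c
  proof -
    have Na: "N = \<bar>c\<bar>" "N \<le> 8 * \<bar>a\<bar>" using N(1,3) ord ac(1) unfolding doubleton_eq_iff max_def min_def by (auto split: if_splits)
    have Sac: "phi k \<xi> - phi k c - phi k a \<le> S" "phi k c - phi k a - phi k \<xi> \<le> S"
       "phi k c - phi k \<xi> - phi k a \<le> S"
      using tri ac(1) unfolding doubleton_eq_iff by (elim disjE conjE; hypsubst; linarith)+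
    \<comment> \<open>The largest frequency is the output \<open>\<xi>\<close> if the inputs have equal sign, and otherwise the larger input \<open>c\<close>.\<close>
    consider "\<bar>\<xi>\<bar> = \<bar>c\<bar> + \<bar>a\<bar>" | "\<bar>c\<bar> = \<bar>a\<bar> + \<bar>\<xi>\<bar>" "\<bar>\<xi>\<bar> \<le> \<bar>a\<bar>" | "\<bar>c\<bar> = \<bar>\<xi>\<bar> + \<bar>a\<bar>" "\<bar>a\<bar> \<le> \<bar>\<xi>\<bar>"
      using ord ac by linarith
    then show ?thesis
    proof cases
      case H1: 1
      have S': "phi k (\<bar>c\<bar> + \<bar>a\<bar>) - phi k \<bar>c\<bar> - phi k \<bar>a\<bar> \<le> S"
        using Sac H1 by (metis phi_minus(2))
      show ?thesis
      proof (rule fin[of "\<bar>a\<bar>"], goal_cases)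
        case 1 show ?case using Na N(2) H1 ord by linarith
      next
        case 2 show ?case by (rule res[of "\<bar>a\<bar>" "\<bar>c\<bar>"]) (use Na N(2) H1 ord S' in linarith)+
      qed
    next
      case H2: 2
      have S': "phi k (\<bar>a\<bar> + \<bar>\<xi>\<bar>) - phi k \<bar>a\<bar> - phi k \<bar>\<xi>\<bar> \<le> S"
        using Sac H2 by (metis phi_minus(2))
      show ?thesis
      proof (rule fin[of "\<bar>\<xi>\<bar>"], goal_cases)
        case 1 show ?case using Na N(2) H2 ord by linarith
      next
        case 2 show ?case by (rule res[of "\<bar>\<xi>\<bar>" "\<bar>a\<bar>"]) (use Na N(2) H2 ord S' in linarith)+
      qed
    next
      case H3: 3
      have S': "phi k (\<bar>\<xi>\<bar> + \<bar>a\<bar>) - phi k \<bar>\<xi>\<bar> - phi k \<bar>a\<bar> \<le> S"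
        using Sac H3 by (metis phi_minus(2))
      show ?thesis
      proof (rule fin[of "\<bar>a\<bar>"], goal_cases)
        case 1 show ?case using Na N(2) H3 ord by linarith
      next
        case 2 show ?case by (rule res[of "\<bar>a\<bar>" "\<bar>\<xi>\<bar>"]) (use Na N(2) H3 ord S' in linarith)+
      qed
    qed
  qed
  show ?thesis
    unfolding S_def[symmetric] using *[of \<xi>1 \<xi>2] *[of \<xi>2 \<xi>1] assms(2) insert_commute[of \<xi>1 \<xi>2 "{}"] add.commute[of \<xi>1 \<xi>2]
      linear[of "\<bar>\<xi>1\<bar>" "\<bar>\<xi>2\<bar>"] by metis
qed

text \<open>The part of the quadratic kernel that depends on the frequencies only: the multiplier bound
  \<open>\<bar>\<xi>\<bar> / \<langle>\<xi>\<rangle>\<^sup>2\<close>, the two derivatives on the second factor, and the spatial weights of output and inputs.\<close>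

definition freq_weight :: "real \<Rightarrow> real \<Rightarrow> real \<Rightarrow> real" where
  "freq_weight s \<xi>1 \<xi>2 = \<bar>\<xi>1 + \<xi>2\<bar> * jbracket (\<xi>1 + \<xi>2) powr (s - 2) * \<xi>2\<^sup>2
     * jbracket \<xi>1 powr (- s) * jbracket \<xi>2 powr (- s)"

text \<open>The low--high region, in which the two inputs travel at very different group velocities.\<close>

definition transversal :: "real \<Rightarrow> real \<Rightarrow> bool" where
  "transversal \<xi>1 \<xi>2 \<longleftrightarrow> 4 \<le> max \<bar>\<xi>1\<bar> \<bar>\<xi>2\<bar> \<and> 8 * min \<bar>\<xi>1\<bar> \<bar>\<xi>2\<bar> \<le> max \<bar>\<xi>1\<bar> \<bar>\<xi>2\<bar>"

lemma jbracket_powr_le: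
  assumes "0 < x" "x \<le> jbracket y" "p \<le> 0"
  shows "jbracket y powr p \<le> x powr p"
  using assms by (intro powr_mono2') auto

lemma jbracket_powr_le_1: "p \<le> 0 \<Longrightarrow> jbracket y powr p \<le> 1"
  using jbracket_powr_le[of 1 y p] jbracket_ge_1[of y] by simp

lemma freq_weight_nonneg: "0 \<le> freq_weight s \<xi>1 \<xi>2"
  by (simp add: freq_weight_def)

lemma freq_weight_low:
  assumes s: "1 / 2 < s" "s \<le> 5 / 8" and N: "max \<bar>\<xi>1\<bar> \<bar>\<xi>2\<bar> \<le> 4"
  shows "(freq_weight s \<xi>1 \<xi>2)\<^sup>2 \<le> 2^14 * 27 * jbracket (\<xi>1 + \<xi>2) powr (- (3 / 2))"
proof -
  have x: "\<bar>\<xi>1 + \<xi>2\<bar> \<le> 8" "\<xi>2\<^sup>2 \<le> 4\<^sup>2" using N abs_le_square_iff[of \<xi>2 4] by auto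
  have "freq_weight s \<xi>1 \<xi>2 \<le> 8 * 1 * 4\<^sup>2 * 1 * 1"
    unfolding freq_weight_def using x s
    by (intro mult_mono jbracket_powr_le_1) auto
  then have "(freq_weight s \<xi>1 \<xi>2)\<^sup>2 \<le> (8 * 1 * 4\<^sup>2 * 1 * 1)\<^sup>2"
    by (intro power_mono freq_weight_nonneg)
  moreover have "1 \<le> 27 * jbracket (\<xi>1 + \<xi>2) powr (- (3 / 2))"
  proof -
    have "jbracket (\<xi>1 + \<xi>2) \<le> 9" using jbracket_le_abs[of "\<xi>1 + \<xi>2"] x by linarith
    then have "9 powr (- (3 / 2)) \<le> jbracket (\<xi>1 + \<xi>2) powr (- (3 / 2))"
      by (intro powr_mono2') auto
    moreover have "(9::real) powr (- (3 / 2)) = 1 / 27"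
    proof -
      have "(9::real) powr (3 / 2) = (9 powr (1/2)) ^ 3"
        by (simp add: powr_power)
      also have "\<dots> = 27" by (simp add: powr_half_sqrt)
      finally show ?thesis by (simp add: powr_minus field_simps)
    qed
    ultimately show ?thesis by simp
  qed
  ultimately show ?thesis by simp
qed

text \<open>In this region the output frequency is comparable to the larger input frequency \<open>N\<close>, so the output weight
  cancels the weight of that input; what is left is a loss of exactly one derivative.\<close>

lemma freq_weight_transversal:
  assumes s: "1 / 2 < s" "s \<le> 5 / 8" and "transversal \<xi>1 \<xi>2"
  shows "(freq_weight s \<xi>1 \<xi>2)\<^sup>2 \<le> 16 * (\<xi>1 + \<xi>2)\<^sup>2"
proof -
  define N where "N = max \<bar>\<xi>1\<bar> \<bar>\<xi>2\<bar>"
  define x where "x = \<bar>\<xi>1 + \<xi>2\<bar>"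
  have N: "4 \<le> N" "8 * min \<bar>\<xi>1\<bar> \<bar>\<xi>2\<bar> \<le> N" using assms by (auto simp: transversal_def N_def)
  have "\<bar>\<xi>2\<bar> \<le> x + \<bar>\<xi>1\<bar>" "\<bar>\<xi>1\<bar> \<le> x + \<bar>\<xi>2\<bar>" unfolding x_def by linarith+
  then have x: "N \<le> 2 * x" using N unfolding N_def
    by (auto simp: max_def min_def split: if_splits)
  with N have x: "N \<le> 2 * x" "0 < x" by linarith+
  have prod: "jbracket \<xi>1 powr (- s) * jbracket \<xi>2 powr (- s) \<le> N powr (- s)"
  proof (cases "\<bar>\<xi>1\<bar> \<le> \<bar>\<xi>2\<bar>")
    case True
    then have "jbracket \<xi>1 powr (- s) * jbracket \<xi>2 powr (- s) \<le> 1 * N powr (- s)"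
      using s N jbracket_ge_abs[of \<xi>2] by (intro mult_mono jbracket_powr_le_1 jbracket_powr_le) (auto simp: N_def)
    then show ?thesis by simp
  next
    case False
    then have "jbracket \<xi>1 powr (- s) * jbracket \<xi>2 powr (- s) \<le> N powr (- s) * 1"
      using s N jbracket_ge_abs[of \<xi>1] by (intro mult_mono jbracket_powr_le_1 jbracket_powr_le) (auto simp: N_def)
    then show ?thesis by simp
  qed
  have sq: "\<xi>2\<^sup>2 \<le> N\<^sup>2" by (simp add: N_def abs_le_square_iff[symmetric])
  have "freq_weight s \<xi>1 \<xi>2 = x * jbracket (\<xi>1 + \<xi>2) powr (s - 2) * \<xi>2\<^sup>2 * (jbracket \<xi>1 powr (- s) * jbracket \<xi>2 powr (- s))"
    by (simp add: freq_weight_def x_def)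
  also have "\<dots> \<le> x * x powr (s - 2) * N\<^sup>2 * N powr (- s)"
    using x s sq prod jbracket_ge_abs[of "\<xi>1 + \<xi>2"] by (intro mult_mono jbracket_powr_le) (auto simp: x_def)
  also have "\<dots> = x powr (s - 1) * N powr (2 - s)"
  proof -
    have "x * x powr (s - 2) = x powr (s - 1)"
      using x powr_add[of x 1 "s - 2"] by simp
    moreover have "N\<^sup>2 * N powr (- s) = N powr (2 - s)"
      using N powr_add[of N 2 "- s"] by simp
    ultimately show ?thesis by (simp add: mult.assoc)
  qed
  also have "\<dots> \<le> x powr (s - 1) * (2 * x) powr (2 - s)"
    using x N s by (intro mult_left_mono powr_mono2) auto
  also have "\<dots> = 2 powr (2 - s) * (x powr (s - 1) * x powr (2 - s))"
    using x by (simp add: powr_mult mult_ac)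
  also have "x powr (s - 1) * x powr (2 - s) = x"
    using x by (simp add: powr_add[symmetric])
  also have "2 powr (2 - s) * x \<le> 2 powr 2 * x"
    using s x by (intro mult_right_mono powr_mono) auto
  finally have "freq_weight s \<xi>1 \<xi>2 \<le> 4 * x" by simp
  then have "(freq_weight s \<xi>1 \<xi>2)\<^sup>2 \<le> (4 * x)\<^sup>2"
    by (intro power_mono freq_weight_nonneg)
  then show ?thesis by (simp add: x_def power_mult_distrib)
qed

text \<open>Here the output frequency may be much smaller than \<open>N\<close>, and the squared weight loses \<open>N\<^sup>4\<^sup>-\<^sup>4\<^sup>s\<close>. A
  modulation \<open>T\<close> of size \<open>\<bar>\<xi>\<bar> N\<^sup>2\<close> to the power \<open>2 b - 2\<close> returns \<open>N\<^sup>4\<^sup>b\<^sup>-\<^sup>4\<close>, which suffices because \<open>b \<le> s\<close>. It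
  costs a power of the output frequency; what remains is \<open>\<langle>\<xi>\<rangle>\<^sup>2\<^sup>b\<^sup>+\<^sup>2\<^sup>s\<^sup>-\<^sup>4\<close>, and \<open>b, s \<le> 5/8\<close> makes the exponent
  at most \<open>- 3/2\<close>.\<close>

lemma freq_weight_comparable:
  assumes s: "1 / 2 < b" "b \<le> s" "s \<le> 5 / 8" and "4 \<le> N" "N = max \<bar>\<xi>1\<bar> \<bar>\<xi>2\<bar>" "N \<le> 8 * min \<bar>\<xi>1\<bar> \<bar>\<xi>2\<bar>"
    and T: "\<bar>\<xi>1 + \<xi>2\<bar> * N\<^sup>2 / 96 \<le> \<bar>T\<bar>"
  shows "(freq_weight s \<xi>1 \<xi>2)\<^sup>2 * jbracket T powr (2 * b - 2) \<le> 2^12 * 96 * jbracket (\<xi>1 + \<xi>2) powr (- (3 / 2))"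
proof (cases "\<xi>1 + \<xi>2 = 0")
  case True
  then show ?thesis by (simp add: freq_weight_def)
next
  case False
  define x where "x = \<bar>\<xi>1 + \<xi>2\<bar>"
  define J where "J = jbracket (\<xi>1 + \<xi>2)"
  have x: "0 < x" using False by (simp add: x_def)
  have J: "x \<le> J" "1 \<le> J" using jbracket_ge_abs jbracket_ge_1 by (auto simp: x_def J_def)
  have N: "4 \<le> N" by fact
  have sq: "\<xi>2\<^sup>2 \<le> N\<^sup>2" using assms(5) by (simp add: abs_le_square_iff[symmetric])
  have pr: "jbracket y powr (- s) \<le> 8 * N powr (- s)" if "N \<le> 8 * \<bar>y\<bar>" for y
  proof -
    have "jbracket y powr (- s) \<le> (N / 8) powr (- s)"
      using that N s jbracket_ge_abs[of y] by (intro jbracket_powr_le) auto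
    also have "\<dots> = 8 powr s * N powr (- s)" using N by (simp add: powr_divide powr_minus field_simps)
    also have "\<dots> \<le> 8 powr 1 * N powr (- s)" using s by (intro mult_right_mono powr_mono) auto
    finally show ?thesis by simp
  qed
  have pr1: "jbracket \<xi>1 powr (- s) \<le> 8 * N powr (- s)" and pr2: "jbracket \<xi>2 powr (- s) \<le> 8 * N powr (- s)"
    using assms(6) by (auto intro!: pr)
  have "freq_weight s \<xi>1 \<xi>2 \<le> x * J powr (s - 2) * N\<^sup>2 * (8 * N powr (- s)) * (8 * N powr (- s))"
    unfolding freq_weight_def x_def[symmetric] J_def[symmetric] using pr1 pr2 sq x
    by (intro mult_mono) auto
  also have "\<dots> = 64 * x * J powr (s - 2) * N powr (2 - 2 * s)"
    using N powr_add[of N 2 "- s"] powr_add[of N "2 - s" "- s"] by (simp add: mult_ac)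
  finally have "(freq_weight s \<xi>1 \<xi>2)\<^sup>2 \<le> (64 * x * J powr (s - 2) * N powr (2 - 2 * s))\<^sup>2"
    by (intro power_mono freq_weight_nonneg)
  also have "\<dots> = 2^12 * (x powr 2 * J powr (2 * s - 4) * N powr (4 - 4 * s))"
    using x J N by (simp add: power_mult_distrib powr_power algebra_simps)
  finally have 1: "(freq_weight s \<xi>1 \<xi>2)\<^sup>2 \<le> 2^12 * (x powr 2 * J powr (2 * s - 4) * N powr (4 - 4 * s))" .
  have "jbracket T powr (2 * b - 2) \<le> (x * N\<^sup>2 / 96) powr (2 * b - 2)"
    using T x N s jbracket_ge_abs[of T] by (intro jbracket_powr_le) (auto simp: x_def)
  also have "\<dots> = (1 / 96) powr (2 * b - 2) * (x powr (2 * b - 2) * N powr (4 * b - 4))"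
  proof -
    have "x * N\<^sup>2 / 96 = (1 / 96) * (x * N powr 2)" using N by simp
    then show ?thesis
      using x N by (simp only: powr_mult powr_powr) (simp add: algebra_simps)
  qed
  also have "(1 / 96) powr (2 * b - 2) = (96::real) powr (2 - 2 * b)"
    by (simp add: powr_divide powr_minus[symmetric] divide_powr_uminus)
  also have "\<dots> \<le> (96::real) powr 1" using s by (intro powr_mono) auto
  finally have 2: "jbracket T powr (2 * b - 2) \<le> 96 * (x powr (2 * b - 2) * N powr (4 * b - 4))"
    by (simp add: mult_right_mono)
  have "(freq_weight s \<xi>1 \<xi>2)\<^sup>2 * jbracket T powr (2 * b - 2) \<le>
     (2^12 * (x powr 2 * J powr (2 * s - 4) * N powr (4 - 4 * s))) * (96 * (x powr (2 * b - 2) * N powr (4 * b - 4)))"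
    by (intro mult_mono 1 2) auto
  also have "\<dots> = 2^12 * 96 * ((x powr 2 * x powr (2 * b - 2)) * J powr (2 * s - 4) * (N powr (4 - 4 * s) * N powr (4 * b - 4)))"
    by (simp only: mult_ac)
  also have "\<dots> = 2^12 * 96 * (x powr (2 * b) * J powr (2 * s - 4) * N powr (4 * b - 4 * s))"
    by (simp only: powr_add[symmetric]) (simp add: algebra_simps)
  also have "\<dots> \<le> 2^12 * 96 * (J powr (2 * b) * J powr (2 * s - 4) * 1)"
  proof (intro mult_mono mult_left_mono)
    show "x powr (2 * b) \<le> J powr (2 * b)" using J x s by (intro powr_mono2) auto
    have "N powr (4 * b - 4 * s) \<le> N powr 0" using s N by (intro powr_mono) auto
    then show "N powr (4 * b - 4 * s) \<le> 1" using N by simp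
  qed auto
  also have "J powr (2 * b) * J powr (2 * s - 4) * 1 = J powr (2 * b + 2 * s - 4)"
    by (simp add: powr_add[symmetric] algebra_simps)
  also have "2^12 * 96 * J powr (2 * b + 2 * s - 4) \<le> 2^12 * 96 * J powr (- (3 / 2))"
    using s J by (intro mult_left_mono powr_mono) auto
  finally show ?thesis by (simp add: J_def)
qed

text \<open>The squared kernel splits into three terms, one for each way to apply Cauchy--Schwarz: the first two have an
  integrable weight in the output frequency and one input modulation, the third one keeps both input modulations on
  the transversal region. In the comparable region one modulation is large; if it belongs to an input, its exponent
  \<open>- 2 b\<close> is weakened to \<open>2 b - 2\<close>, and the other input keeps its weight.\<close>

lemma kernel_bound:
  fixes \<xi>1 \<xi>2 \<tau> \<tau>1 \<tau>2 k s b :: real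
  assumes s: "1 / 2 < b" "b \<le> s" "s \<le> 5 / 8" and k: "\<bar>k\<bar> \<le> 1"
    and t: "\<tau> = \<tau>1 + \<tau>2"
  defines "T0 \<equiv> \<bar>\<tau>\<bar> - phi k (\<xi>1 + \<xi>2)" and "T1 \<equiv> \<bar>\<tau>1\<bar> - phi k \<xi>1" and "T2 \<equiv> \<bar>\<tau>2\<bar> - phi k \<xi>2"
  shows "(freq_weight s \<xi>1 \<xi>2)\<^sup>2 * (jbracket T0 powr (2 * b - 2) * jbracket T1 powr (- 2 * b) * jbracket T2 powr (- 2 * b))
    \<le> 2^19 * (jbracket (\<xi>1 + \<xi>2) powr (- (3/2)) * jbracket T1 powr (- 2 * b)
            + jbracket (\<xi>1 + \<xi>2) powr (- (3/2)) * jbracket T2 powr (- 2 * b)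
            + of_bool (transversal \<xi>1 \<xi>2) * (\<xi>1 + \<xi>2)\<^sup>2 * jbracket T1 powr (- 2 * b) * jbracket T2 powr (- 2 * b))"
proof -
  define N where "N = max \<bar>\<xi>1\<bar> \<bar>\<xi>2\<bar>"
  define W where "W = (freq_weight s \<xi>1 \<xi>2)\<^sup>2"
  define w where "w = jbracket (\<xi>1 + \<xi>2) powr (- (3/2))"
  define a0 a1 a2 where "a0 = jbracket T0 powr (2 * b - 2)" and "a1 = jbracket T1 powr (- 2 * b)" and "a2 = jbracket T2 powr (- 2 * b)"
  have W: "0 \<le> W" by (simp add: W_def)
  have w: "0 \<le> w" by (simp add: w_def)
  have a: "0 \<le> a0" "0 \<le> a1" "0 \<le> a2" "a0 \<le> 1" "a1 \<le> 1" "a2 \<le> 1"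
    using s by (auto simp: a0_def a1_def a2_def intro!: jbracket_powr_le_1)
  let ?t = "of_bool (transversal \<xi>1 \<xi>2) * (\<xi>1 + \<xi>2)\<^sup>2 * a1 * a2"
  have t0: "0 \<le> ?t" using a by simp
  have "W * (a0 * a1 * a2) \<le> 2^19 * (w * a1 + w * a2 + ?t)"
  proof (cases "N < 4")
    case True
    have "W \<le> 2^14 * 27 * w"
      unfolding W_def w_def by (rule freq_weight_low) (use s True in \<open>auto simp: N_def\<close>)
    then have "W * (a0 * a1 * a2) \<le> (2^14 * 27 * w) * (1 * 1 * a2)"
      using a W w by (intro mult_mono) auto
    also have "\<dots> \<le> 2^19 * (w * a2)" using w a by simp
    also have "\<dots> \<le> 2^19 * (w * a1 + w * a2 + ?t)" using w a t0 by (intro mult_left_mono) auto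
    finally show ?thesis .
  next
    case False
    show ?thesis
    proof (cases "transversal \<xi>1 \<xi>2")
      case True
      have "W \<le> 16 * (\<xi>1 + \<xi>2)\<^sup>2"
        unfolding W_def by (rule freq_weight_transversal) (use s True in auto)
      then have "W * (a0 * a1 * a2) \<le> (16 * (\<xi>1 + \<xi>2)\<^sup>2) * (1 * a1 * a2)"
        using a W w by (intro mult_mono) auto
      also have "\<dots> \<le> 2^19 * ?t" using a True by simp
      also have "\<dots> \<le> 2^19 * (w * a1 + w * a2 + ?t)" using w a t0 by (intro mult_left_mono) auto
      finally show ?thesis .
    next
      case F: False
      have N: "4 \<le> N" "N \<le> 8 * min \<bar>\<xi>1\<bar> \<bar>\<xi>2\<bar>" using F False unfolding transversal_def N_def[symmetric] by auto
      have "\<bar>\<xi>1 + \<xi>2\<bar> * N\<^sup>2 / 32 \<le> \<bar>T0\<bar> + \<bar>T1\<bar> + \<bar>T2\<bar>"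
        unfolding T0_def T1_def T2_def by (rule modulation_triangle[OF t refl k N_def N])
      moreover have "\<exists>T\<in>{T0, T1, T2}. r / 96 \<le> \<bar>T\<bar>" if "r / 32 \<le> \<bar>T0\<bar> + \<bar>T1\<bar> + \<bar>T2\<bar>" for r
      proof (rule ccontr)
        assume "\<not> ?thesis"
        then have "\<bar>T0\<bar> < r / 96" "\<bar>T1\<bar> < r / 96" "\<bar>T2\<bar> < r / 96" by (simp_all add: not_le)
        with that show False by linarith
      qed
      ultimately have "\<exists>T\<in>{T0, T1, T2}. \<bar>\<xi>1 + \<xi>2\<bar> * N\<^sup>2 / 96 \<le> \<bar>T\<bar>"
        by blast
      then obtain T where T: "T \<in> {T0, T1, T2}" "\<bar>\<xi>1 + \<xi>2\<bar> * N\<^sup>2 / 96 \<le> \<bar>T\<bar>" by blast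
      define aT where "aT = jbracket T powr (2 * b - 2)"
      have WT: "W * aT \<le> 2^19 * w"
      proof -
        have "W * aT \<le> 2^12 * 96 * w"
          unfolding W_def w_def aT_def by (rule freq_weight_comparable[OF s N(1) N_def N(2) T(2)])
        also have "\<dots> \<le> 2^19 * w" using w by simp
        finally show ?thesis .
      qed
      have aT: "0 \<le> aT" by (simp add: aT_def)
      have mono: "jbracket T powr (- 2 * b) \<le> aT"
        unfolding aT_def using s jbracket_ge_1[of T] by (intro powr_mono) auto
      have "a0 * a1 * a2 \<le> aT * (a1 + a2)"
        using T(1)
      proof (elim insertE)
        assume "T = T0"
        have "a0 * a1 * a2 \<le> a0 * 1 * a2" using a by (intro mult_mono) auto
        also have "\<dots> \<le> a0 * (a1 + a2)" using a by (simp add: algebra_simps)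
        finally show ?thesis using \<open>T = T0\<close> by (simp add: aT_def a0_def)
      next
        assume "T = T1"
        have "a0 * a1 * a2 \<le> 1 * aT * a2" using a aT mono \<open>T = T1\<close> by (intro mult_mono) (auto simp: a1_def)
        also have "\<dots> \<le> aT * (a1 + a2)" using a by (simp add: algebra_simps aT_def)
        finally show ?thesis .
      next
        assume "T = T2"
        have "a0 * a1 * a2 \<le> 1 * a1 * aT" using a aT mono \<open>T = T2\<close> by (intro mult_mono) (auto simp: a2_def)
        also have "\<dots> \<le> aT * (a1 + a2)" using a by (simp add: algebra_simps aT_def)
        finally show ?thesis .
      qed auto
      then have "W * (a0 * a1 * a2) \<le> W * (aT * (a1 + a2))"
        using W by (intro mult_left_mono) auto
      also have "\<dots> = (W * aT) * (a1 + a2)" by simp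
      also have "\<dots> \<le> (2^19 * w) * (a1 + a2)" using a by (intro mult_right_mono WT) auto
      also have "\<dots> \<le> 2^19 * (w * a1 + w * a2 + ?t)" using t0 by (simp add: algebra_simps)
      finally show ?thesis .
    qed
  qed
  then show ?thesis unfolding W_def w_def a0_def a1_def a2_def .
qed

text \<open>With \<open>\<xi>\<close> fixed, the high frequency \<open>\<xi> - x\<close> has size at least \<open>8 \<bar>\<xi>\<bar> / 9\<close> and the low one \<open>x\<close> at most
  \<open>\<bar>\<xi>\<bar> / 7\<close>. The lower bound for the speed of \<open>\<phi>(\<xi> - x)\<close> therefore exceeds the Lipschitz bound for \<open>\<phi>(x)\<close> by at least \<open>\<xi>\<^sup>2 / 2\<close>, for
  all signs \<open>e1\<close>, \<open>e2\<close>.\<close>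

lemma transversal_expanding:
  assumes k: "\<bar>k\<bar> \<le> 1" and e: "e1 \<in> {1, -1}" "e2 \<in> {1, -1}" and xi: "\<xi> \<noteq> 0"
    and x: "4 \<le> \<bar>\<xi> - x\<bar>" "8 * \<bar>x\<bar> \<le> \<bar>\<xi> - x\<bar>" and y: "4 \<le> \<bar>\<xi> - y\<bar>" "8 * \<bar>y\<bar> \<le> \<bar>\<xi> - y\<bar>"
  shows "\<xi>\<^sup>2 / 2 * \<bar>x - y\<bar> \<le> \<bar>(c + e1 * phi k x + e2 * phi k (\<xi> - x)) - (c + e1 * phi k y + e2 * phi k (\<xi> - y))\<bar>"
proof -
  define X where "X = \<bar>\<xi>\<bar>"
  have X: "3.5 \<le> X" unfolding X_def using x by linarith
  have X2: "3.5\<^sup>2 \<le> X\<^sup>2" using X by (intro power_mono) auto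
  \<comment> \<open>From \<open>8 \<bar>x\<bar> \<le> \<bar>\<xi> - x\<bar>\<close> follow \<open>7 \<bar>x\<bar> \<le> \<bar>\<xi>\<bar>\<close> and \<open>8 \<bar>\<xi>\<bar> \<le> 9 \<bar>\<xi> - x\<bar>\<close>.\<close>
  have small: "\<bar>phi k x - phi k y\<bar> \<le> (1 + 5 * (X / 7)\<^sup>2) * \<bar>x - y\<bar>"
    by (rule phi_lipschitz[OF k]) (use x y in \<open>unfold X_def, linarith+\<close>)
  have *: "(64 / 81 * X\<^sup>2 - 1 / 2) * \<bar>x - y\<bar> \<le> \<bar>phi k (\<xi> - x) - phi k (\<xi> - y)\<bar>"
    if x: "4 \<le> \<bar>\<xi> - x\<bar>" "8 * \<bar>x\<bar> \<le> \<bar>\<xi> - x\<bar>" and y: "4 \<le> \<bar>\<xi> - y\<bar>" "8 * \<bar>y\<bar> \<le> \<bar>\<xi> - y\<bar>"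
      and le: "\<bar>\<xi> - y\<bar> \<le> \<bar>\<xi> - x\<bar>" for x y
  proof -
    define u v where "u = \<bar>\<xi> - x\<bar>" and "v = \<bar>\<xi> - y\<bar>"
    have uv: "u - v = \<bar>x - y\<bar>" unfolding u_def v_def using x y le by linarith
    have u: "8 / 9 * X \<le> u" "v \<le> u" "0 \<le> v" "1 \<le> u" unfolding u_def v_def X_def using x y le by linarith+
    have "(8 / 9 * X)\<^sup>2 \<le> u\<^sup>2" using u X by (intro power_mono) auto
    then have "(64 / 81 * X\<^sup>2 - 1 / 2) * (u - v) \<le> (u - v) * (u\<^sup>2 - 1 / 2)"
      using u by (subst mult.commute, intro mult_left_mono) (auto simp: power_mult_distrib power_divide)
    also have "\<dots> \<le> phi k u - phi k v" by (rule phi_diff_ge[OF k u(3,2,4)])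
    also have "\<dots> \<le> \<bar>phi k (\<xi> - x) - phi k (\<xi> - y)\<bar>" by (simp add: u_def v_def)
    finally show ?thesis by (simp add: uv)
  qed
  have large: "(64 / 81 * X\<^sup>2 - 1 / 2) * \<bar>x - y\<bar> \<le> \<bar>phi k (\<xi> - x) - phi k (\<xi> - y)\<bar>"
    using *[OF x y] *[OF y x] by (cases "\<bar>\<xi> - y\<bar> \<le> \<bar>\<xi> - x\<bar>") (auto simp: abs_minus_commute)
  have "\<xi>\<^sup>2 / 2 = X\<^sup>2 / 2" by (simp add: X_def)
  also have "\<dots> \<le> (64 / 81 * X\<^sup>2 - 1 / 2) - (1 + 5 * (X / 7)\<^sup>2)"
    using X2 by (simp add: power_divide)
  finally have "\<xi>\<^sup>2 / 2 * \<bar>x - y\<bar> \<le> ((64 / 81 * X\<^sup>2 - 1 / 2) - (1 + 5 * (X / 7)\<^sup>2)) * \<bar>x - y\<bar>"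
    by (intro mult_right_mono) auto
  also have "\<dots> \<le> \<bar>phi k (\<xi> - x) - phi k (\<xi> - y)\<bar> - \<bar>phi k x - phi k y\<bar>"
    using small large by (simp add: algebra_simps)
  also have "\<dots> \<le> \<bar>(c + e1 * phi k x + e2 * phi k (\<xi> - x)) - (c + e1 * phi k y + e2 * phi k (\<xi> - y))\<bar>"
    using e by auto
  finally show ?thesis .
qed

section \<open>Integrals of the quadratic kernel\<close>

lemma nn_integral_R2:
  fixes f :: "real \<times> real \<Rightarrow> ennreal"
  assumes [measurable]: "f \<in> borel_measurable borel"
  shows "integral\<^sup>N lborel f = (\<integral>\<^sup>+x. \<integral>\<^sup>+y. f (x, y) \<partial>lborel \<partial>lborel)"
proof -
  have "f \<in> borel_measurable (lborel \<Otimes>\<^sub>M lborel)" by (simp add: lborel_prod)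
  then show ?thesis
    by (subst lborel.nn_integral_fst) (simp_all add: lborel_prod)
qed

text \<open>Shifting \<open>t\<close> along one characteristic curve leaves the whole dependence on \<open>x\<close> in the other factor, whose
  phase is expanding in \<open>x\<close>.\<close>

lemma transversal_half_integral:
  assumes k: "\<bar>k\<bar> \<le> 1" and e: "e1 \<in> {1, -1}" "e2 \<in> {1, -1}" and xi: "\<xi> \<noteq> 0" and p: "0 \<le> p"
  defines "E \<equiv> {x. 4 \<le> \<bar>\<xi> - x\<bar> \<and> 8 * \<bar>x\<bar> \<le> \<bar>\<xi> - x\<bar>}"
  shows "(\<integral>\<^sup>+x. \<integral>\<^sup>+t. indicator E x * (ennreal (jbracket (t + e1 * phi k x) powr (- p)) * ennreal (jbracket (\<tau> - t + e2 * phi k (\<xi> - x)) powr (- p))) \<partial>lborel \<partial>lborel)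
     \<le> ennreal (2 powr p * (2 / (\<xi>\<^sup>2 / 2))) * jbracket_integral p * jbracket_integral p"
proof -
  let ?c = "ennreal (2 powr p * (2 / (\<xi>\<^sup>2 / 2))) * jbracket_integral p"
  have E [measurable]: "E \<in> sets borel" unfolding E_def by measurable
  define \<psi> where "\<psi> t x = (\<tau> - t) + e1 * phi k x + e2 * phi k (\<xi> - x)" for t x
  have [measurable]: "\<psi> t \<in> borel_measurable borel" for t unfolding \<psi>_def by measurable
  have m [measurable]: "(\<lambda>(x, t). \<psi> t x) \<in> borel_measurable (lborel \<Otimes>\<^sub>M lborel)"
    unfolding \<psi>_def by measurable
  have "(\<integral>\<^sup>+t. indicator E x * (ennreal (jbracket (t + e1 * phi k x) powr (- p)) * ennreal (jbracket (\<tau> - t + e2 * phi k (\<xi> - x)) powr (- p))) \<partial>lborel)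
     = (\<integral>\<^sup>+t. indicator E x * (ennreal (jbracket t powr (- p)) * ennreal (jbracket (\<psi> t x) powr (- p))) \<partial>lborel)" for x
    by (subst nn_integral_translate[where a="e1 * phi k x", symmetric]) (auto simp: \<psi>_def algebra_simps)
  then have "(\<integral>\<^sup>+x. \<integral>\<^sup>+t. indicator E x * (ennreal (jbracket (t + e1 * phi k x) powr (- p)) * ennreal (jbracket (\<tau> - t + e2 * phi k (\<xi> - x)) powr (- p))) \<partial>lborel \<partial>lborel)
     = (\<integral>\<^sup>+x. \<integral>\<^sup>+t. indicator E x * (ennreal (jbracket t powr (- p)) * ennreal (jbracket (\<psi> t x) powr (- p))) \<partial>lborel \<partial>lborel)"
    by simp
  also have "\<dots> = (\<integral>\<^sup>+t. \<integral>\<^sup>+x. indicator E x * (ennreal (jbracket t powr (- p)) * ennreal (jbracket (\<psi> t x) powr (- p))) \<partial>lborel \<partial>lborel)"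
    by (rule lborel_pair.Fubini'[symmetric]) measurable
  also have "\<dots> = (\<integral>\<^sup>+t. \<integral>\<^sup>+x. ennreal (jbracket t powr (- p)) * (indicator E x * ennreal (jbracket (\<psi> t x) powr (- p))) \<partial>lborel \<partial>lborel)"
    by (simp add: mult_ac)
  also have "\<dots> = (\<integral>\<^sup>+t. ennreal (jbracket t powr (- p)) * (\<integral>\<^sup>+x. (indicator E x * ennreal (jbracket (\<psi> t x) powr (- p))) \<partial>lborel) \<partial>lborel)"
    by (intro nn_integral_cong nn_integral_cmult) measurable
  also have "\<dots> \<le> (\<integral>\<^sup>+t. ennreal (jbracket t powr (- p)) * ?c \<partial>lborel)"
  proof (intro nn_integral_mono mult_left_mono)
    fix t
    show "(\<integral>\<^sup>+x. (indicator E x * ennreal (jbracket (\<psi> t x) powr (- p))) \<partial>lborel) \<le> ?c"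
    proof (rule expanding_integral)
      fix x y assume "x \<in> E" "y \<in> E"
      then show "\<xi>\<^sup>2 / 2 * \<bar>x - y\<bar> \<le> \<bar>\<psi> t x - \<psi> t y\<bar>"
        unfolding \<psi>_def E_def by (intro transversal_expanding[OF k e xi]) auto
    qed (use xi p in auto)
  qed auto
  also have "\<dots> = jbracket_integral p * ?c"
    unfolding jbracket_integral_def by (rule nn_integral_multc) measurable
  finally show ?thesis by (simp add: mult_ac)
qed

lemma iterated_measurable_add:
  fixes f g :: "real \<Rightarrow> real \<Rightarrow> ennreal"
  assumes [measurable]: "case_prod f \<in> borel_measurable (lborel \<Otimes>\<^sub>M lborel)" "case_prod g \<in> borel_measurable (lborel \<Otimes>\<^sub>M lborel)"
  shows "(\<lambda>(x, t). f x t + g x t) \<in> borel_measurable (lborel \<Otimes>\<^sub>M lborel)"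
  by measurable

lemma iterated_nn_integral_add:
  fixes f g :: "real \<Rightarrow> real \<Rightarrow> ennreal"
  assumes [measurable]: "case_prod f \<in> borel_measurable (lborel \<Otimes>\<^sub>M lborel)" "case_prod g \<in> borel_measurable (lborel \<Otimes>\<^sub>M lborel)"
  shows "(\<integral>\<^sup>+x. \<integral>\<^sup>+t. f x t + g x t \<partial>lborel \<partial>lborel) = (\<integral>\<^sup>+x. \<integral>\<^sup>+t. f x t \<partial>lborel \<partial>lborel) + (\<integral>\<^sup>+x. \<integral>\<^sup>+t. g x t \<partial>lborel \<partial>lborel)"
proof -
  have "(\<integral>\<^sup>+x. \<integral>\<^sup>+t. f x t + g x t \<partial>lborel \<partial>lborel) = (\<integral>\<^sup>+x. (\<integral>\<^sup>+t. f x t \<partial>lborel) + (\<integral>\<^sup>+t. g x t \<partial>lborel) \<partial>lborel)"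
    by (intro nn_integral_cong nn_integral_add) measurable
  also have "\<dots> = (\<integral>\<^sup>+x. \<integral>\<^sup>+t. f x t \<partial>lborel \<partial>lborel) + (\<integral>\<^sup>+x. \<integral>\<^sup>+t. g x t \<partial>lborel \<partial>lborel)"
    by (rule nn_integral_add) measurable
  finally show ?thesis .
qed

lemma ennreal_modulation_le:
  assumes "0 \<le> p"
  shows "ennreal (jbracket (\<bar>y\<bar> - c) powr (- p)) \<le>
    ennreal (jbracket (y + 1 * c) powr (- p)) + ennreal (jbracket (y + (-1) * c) powr (- p))"
  using jbracket_modulation_le[OF assms, of y c]
  by (subst ennreal_plus[symmetric]) (auto simp del: ennreal_plus intro!: ennreal_leI)

text \<open>The transversal region consists of the region in which the first input has the low frequency and of its mirror
  image under \<open>z \<mapsto> \<zeta> - z\<close>, and each modulation of two characteristic curves. The factor \<open>\<xi>\<^sup>-\<^sup>2\<close>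
  from the expansion cancels \<open>\<xi>\<^sup>2\<close>, so that the bound does not depend on the output point.\<close>

lemma transversal_kernel_integral:
  fixes \<zeta> :: "real \<times> real"
  assumes k: "\<bar>k\<bar> \<le> 1" and p: "0 \<le> p"
  shows "(\<integral>\<^sup>+z. ennreal (of_bool (transversal (fst z) (fst \<zeta> - fst z)) * (fst \<zeta>)\<^sup>2
       * jbracket (\<bar>snd z\<bar> - phi k (fst z)) powr (- p) * jbracket (\<bar>snd \<zeta> - snd z\<bar> - phi k (fst \<zeta> - fst z)) powr (- p)) \<partial>lborel)
     \<le> ennreal (32 * 2 powr p) * jbracket_integral p * jbracket_integral p"
proof (cases "fst \<zeta> = 0")
  case True
  then show ?thesis by simp
next
  case False
  define \<xi> \<tau> where "\<xi> = fst \<zeta>" and "\<tau> = snd \<zeta>"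
  have xi: "\<xi> \<noteq> 0" using False by (simp add: \<xi>_def)
  define E where "E = {x. 4 \<le> \<bar>\<xi> - x\<bar> \<and> 8 * \<bar>x\<bar> \<le> \<bar>\<xi> - x\<bar>}"
  have E [measurable]: "E \<in> sets borel" unfolding E_def by measurable
  define h where "h z = ennreal (jbracket (\<bar>snd z\<bar> - phi k (fst z)) powr (- p) * jbracket (\<bar>\<tau> - snd z\<bar> - phi k (\<xi> - fst z)) powr (- p))" for z
  have h [measurable]: "h \<in> borel_measurable borel" unfolding h_def by measurable
  define H where "H z = indicator E (fst z) * h z" for z
  have H [measurable]: "H \<in> borel_measurable borel" unfolding H_def by measurable
  define c where "c = ennreal (2 powr p * (2 / (\<xi>\<^sup>2 / 2))) * jbracket_integral p * jbracket_integral p"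
  have H_le: "integral\<^sup>N lborel H \<le> 4 * c"
  proof -
    let ?I = "\<lambda>e1 e2 x t. indicator E x * (ennreal (jbracket (t + e1 * phi k x) powr (- p)) * ennreal (jbracket (\<tau> - t + e2 * phi k (\<xi> - x)) powr (- p)))"
    have mI: "(\<lambda>(x, t). ?I e1 e2 x t) \<in> borel_measurable (lborel \<Otimes>\<^sub>M lborel)" for e1 e2
      by measurable
    have "H (x, t) \<le> ?I 1 1 x t + ?I 1 (-1) x t + (?I (-1) 1 x t + ?I (-1) (-1) x t)" for x t
    proof -
      have "h (x, t) \<le> (ennreal (jbracket (t + 1 * phi k x) powr (- p)) + ennreal (jbracket (t + (-1) * phi k x) powr (- p)))
        * (ennreal (jbracket (\<tau> - t + 1 * phi k (\<xi> - x)) powr (- p)) + ennreal (jbracket (\<tau> - t + (-1) * phi k (\<xi> - x)) powr (- p)))"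
        unfolding h_def
        by (subst ennreal_mult) (simp_all only: fst_conv snd_conv mult_mono ennreal_modulation_le[OF p] powr_ge_zero zero_le add_nonneg_nonneg)
      then have "H (x, t) \<le> indicator E x * ((ennreal (jbracket (t + 1 * phi k x) powr (- p)) + ennreal (jbracket (t + (-1) * phi k x) powr (- p)))
        * (ennreal (jbracket (\<tau> - t + 1 * phi k (\<xi> - x)) powr (- p)) + ennreal (jbracket (\<tau> - t + (-1) * phi k (\<xi> - x)) powr (- p))))"
        unfolding H_def fst_conv by (rule mult_left_mono) simp
      then show ?thesis by (simp only: distrib_left distrib_right add_ac)
    qed
    then have "integral\<^sup>N lborel H \<le> (\<integral>\<^sup>+x. \<integral>\<^sup>+t. ?I 1 1 x t + ?I 1 (-1) x t + (?I (-1) 1 x t + ?I (-1) (-1) x t) \<partial>lborel \<partial>lborel)"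
      unfolding nn_integral_R2[OF H] by (intro nn_integral_mono)
    also have "\<dots> = (\<integral>\<^sup>+x. \<integral>\<^sup>+t. ?I 1 1 x t \<partial>lborel \<partial>lborel) + (\<integral>\<^sup>+x. \<integral>\<^sup>+t. ?I 1 (-1) x t \<partial>lborel \<partial>lborel)
       + ((\<integral>\<^sup>+x. \<integral>\<^sup>+t. ?I (-1) 1 x t \<partial>lborel \<partial>lborel) + (\<integral>\<^sup>+x. \<integral>\<^sup>+t. ?I (-1) (-1) x t \<partial>lborel \<partial>lborel))"
      by (simp only: iterated_nn_integral_add mI iterated_measurable_add)
    also have "\<dots> \<le> c + c + (c + c)"
      unfolding c_def E_def by (intro add_mono transversal_half_integral[OF k _ _ xi p]) auto
    also have "\<dots> = 4 * c"
    proof -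
      have "c + c + (c + c) = (1 + 1 + (1 + 1)) * c" by (simp only: distrib_right mult_1)
      then show ?thesis by simp
    qed
    finally show ?thesis .
  qed
  have pt: "ennreal (of_bool (transversal (fst z) (\<xi> - fst z)) * \<xi>\<^sup>2
       * jbracket (\<bar>snd z\<bar> - phi k (fst z)) powr (- p) * jbracket (\<bar>\<tau> - snd z\<bar> - phi k (\<xi> - fst z)) powr (- p))
    \<le> ennreal (\<xi>\<^sup>2) * (H z + H (\<zeta> - z))" for z
  proof (cases "transversal (fst z) (\<xi> - fst z)")
    case True
    have sym: "h (\<zeta> - z) = h z" by (simp add: h_def \<xi>_def \<tau>_def mult.commute)
    have "fst z \<in> E \<or> \<xi> - fst z \<in> E"
      using True unfolding transversal_def E_def by (auto simp: max_def min_def split: if_splits)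
    then have "h z \<le> H z + H (\<zeta> - z)"
      unfolding H_def sym by (auto simp: \<xi>_def indicator_def)
    then have "ennreal (\<xi>\<^sup>2) * h z \<le> ennreal (\<xi>\<^sup>2) * (H z + H (\<zeta> - z))" by (rule mult_left_mono) simp
    then show ?thesis using True by (simp add: h_def ennreal_mult[symmetric] mult_ac del: ennreal_mult'')
  qed simp
  have "(\<integral>\<^sup>+z. ennreal (of_bool (transversal (fst z) (\<xi> - fst z)) * \<xi>\<^sup>2
       * jbracket (\<bar>snd z\<bar> - phi k (fst z)) powr (- p) * jbracket (\<bar>\<tau> - snd z\<bar> - phi k (\<xi> - fst z)) powr (- p)) \<partial>lborel)
     \<le> (\<integral>\<^sup>+z. ennreal (\<xi>\<^sup>2) * (H z + H (\<zeta> - z)) \<partial>lborel)"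
    by (intro nn_integral_mono pt)
  also have "\<dots> = ennreal (\<xi>\<^sup>2) * (integral\<^sup>N lborel H + integral\<^sup>N lborel H)"
    by (subst nn_integral_cmult, measurable, subst nn_integral_add, measurable) (simp add: nn_integral_reflect)
  also have "\<dots> \<le> ennreal (\<xi>\<^sup>2) * (4 * c + 4 * c)"
    by (intro mult_left_mono add_mono H_le) auto
  also have "\<dots> = ennreal (32 * 2 powr p) * jbracket_integral p * jbracket_integral p"
  proof -
    have "4 * c + 4 * c = ennreal 8 * c"
      by (simp add: distrib_right[symmetric])
    moreover have "ennreal (\<xi>\<^sup>2) * (ennreal 8 * ennreal (2 powr p * (2 / (\<xi>\<^sup>2 / 2)))) = ennreal (32 * 2 powr p)"
      using xi by (subst ennreal_mult[symmetric], simp, simp)+ simp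
    ultimately show ?thesis unfolding c_def by (metis mult.assoc)
  qed
  finally show ?thesis by (simp add: \<xi>_def \<tau>_def)
qed

text \<open>With one input \<open>y\<close> frozen, the time variable is integrated against the modulation of the other input and the
  output frequency against its own weight.\<close>

lemma output_kernel_integral:
  fixes y :: "real \<times> real"
  assumes p: "0 \<le> p"
  shows "(\<integral>\<^sup>+z. ennreal (jbracket (fst z) powr (- q) * jbracket (\<bar>snd z - snd y\<bar> - phi k (fst z - fst y)) powr (- p)) \<partial>lborel)
    \<le> jbracket_integral q * (2 * jbracket_integral p)"
proof -
  have "(\<integral>\<^sup>+z. ennreal (jbracket (fst z) powr (- q) * jbracket (\<bar>snd z - snd y\<bar> - phi k (fst z - fst y)) powr (- p)) \<partial>lborel)
    = (\<integral>\<^sup>+x. ennreal (jbracket x powr (- q)) * (\<integral>\<^sup>+t. ennreal (jbracket (\<bar>t - snd y\<bar> - phi k (x - fst y)) powr (- p)) \<partial>lborel) \<partial>lborel)"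
    by (subst nn_integral_R2) (auto simp: ennreal_mult nn_integral_cmult)
  also have "\<dots> \<le> (\<integral>\<^sup>+x. ennreal (jbracket x powr (- q)) * (2 * jbracket_integral p) \<partial>lborel)"
    by (intro nn_integral_mono mult_left_mono jbracket_integral_modulation p) auto
  also have "\<dots> = jbracket_integral q * (2 * jbracket_integral p)"
    unfolding jbracket_integral_def by (rule nn_integral_multc) measurable
  finally show ?thesis .
qed

lemma ennreal_sum3_sq_le: "(x + y + z)\<^sup>2 \<le> 3 * (x\<^sup>2 + y\<^sup>2 + z\<^sup>2)" for x y z :: ennreal
proof (cases "x = \<top> \<or> y = \<top> \<or> z = \<top>")
  case True
  then show ?thesis by (auto simp: power2_eq_square ennreal_top_mult ennreal_mult_top)
next
  case False
  then obtain a b c where "x = ennreal a" "y = ennreal b" "z = ennreal c" "0 \<le> a" "0 \<le> b" "0 \<le> c"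
    by (metis ennreal_cases)
  moreover have "(a + b + c)\<^sup>2 \<le> 3 * (a\<^sup>2 + b\<^sup>2 + c\<^sup>2)" for a b c :: real
    using zero_le_power2[of "a - b"] zero_le_power2[of "a - c"] zero_le_power2[of "b - c"]
    by (simp add: power2_eq_square algebra_simps)
  moreover have "3 = ennreal 3" by simp
  ultimately show ?thesis
    by (simp only: ennreal_plus[symmetric] ennreal_power ennreal_mult[symmetric] add_nonneg_nonneg zero_le_power2 ennreal_leI zero_le_numeral mult_nonneg_nonneg)
qed

text \<open>The squared norm of \<open>X_norm\<close> as a function of the modulus of the transform. The value may be infinite, which
  dispenses with integrability conditions in the convolution estimates.\<close>

definition X_nn :: "real \<Rightarrow> real \<Rightarrow> real \<Rightarrow> (real \<times> real \<Rightarrow> ennreal) \<Rightarrow> ennreal" where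
  "X_nn k s b F = (\<integral>\<^sup>+\<zeta>. (ennreal (X_weight k s b \<zeta>) * F \<zeta>)\<^sup>2 \<partial>lborel)"

lemma X_weight_pos: "0 < X_weight k s b \<zeta>"
  by (simp add: X_weight_def split: prod.split)

lemma X_weight_nonneg [simp]: "0 \<le> X_weight k s b \<zeta>"
  using X_weight_pos less_imp_le by blast

text \<open>The roots of the three terms of \<open>kernel_bound\<close> bound the kernel itself, at the level \<open>s0\<close>. The excess
  \<open>\<langle>\<xi>\<rangle>\<^sup>s\<^sup>-\<^sup>s\<^sup>0\<close> of the output weight is distributed over the inputs by \<open>\<langle>\<xi>\<^sub>1 + \<xi>\<^sub>2\<rangle> \<le> \<surd>2 \<langle>\<xi>\<^sub>1\<rangle> \<langle>\<xi>\<^sub>2\<rangle>\<close>, where it is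
  absorbed by their weights.\<close>

lemma quad_kernel_le:
  fixes \<zeta> z :: "real \<times> real"
  assumes k: "\<bar>k\<bar> \<le> 1" and s0: "1 / 2 < b" "b \<le> s0" "s0 \<le> 5 / 8" "s0 \<le> s"
  defines "\<xi> \<equiv> fst \<zeta>" and "T1 \<equiv> \<bar>snd z\<bar> - phi k (fst z)" and "T2 \<equiv> \<bar>snd \<zeta> - snd z\<bar> - phi k (fst \<zeta> - fst z)"
  defines "a1 \<equiv> jbracket \<xi> powr (- (3/2)) * jbracket T1 powr (- (2 * b))"
    and "a2 \<equiv> jbracket \<xi> powr (- (3/2)) * jbracket T2 powr (- (2 * b))"
    and "a3 \<equiv> of_bool (transversal (fst z) (fst \<zeta> - fst z)) * \<xi>\<^sup>2 * jbracket T1 powr (- (2 * b)) * jbracket T2 powr (- (2 * b))"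
  shows "X_weight k s (b - 1) \<zeta> * (2 * \<bar>\<xi>\<bar> / (jbracket \<xi>)\<^sup>2) * (fst (\<zeta> - z))\<^sup>2
     \<le> (2 ^ 11 * sqrt 2 powr (s - s0)) * (sqrt a1 + sqrt a2 + sqrt a3) * (X_weight k s b z * X_weight k s b (\<zeta> - z))"
proof -
  define x1 x2 where "x1 = fst z" and "x2 = fst \<zeta> - fst z"
  have xi: "\<xi> = x1 + x2" by (simp add: x1_def x2_def \<xi>_def)
  have xx: "fst \<zeta> - x1 = x2" by (simp add: x1_def x2_def)
  define T0 where "T0 = \<bar>snd \<zeta>\<bar> - phi k \<xi>"
  define J J1 J2 where "J = jbracket \<xi>" and "J1 = jbracket x1" and "J2 = jbracket x2"
  define m where "m = freq_weight s0 x1 x2 * (jbracket T0 powr (b - 1) * jbracket T1 powr (- b) * jbracket T2 powr (- b))"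
  have m0: "0 \<le> m" by (simp add: m_def freq_weight_nonneg)
  have J: "0 < J" "0 < J1" "0 < J2" by (auto simp: J_def J1_def J2_def)
  have a: "0 \<le> a1" "0 \<le> a2" "0 \<le> a3" by (auto simp: a1_def a2_def a3_def)
  have "m\<^sup>2 = (freq_weight s0 x1 x2)\<^sup>2 * (jbracket T0 powr (2 * b - 2) * jbracket T1 powr (- 2 * b) * jbracket T2 powr (- 2 * b))"
    by (simp add: m_def power_mult_distrib powr_power algebra_simps)
  also have "\<dots> \<le> 2^19 * (a1 + a2 + a3)"
    using kernel_bound[OF s0(1-3) k, of "snd \<zeta>" "snd z" "snd \<zeta> - snd z" x1 x2]
    unfolding a1_def a2_def a3_def T0_def T1_def T2_def x1_def[symmetric] xx xi by simp
  also have "\<dots> \<le> (2^10 * (sqrt a1 + sqrt a2 + sqrt a3))\<^sup>2"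
  proof -
    have "a1 + a2 + a3 \<le> (sqrt a1 + sqrt a2 + sqrt a3)\<^sup>2"
      using a by (simp add: power2_sum algebra_simps)
    then have "2^19 * (a1 + a2 + a3) \<le> 2^20 * (sqrt a1 + sqrt a2 + sqrt a3)\<^sup>2"
      using a by (intro mult_mono) auto
    also have "\<dots> = (2^10 * (sqrt a1 + sqrt a2 + sqrt a3))\<^sup>2"
      by (simp only: power_mult_distrib power_mult[symmetric]) simp
    finally show ?thesis .
  qed
  finally have m: "m \<le> 2^10 * (sqrt a1 + sqrt a2 + sqrt a3)"
    by (rule power2_le_imp_le) (use a in simp)
  have "J powr s = J powr s0 * J powr (s - s0)" by (simp add: powr_add[symmetric])
  also have "\<dots> \<le> J powr s0 * (sqrt 2 * (J1 * J2)) powr (s - s0)"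
    using jbracket_add_le[of x1 x2] s0 unfolding J_def J1_def J2_def xi
    by (intro mult_left_mono powr_mono2) auto
  also have "\<dots> = J powr s0 * (sqrt 2 powr (s - s0) * (J1 powr (s - s0) * J2 powr (s - s0)))"
    using J by (simp add: powr_mult)
  finally have Js: "J powr s \<le> J powr s0 * (sqrt 2 powr (s - s0) * (J1 powr (s - s0) * J2 powr (s - s0)))" .
  let ?D = "sqrt 2 powr (s - s0)"
  have "X_weight k s (b - 1) \<zeta> * (2 * \<bar>\<xi>\<bar> / J\<^sup>2) * x2\<^sup>2 = J powr s * (jbracket T0 powr (b - 1) * (2 * \<bar>\<xi>\<bar> / J\<^sup>2) * x2\<^sup>2)"
    by (simp add: X_weight_def J_def T0_def \<xi>_def split: prod.split)
  also have "\<dots> \<le> (J powr s0 * (?D * (J1 powr (s - s0) * J2 powr (s - s0)))) * (jbracket T0 powr (b - 1) * (2 * \<bar>\<xi>\<bar> / J\<^sup>2) * x2\<^sup>2)"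
    by (intro mult_right_mono Js) (use J in auto)
  also have "\<dots> = 2 * ?D * m * (X_weight k s b z * X_weight k s b (\<zeta> - z))"
  proof -
    have e1: "J powr s0 / J\<^sup>2 = J powr (s0 - 2)" using J by (simp add: powr_diff)
    have e2: "J1 powr (s - s0) = J1 powr s * J1 powr (- s0)" "J2 powr (s - s0) = J2 powr s * J2 powr (- s0)"
      by (simp_all add: powr_add[symmetric])
    have X1: "X_weight k s b z = J1 powr s * jbracket T1 powr b"
      by (simp add: X_weight_def J1_def T1_def x1_def split: prod.split)
    have X2: "X_weight k s b (\<zeta> - z) = J2 powr s * jbracket T2 powr b"
      by (simp add: X_weight_def J2_def T2_def x2_def minus_prod_def)
    have c: "jbracket T1 powr (- b) * jbracket T1 powr b = 1" "jbracket T2 powr (- b) * jbracket T2 powr b = 1"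
      by (simp_all add: powr_add[symmetric])
    have "2 * ?D * m * (X_weight k s b z * X_weight k s b (\<zeta> - z)) =
      2 * ?D * (\<bar>\<xi>\<bar> * J powr (s0 - 2) * x2\<^sup>2 * J1 powr (- s0) * J2 powr (- s0) * jbracket T0 powr (b - 1) * J1 powr s * J2 powr s)
        * (jbracket T1 powr (- b) * jbracket T1 powr b) * (jbracket T2 powr (- b) * jbracket T2 powr b)"
      unfolding X1 X2 m_def freq_weight_def xi[symmetric] J_def[symmetric] J1_def[symmetric] J2_def[symmetric]
      by (simp only: mult_ac)
    also have "\<dots> = 2 * ?D * (\<bar>\<xi>\<bar> * (J powr s0 / J\<^sup>2) * x2\<^sup>2 * (J1 powr s * J1 powr (- s0)) * (J2 powr s * J2 powr (- s0)) * jbracket T0 powr (b - 1))"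
      unfolding c e1 by (simp only: mult_ac mult_1_right)
    finally show ?thesis unfolding e2 by simp
  qed
  also have "\<dots> \<le> 2 * ?D * (2^10 * (sqrt a1 + sqrt a2 + sqrt a3)) * (X_weight k s b z * X_weight k s b (\<zeta> - z))"
    by (intro mult_right_mono mult_left_mono m) auto
  also have "\<dots> = (2 ^ 11 * ?D) * (sqrt a1 + sqrt a2 + sqrt a3) * (X_weight k s b z * X_weight k s b (\<zeta> - z))"
    by (simp add: algebra_simps)
  finally show ?thesis by (simp only: J_def x2_def fst_diff)
qed

section \<open>The estimates for nonnegative functions\<close>

text \<open>Each of the three parts of the kernel is integrated with the point frozen for which its weights are
  integrable.\<close>

lemma quad_estimate:
  assumes k: "\<bar>k\<bar> \<le> 1" and s0: "1 / 2 < b" "b \<le> s0" "s0 \<le> 5 / 8" "s0 \<le> s"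
  obtains C where "C < \<infinity>" and "\<And>F G. F \<in> borel_measurable borel \<Longrightarrow> G \<in> borel_measurable borel \<Longrightarrow>
    (\<integral>\<^sup>+\<zeta>. (ennreal (X_weight k s (b - 1) \<zeta> * (2 * \<bar>fst \<zeta>\<bar> / (jbracket (fst \<zeta>))\<^sup>2)) *
        (\<integral>\<^sup>+z. F z * (ennreal ((fst (\<zeta> - z))\<^sup>2) * G (\<zeta> - z)) \<partial>lborel))\<^sup>2 \<partial>lborel)
      \<le> C * (X_nn k s b F * X_nn k s b G)"
proof -
  define p where "p = 2 * b"
  have p: "1 < p" using s0 by (simp add: p_def)
  define a1 a2 a3 where "a1 \<zeta> z = jbracket (fst \<zeta>) powr (- (3/2)) * jbracket (\<bar>snd z\<bar> - phi k (fst z)) powr (- p)"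
    and "a2 \<zeta> z = jbracket (fst \<zeta>) powr (- (3/2)) * jbracket (\<bar>snd \<zeta> - snd z\<bar> - phi k (fst \<zeta> - fst z)) powr (- p)"
    and "a3 \<zeta> z = of_bool (transversal (fst z) (fst \<zeta> - fst z)) * (fst \<zeta>)\<^sup>2 * jbracket (\<bar>snd z\<bar> - phi k (fst z)) powr (- p)
       * jbracket (\<bar>snd \<zeta> - snd z\<bar> - phi k (fst \<zeta> - fst z)) powr (- p)" for \<zeta> z :: "real \<times> real"
  define M1 M2 M3 where "M1 \<zeta> z = ennreal (sqrt (a1 \<zeta> z))" and "M2 \<zeta> z = ennreal (sqrt (a2 \<zeta> z))"
    and "M3 \<zeta> z = ennreal (sqrt (a3 \<zeta> z))" for \<zeta> z
  have apos: "0 \<le> a1 \<zeta> z" "0 \<le> a2 \<zeta> z" "0 \<le> a3 \<zeta> z" for \<zeta> z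
    by (auto simp: a1_def a2_def a3_def)
  have Msq: "(M1 \<zeta> z)\<^sup>2 = ennreal (a1 \<zeta> z)" "(M2 \<zeta> z)\<^sup>2 = ennreal (a2 \<zeta> z)" "(M3 \<zeta> z)\<^sup>2 = ennreal (a3 \<zeta> z)" for \<zeta> z
    unfolding M1_def M2_def M3_def using apos by (simp_all add: ennreal_power)
  have am [measurable]: "case_prod a1 \<in> borel_measurable (borel \<Otimes>\<^sub>M borel)" "case_prod a2 \<in> borel_measurable (borel \<Otimes>\<^sub>M borel)"
    "case_prod a3 \<in> borel_measurable (borel \<Otimes>\<^sub>M borel)"
    unfolding a1_def a2_def a3_def transversal_def of_bool_def by measurable
  have Mm [measurable]: "case_prod M1 \<in> borel_measurable (borel \<Otimes>\<^sub>M borel)" "case_prod M2 \<in> borel_measurable (borel \<Otimes>\<^sub>M borel)"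
    "case_prod M3 \<in> borel_measurable (borel \<Otimes>\<^sub>M borel)"
    unfolding M1_def M2_def M3_def by measurable
  define D where "D = 2 ^ 11 * sqrt 2 powr (s - s0)"
  have D: "0 \<le> D" by (simp add: D_def)
  define c1 where "c1 = jbracket_integral (3/2) * (2 * jbracket_integral p)"
  define c3 where "c3 = ennreal (32 * 2 powr p) * jbracket_integral p * jbracket_integral p"
  define C where "C = ennreal (D\<^sup>2) * (3 * (c1 + c1 + c3))"
  have fin: "jbracket_integral (3/2) < \<infinity>" "jbracket_integral p < \<infinity>" by (rule jbracket_integral_finite; use p in simp)+
  have "C < \<infinity>"
    using fin unfolding C_def c1_def c3_def by (auto simp: ennreal_mult_less_top)
  moreover have "(\<integral>\<^sup>+\<zeta>. (ennreal (X_weight k s (b - 1) \<zeta> * (2 * \<bar>fst \<zeta>\<bar> / (jbracket (fst \<zeta>))\<^sup>2)) *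
        (\<integral>\<^sup>+z. F z * (ennreal ((fst (\<zeta> - z))\<^sup>2) * G (\<zeta> - z)) \<partial>lborel))\<^sup>2 \<partial>lborel)
      \<le> C * (X_nn k s b F * X_nn k s b G)"
    if [measurable]: "F \<in> borel_measurable borel" "G \<in> borel_measurable borel" for F G
  proof -
    define f g where "f z = ennreal (X_weight k s b z) * F z" and "g z = ennreal (X_weight k s b z) * G z" for z
    have [measurable]: "f \<in> borel_measurable borel" "g \<in> borel_measurable borel"
      unfolding f_def g_def by measurable
    define I where "I M \<zeta> = (\<integral>\<^sup>+z. M \<zeta> z * (f z * g (\<zeta> - z)) \<partial>lborel)" for M :: "real \<times> real \<Rightarrow> real \<times> real \<Rightarrow> ennreal" and \<zeta>
    have Im [measurable]: "I M \<in> borel_measurable borel" if [measurable]: "case_prod M \<in> borel_measurable (borel \<Otimes>\<^sub>M borel)" for M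
      unfolding I_def by measurable
    have pt: "ennreal (X_weight k s (b - 1) \<zeta> * (2 * \<bar>fst \<zeta>\<bar> / (jbracket (fst \<zeta>))\<^sup>2)) *
        (\<integral>\<^sup>+z. F z * (ennreal ((fst (\<zeta> - z))\<^sup>2) * G (\<zeta> - z)) \<partial>lborel) \<le> ennreal D * (I M1 \<zeta> + I M2 \<zeta> + I M3 \<zeta>)" for \<zeta>
    proof -
      let ?A = "X_weight k s (b - 1) \<zeta> * (2 * \<bar>fst \<zeta>\<bar> / (jbracket (fst \<zeta>))\<^sup>2)"
      have "ennreal ?A * (\<integral>\<^sup>+z. F z * (ennreal ((fst (\<zeta> - z))\<^sup>2) * G (\<zeta> - z)) \<partial>lborel)
        = (\<integral>\<^sup>+z. ennreal ?A * (F z * (ennreal ((fst (\<zeta> - z))\<^sup>2) * G (\<zeta> - z))) \<partial>lborel)"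
        by (rule nn_integral_cmult[symmetric]) measurable
      also have "\<dots> \<le> (\<integral>\<^sup>+z. ennreal D * (M1 \<zeta> z * (f z * g (\<zeta> - z)) + M2 \<zeta> z * (f z * g (\<zeta> - z)) + M3 \<zeta> z * (f z * g (\<zeta> - z))) \<partial>lborel)"
      proof (intro nn_integral_mono)
        fix z
        let ?w = "X_weight k s b z * X_weight k s b (\<zeta> - z)"
        have "?A * (fst (\<zeta> - z))\<^sup>2 \<le> D * (sqrt (a1 \<zeta> z) + sqrt (a2 \<zeta> z) + sqrt (a3 \<zeta> z)) * ?w"
          using quad_kernel_le[OF k s0, of \<zeta> z] unfolding a1_def a2_def a3_def D_def p_def .
        then have "ennreal (?A * (fst (\<zeta> - z))\<^sup>2) \<le> ennreal (D * (sqrt (a1 \<zeta> z) + sqrt (a2 \<zeta> z) + sqrt (a3 \<zeta> z)) * ?w)"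
          by (rule ennreal_leI)
        also have "\<dots> = ennreal D * (M1 \<zeta> z + M2 \<zeta> z + M3 \<zeta> z) * (ennreal (X_weight k s b z) * ennreal (X_weight k s b (\<zeta> - z)))"
          unfolding M1_def M2_def M3_def using D apos
          by (subst ennreal_mult ennreal_plus; simp)+
        finally have "ennreal (?A * (fst (\<zeta> - z))\<^sup>2) * (F z * G (\<zeta> - z)) \<le>
          (ennreal D * (M1 \<zeta> z + M2 \<zeta> z + M3 \<zeta> z) * (ennreal (X_weight k s b z) * ennreal (X_weight k s b (\<zeta> - z)))) * (F z * G (\<zeta> - z))"
          by (rule mult_right_mono) simp
        moreover have "ennreal (?A * (fst (\<zeta> - z))\<^sup>2) = ennreal ?A * ennreal ((fst (\<zeta> - z))\<^sup>2)"
          by (rule ennreal_mult) auto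
        ultimately show "ennreal ?A * (F z * (ennreal ((fst (\<zeta> - z))\<^sup>2) * G (\<zeta> - z))) \<le>
          ennreal D * (M1 \<zeta> z * (f z * g (\<zeta> - z)) + M2 \<zeta> z * (f z * g (\<zeta> - z)) + M3 \<zeta> z * (f z * g (\<zeta> - z)))"
          unfolding f_def g_def by (simp only: distrib_left distrib_right mult_ac)
      qed
      also have "\<dots> = ennreal D * (I M1 \<zeta> + I M2 \<zeta> + I M3 \<zeta>)"
        unfolding I_def by (simp add: nn_integral_cmult nn_integral_add)
      finally show ?thesis .
    qed
    let ?N = "X_nn k s b F * X_nn k s b G"
    have N: "?N = (\<integral>\<^sup>+x. (f x)\<^sup>2 \<partial>lborel) * (\<integral>\<^sup>+x. (g x)\<^sup>2 \<partial>lborel)"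
      by (simp add: X_nn_def f_def g_def)
    have I1: "(\<integral>\<^sup>+\<zeta>. (I M1 \<zeta>)\<^sup>2 \<partial>lborel) \<le> c1 * ?N"
      unfolding I_def N
    proof (rule convolution_CS_second)
      fix y :: "real \<times> real"
      show "(\<integral>\<^sup>+x. (M1 x (x - y))\<^sup>2 \<partial>lborel) \<le> c1"
        unfolding Msq c1_def using output_kernel_integral[of p "3/2" y k] p by (simp add: a1_def)
    qed measurable
    have I2: "(\<integral>\<^sup>+\<zeta>. (I M2 \<zeta>)\<^sup>2 \<partial>lborel) \<le> c1 * ?N"
      unfolding I_def N
    proof (rule convolution_CS_first)
      fix y :: "real \<times> real"
      show "(\<integral>\<^sup>+x. (M2 x y)\<^sup>2 \<partial>lborel) \<le> c1"
        unfolding Msq c1_def using output_kernel_integral[of p "3/2" y k] p by (simp add: a2_def)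
    qed measurable
    have I3: "(\<integral>\<^sup>+\<zeta>. (I M3 \<zeta>)\<^sup>2 \<partial>lborel) \<le> c3 * ?N"
      unfolding I_def N
    proof (rule convolution_CS_output)
      fix x :: "real \<times> real"
      show "(\<integral>\<^sup>+y. (M3 x y)\<^sup>2 \<partial>lborel) \<le> c3"
        unfolding Msq c3_def using transversal_kernel_integral[OF k, of p x] p by (simp add: a3_def)
    qed measurable
    have "(\<integral>\<^sup>+\<zeta>. (ennreal (X_weight k s (b - 1) \<zeta> * (2 * \<bar>fst \<zeta>\<bar> / (jbracket (fst \<zeta>))\<^sup>2)) *
        (\<integral>\<^sup>+z. F z * (ennreal ((fst (\<zeta> - z))\<^sup>2) * G (\<zeta> - z)) \<partial>lborel))\<^sup>2 \<partial>lborel)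
      \<le> (\<integral>\<^sup>+\<zeta>. (ennreal D * (I M1 \<zeta> + I M2 \<zeta> + I M3 \<zeta>))\<^sup>2 \<partial>lborel)"
      by (intro nn_integral_mono power_mono pt) auto
    also have "\<dots> \<le> (\<integral>\<^sup>+\<zeta>. ennreal (D\<^sup>2) * (3 * ((I M1 \<zeta>)\<^sup>2 + (I M2 \<zeta>)\<^sup>2 + (I M3 \<zeta>)\<^sup>2)) \<partial>lborel)"
      unfolding power_mult_distrib ennreal_power[OF D] by (intro nn_integral_mono mult_left_mono ennreal_sum3_sq_le) auto
    also have "\<dots> = ennreal (D\<^sup>2) * (3 * ((\<integral>\<^sup>+\<zeta>. (I M1 \<zeta>)\<^sup>2 \<partial>lborel) + (\<integral>\<^sup>+\<zeta>. (I M2 \<zeta>)\<^sup>2 \<partial>lborel) + (\<integral>\<^sup>+\<zeta>. (I M3 \<zeta>)\<^sup>2 \<partial>lborel)))"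
      by (simp add: nn_integral_cmult nn_integral_add)
    also have "\<dots> \<le> ennreal (D\<^sup>2) * (3 * (c1 * ?N + c1 * ?N + c3 * ?N))"
      by (intro mult_left_mono add_mono I1 I2 I3) auto
    also have "\<dots> = C * ?N"
      unfolding C_def by (simp only: distrib_left distrib_right mult_ac)
    finally show ?thesis .
  qed
  ultimately show ?thesis using that by blast
qed

text \<open>Cauchy--Schwarz with respect to the measure with density \<open>f\<close>.\<close>

lemma Young_L2_L1:
  fixes f g :: "'a::euclidean_space \<Rightarrow> ennreal"
  assumes [measurable]: "f \<in> borel_measurable borel" "g \<in> borel_measurable borel"
  shows "(\<integral>\<^sup>+x. (\<integral>\<^sup>+y. f y * g (x - y) \<partial>lborel)\<^sup>2 \<partial>lborel) \<le> (\<integral>\<^sup>+x. f x \<partial>lborel)\<^sup>2 * (\<integral>\<^sup>+x. (g x)\<^sup>2 \<partial>lborel)"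
proof -
  let ?L = "\<integral>\<^sup>+x. f x \<partial>lborel"
  have "(\<integral>\<^sup>+y. f y * g (x - y) \<partial>lborel)\<^sup>2 \<le> ?L * (\<integral>\<^sup>+y. f y * (g (x - y))\<^sup>2 \<partial>lborel)" for x
  proof -
    have "(\<integral>\<^sup>+y. g (x - y) \<partial>density lborel f)\<^sup>2 = (\<integral>\<^sup>+y. 1 * g (x - y) \<partial>density lborel f)\<^sup>2" by simp
    also have "\<dots> \<le> (\<integral>\<^sup>+y. 1\<^sup>2 \<partial>density lborel f) * (\<integral>\<^sup>+y. (g (x - y))\<^sup>2 \<partial>density lborel f)"
      by (rule Cauchy_Schwarz_nn_integral) measurable
    finally show ?thesis by (simp add: nn_integral_density emeasure_density)
  qed
  then have "(\<integral>\<^sup>+x. (\<integral>\<^sup>+y. f y * g (x - y) \<partial>lborel)\<^sup>2 \<partial>lborel) \<le> (\<integral>\<^sup>+x. ?L * (\<integral>\<^sup>+y. f y * (g (x - y))\<^sup>2 \<partial>lborel) \<partial>lborel)"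
    by (intro nn_integral_mono)
  also have "\<dots> = ?L * (\<integral>\<^sup>+x. \<integral>\<^sup>+y. f y * (g (x - y))\<^sup>2 \<partial>lborel \<partial>lborel)"
    by (rule nn_integral_cmult) measurable
  also have "(\<integral>\<^sup>+x. \<integral>\<^sup>+y. f y * (g (x - y))\<^sup>2 \<partial>lborel \<partial>lborel) = ?L * (\<integral>\<^sup>+x. (g x)\<^sup>2 \<partial>lborel)"
    by (rule nn_integral_convolution[where g="\<lambda>x. (g x)\<^sup>2"]) measurable
  finally show ?thesis by (simp add: power2_eq_square mult_ac)
qed

definition Hs_nn :: "real \<Rightarrow> (real \<times> real \<Rightarrow> ennreal) \<Rightarrow> ennreal" where
  "Hs_nn s F = (\<integral>\<^sup>+\<zeta>. (ennreal (jbracket (fst \<zeta>) powr s) * F \<zeta>)\<^sup>2 \<partial>lborel)"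

text \<open>The weight of the output frequency falls on whichever input has the larger bracket, up to the factor \<open>2\<^sup>s\<close>; the
  other input enters through its \<open>L\<^sup>1\<close> norm.\<close>

lemma Hs_nn_convolution:
  assumes [measurable]: "F \<in> borel_measurable borel" "G \<in> borel_measurable borel" and s: "0 \<le> s"
  shows "Hs_nn s (\<lambda>\<zeta>. \<integral>\<^sup>+z. F z * G (\<zeta> - z) \<partial>lborel)
     \<le> ennreal (3 * (2 powr s)\<^sup>2) * (Hs_nn s F * (integral\<^sup>N lborel G)\<^sup>2 + (integral\<^sup>N lborel F)\<^sup>2 * Hs_nn s G)"
proof -
  define f g where "f z = ennreal (jbracket (fst z) powr s) * F z" and "g z = ennreal (jbracket (fst z) powr s) * G z" for z
  have [measurable]: "f \<in> borel_measurable borel" "g \<in> borel_measurable borel"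
    unfolding f_def g_def by measurable
  define c where "c = 2 powr s"
  have c: "0 \<le> c" by (simp add: c_def)
  define I1 I2 where "I1 \<zeta> = (\<integral>\<^sup>+z. G z * f (\<zeta> - z) \<partial>lborel)" and "I2 \<zeta> = (\<integral>\<^sup>+z. F z * g (\<zeta> - z) \<partial>lborel)" for \<zeta>
  have [measurable]: "I1 \<in> borel_measurable borel" "I2 \<in> borel_measurable borel"
    unfolding I1_def I2_def by measurable
  have I1': "I1 \<zeta> = (\<integral>\<^sup>+z. f z * G (\<zeta> - z) \<partial>lborel)" for \<zeta>
    unfolding I1_def by (subst nn_integral_reflect[where a=\<zeta>, symmetric]) (auto simp: mult_ac)
  have pt: "ennreal (jbracket (fst \<zeta>) powr s) * (\<integral>\<^sup>+z. F z * G (\<zeta> - z) \<partial>lborel) \<le> ennreal c * (I1 \<zeta> + I2 \<zeta>)" for \<zeta>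
  proof -
    have "ennreal (jbracket (fst \<zeta>) powr s) * (\<integral>\<^sup>+z. F z * G (\<zeta> - z) \<partial>lborel)
       = (\<integral>\<^sup>+z. ennreal (jbracket (fst \<zeta>) powr s) * (F z * G (\<zeta> - z)) \<partial>lborel)"
      by (rule nn_integral_cmult[symmetric]) measurable
    also have "\<dots> \<le> (\<integral>\<^sup>+z. ennreal c * (f z * G (\<zeta> - z) + F z * g (\<zeta> - z)) \<partial>lborel)"
    proof (intro nn_integral_mono)
      fix z
      let ?a = "jbracket (fst z)" and ?b = "jbracket (fst (\<zeta> - z))"
      have "jbracket (fst \<zeta>) powr s \<le> c * (?a powr s + ?b powr s)"
      proof -
        have "jbracket (fst \<zeta>) \<le> ?a + ?b" using jbracket_add_le'[of "fst z" "fst (\<zeta> - z)"] by simp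
        also have "\<dots> \<le> 2 * max ?a ?b" by simp
        finally have "jbracket (fst \<zeta>) powr s \<le> (2 * max ?a ?b) powr s" using s by (intro powr_mono2) auto
        also have "\<dots> = c * max ?a ?b powr s" by (simp add: c_def powr_mult le_max_iff_disj)
        also have "\<dots> \<le> c * (?a powr s + ?b powr s)" using c by (intro mult_left_mono) (auto simp: max_def)
        finally show ?thesis .
      qed
      then have "ennreal (jbracket (fst \<zeta>) powr s) \<le> ennreal (c * (?a powr s + ?b powr s))" by (rule ennreal_leI)
      also have "\<dots> = ennreal c * (ennreal (?a powr s) + ennreal (?b powr s))"
        using c by (subst ennreal_mult) auto
      finally have "ennreal (jbracket (fst \<zeta>) powr s) * (F z * G (\<zeta> - z)) \<le> ennreal c * (ennreal (?a powr s) + ennreal (?b powr s)) * (F z * G (\<zeta> - z))"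
        by (rule mult_right_mono) simp
      then show "ennreal (jbracket (fst \<zeta>) powr s) * (F z * G (\<zeta> - z)) \<le> ennreal c * (f z * G (\<zeta> - z) + F z * g (\<zeta> - z))"
        unfolding f_def g_def by (simp only: distrib_left distrib_right mult_ac)
    qed
    also have "\<dots> = ennreal c * (I1 \<zeta> + I2 \<zeta>)"
      unfolding I1' I2_def by (simp add: nn_integral_cmult nn_integral_add)
    finally show ?thesis .
  qed
  have sq: "(x + y)\<^sup>2 \<le> 3 * (x\<^sup>2 + y\<^sup>2)" for x y :: ennreal
    using ennreal_sum3_sq_le[of x y 0] by simp
  have "Hs_nn s (\<lambda>\<zeta>. \<integral>\<^sup>+z. F z * G (\<zeta> - z) \<partial>lborel) \<le> (\<integral>\<^sup>+\<zeta>. (ennreal c * (I1 \<zeta> + I2 \<zeta>))\<^sup>2 \<partial>lborel)"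
    unfolding Hs_nn_def by (intro nn_integral_mono power_mono pt) auto
  also have "\<dots> \<le> (\<integral>\<^sup>+\<zeta>. ennreal (c\<^sup>2) * (3 * ((I1 \<zeta>)\<^sup>2 + (I2 \<zeta>)\<^sup>2)) \<partial>lborel)"
    unfolding power_mult_distrib ennreal_power[OF c] by (intro nn_integral_mono mult_left_mono sq) auto
  also have "\<dots> = ennreal (c\<^sup>2) * (3 * ((\<integral>\<^sup>+\<zeta>. (I1 \<zeta>)\<^sup>2 \<partial>lborel) + (\<integral>\<^sup>+\<zeta>. (I2 \<zeta>)\<^sup>2 \<partial>lborel)))"
    by (simp add: nn_integral_cmult nn_integral_add)
  also have "\<dots> \<le> ennreal (c\<^sup>2) * (3 * ((integral\<^sup>N lborel G)\<^sup>2 * (\<integral>\<^sup>+x. (f x)\<^sup>2 \<partial>lborel) + (integral\<^sup>N lborel F)\<^sup>2 * (\<integral>\<^sup>+x. (g x)\<^sup>2 \<partial>lborel)))"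
    unfolding I1_def I2_def by (intro mult_left_mono add_mono Young_L2_L1) auto
  also have "\<dots> = ennreal (3 * c\<^sup>2) * (Hs_nn s F * (integral\<^sup>N lborel G)\<^sup>2 + (integral\<^sup>N lborel F)\<^sup>2 * Hs_nn s G)"
  proof -
    have "ennreal (3 * c\<^sup>2) = ennreal (c\<^sup>2) * 3" by (simp add: ennreal_mult mult.commute)
    then show ?thesis unfolding Hs_nn_def f_def g_def by (simp only: mult_ac)
  qed
  finally show ?thesis by (simp add: c_def)
qed

lemma X_weight_eq:
  "X_weight k s b \<zeta> = jbracket (fst \<zeta>) powr s * jbracket (\<bar>snd \<zeta>\<bar> - phi k (fst \<zeta>)) powr b"
  by (simp add: X_weight_def split: prod.split)

text \<open>The reciprocal of the weight is square integrable precisely when both exponents exceed \<open>1/2\<close>; this is the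
  Fourier form of the embedding of \<open>X\<^sup>s\<^sup>,\<^sup>b\<close> into the bounded continuous functions.\<close>

lemma X_nn_controls_L1:
  assumes [measurable]: "F \<in> borel_measurable borel" and "1 / 2 < s" "1 / 2 < b"
  shows "(integral\<^sup>N lborel F)\<^sup>2 \<le> (jbracket_integral (2 * s) * (2 * jbracket_integral (2 * b))) * X_nn k s b F"
proof -
  have "(integral\<^sup>N lborel F)\<^sup>2 = (\<integral>\<^sup>+\<zeta>. ennreal (inverse (X_weight k s b \<zeta>)) * (ennreal (X_weight k s b \<zeta>) * F \<zeta>) \<partial>lborel)\<^sup>2"
    by (simp add: mult.assoc[symmetric] ennreal_mult[symmetric] X_weight_pos[THEN less_imp_neq, symmetric])
  also have "\<dots> \<le> (\<integral>\<^sup>+\<zeta>. (ennreal (inverse (X_weight k s b \<zeta>)))\<^sup>2 \<partial>lborel) * X_nn k s b F"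
    unfolding X_nn_def by (rule Cauchy_Schwarz_nn_integral) measurable
  also have "(\<integral>\<^sup>+\<zeta>. (ennreal (inverse (X_weight k s b \<zeta>)))\<^sup>2 \<partial>lborel)
     = (\<integral>\<^sup>+z. ennreal (jbracket (fst z) powr (- (2 * s)) * jbracket (\<bar>snd z - snd (0::real\<times>real)\<bar> - phi k (fst z - fst (0::real\<times>real))) powr (- (2 * b))) \<partial>lborel)"
    by (intro nn_integral_cong)
      (simp add: X_weight_eq ennreal_power power_mult_distrib powr_power powr_minus[symmetric] mult.commute)
  also have "\<dots> \<le> jbracket_integral (2 * s) * (2 * jbracket_integral (2 * b))"
    by (rule output_kernel_integral) (use assms in auto)
  finally show ?thesis by (simp add: mult_right_mono)
qed

lemma X_nn_controls_Hs:
  assumes "0 \<le> b"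
  shows "Hs_nn s F \<le> X_nn k s b F"
  unfolding X_nn_def Hs_nn_def
proof (intro nn_integral_mono power_mono mult_right_mono ennreal_leI)
  fix \<zeta> :: "real \<times> real"
  have "jbracket (fst \<zeta>) powr s * 1 \<le> jbracket (fst \<zeta>) powr s * jbracket (\<bar>snd \<zeta>\<bar> - phi k (fst \<zeta>)) powr b"
    using assms jbracket_ge_1 by (intro mult_left_mono ge_one_powr_ge_zero) auto
  then show "jbracket (fst \<zeta>) powr s \<le> X_weight k s b \<zeta>" by (simp add: X_weight_eq)
qed auto

text \<open>The multiplier and the factor \<open>\<langle>\<bar>\<tau>\<bar> - \<phi>\<rangle>\<^sup>b\<^sup>-\<^sup>1\<close> are bounded, so that only the spatial weight remains on the
  output. Each factor then enters either through its weighted \<open>L\<^sup>2\<close> norm or through its \<open>L\<^sup>1\<close> norm, and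
  \<open>X_nn\<close> controls both.\<close>

lemma cubic_estimate:
  assumes s: "1 / 2 < s" and b: "1 / 2 < b" "b \<le> 1"
  obtains C where "C < \<infinity>" and "\<And>F G H. F \<in> borel_measurable borel \<Longrightarrow> G \<in> borel_measurable borel \<Longrightarrow> H \<in> borel_measurable borel \<Longrightarrow>
    (\<integral>\<^sup>+\<zeta>. (ennreal (X_weight k s (b - 1) \<zeta> * (2 * \<bar>fst \<zeta>\<bar> / (jbracket (fst \<zeta>))\<^sup>2)) *
        (\<integral>\<^sup>+z. F z * (\<integral>\<^sup>+y. G y * H (\<zeta> - z - y) \<partial>lborel) \<partial>lborel))\<^sup>2 \<partial>lborel)
      \<le> C * (X_nn k s b F * X_nn k s b G * X_nn k s b H)"
proof -
  define c where "c = ennreal (3 * (2 powr s)\<^sup>2)"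
  define l where "l = jbracket_integral (2 * s) * (2 * jbracket_integral (2 * b))"
  define C where "C = 4 * (c * (l * l + l * (c * (l + l))))"
  have "jbracket_integral (2 * s) < \<infinity>" "jbracket_integral (2 * b) < \<infinity>" by (rule jbracket_integral_finite; use s b in simp)+
  then have "C < \<infinity>" unfolding C_def c_def l_def by (auto simp: ennreal_mult_less_top)
  moreover have "(\<integral>\<^sup>+\<zeta>. (ennreal (X_weight k s (b - 1) \<zeta> * (2 * \<bar>fst \<zeta>\<bar> / (jbracket (fst \<zeta>))\<^sup>2)) *
        (\<integral>\<^sup>+z. F z * (\<integral>\<^sup>+y. G y * H (\<zeta> - z - y) \<partial>lborel) \<partial>lborel))\<^sup>2 \<partial>lborel)
      \<le> C * (X_nn k s b F * X_nn k s b G * X_nn k s b H)"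
    if [measurable]: "F \<in> borel_measurable borel" "G \<in> borel_measurable borel" "H \<in> borel_measurable borel" for F G H
  proof -
    define K where "K \<zeta> = (\<integral>\<^sup>+y. G y * H (\<zeta> - y) \<partial>lborel)" for \<zeta>
    have [measurable]: "K \<in> borel_measurable borel" unfolding K_def by measurable
    let ?X = "X_nn k s b"
    let ?L = "\<lambda>F. (integral\<^sup>N lborel F)\<^sup>2"
    have L: "?L F \<le> l * ?X F" "?L G \<le> l * ?X G" "?L H \<le> l * ?X H"
      unfolding l_def by (auto intro!: X_nn_controls_L1 s b)
    have A: "Hs_nn s F \<le> ?X F" "Hs_nn s G \<le> ?X G" "Hs_nn s H \<le> ?X H"
      using b by (auto intro!: X_nn_controls_Hs)
    have LK: "?L K \<le> l * ?X G * (l * ?X H)"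
    proof -
      have "integral\<^sup>N lborel K = integral\<^sup>N lborel G * integral\<^sup>N lborel H"
        unfolding K_def by (rule nn_integral_convolution) measurable
      then show ?thesis using L by (simp add: power_mult_distrib mult_mono)
    qed
    have AK: "Hs_nn s K \<le> c * (?X G * (l * ?X H) + l * ?X G * ?X H)"
    proof -
      have "Hs_nn s K \<le> c * (Hs_nn s G * ?L H + ?L G * Hs_nn s H)"
        unfolding K_def c_def using s by (intro Hs_nn_convolution) auto
      also have "\<dots> \<le> c * (?X G * (l * ?X H) + l * ?X G * ?X H)"
        by (intro mult_left_mono add_mono mult_mono A L) auto
      finally show ?thesis .
    qed
    have "(\<integral>\<^sup>+\<zeta>. (ennreal (X_weight k s (b - 1) \<zeta> * (2 * \<bar>fst \<zeta>\<bar> / (jbracket (fst \<zeta>))\<^sup>2)) *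
        (\<integral>\<^sup>+z. F z * K (\<zeta> - z) \<partial>lborel))\<^sup>2 \<partial>lborel)
      \<le> (\<integral>\<^sup>+\<zeta>. 4 * (ennreal (jbracket (fst \<zeta>) powr s) * (\<integral>\<^sup>+z. F z * K (\<zeta> - z) \<partial>lborel))\<^sup>2 \<partial>lborel)"
    proof (intro nn_integral_mono)
      fix \<zeta> :: "real \<times> real"
      let ?i = "\<integral>\<^sup>+z. F z * K (\<zeta> - z) \<partial>lborel"
      have "X_weight k s (b - 1) \<zeta> \<le> jbracket (fst \<zeta>) powr s * 1"
        using b by (auto simp: X_weight_def split: prod.split intro!: mult_left_mono jbracket_powr_le_1)
      moreover have "2 * \<bar>fst \<zeta>\<bar> / (jbracket (fst \<zeta>))\<^sup>2 \<le> 2"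
      proof -
        have "\<bar>fst \<zeta>\<bar> * 1 \<le> jbracket (fst \<zeta>) * jbracket (fst \<zeta>)"
          by (intro mult_mono jbracket_ge_abs jbracket_ge_1) auto
        then show ?thesis by (simp add: divide_le_eq power2_eq_square)
      qed
      ultimately have "X_weight k s (b - 1) \<zeta> * (2 * \<bar>fst \<zeta>\<bar> / (jbracket (fst \<zeta>))\<^sup>2) \<le> jbracket (fst \<zeta>) powr s * 1 * 2"
        by (intro mult_mono) auto
      then have "ennreal (X_weight k s (b - 1) \<zeta> * (2 * \<bar>fst \<zeta>\<bar> / (jbracket (fst \<zeta>))\<^sup>2)) \<le> ennreal (2 * jbracket (fst \<zeta>) powr s)"
        by (intro ennreal_leI) simp
      also have "\<dots> = 2 * ennreal (jbracket (fst \<zeta>) powr s)"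
        by (subst ennreal_mult) auto
      finally have "(ennreal (X_weight k s (b - 1) \<zeta> * (2 * \<bar>fst \<zeta>\<bar> / (jbracket (fst \<zeta>))\<^sup>2)) * ?i)\<^sup>2 \<le> (2 * ennreal (jbracket (fst \<zeta>) powr s) * ?i)\<^sup>2"
        by (intro power_mono mult_right_mono) auto
      then show "(ennreal (X_weight k s (b - 1) \<zeta> * (2 * \<bar>fst \<zeta>\<bar> / (jbracket (fst \<zeta>))\<^sup>2)) * ?i)\<^sup>2 \<le> 4 * (ennreal (jbracket (fst \<zeta>) powr s) * ?i)\<^sup>2"
        by (simp add: power_mult_distrib mult.assoc)
    qed
    also have "\<dots> = 4 * Hs_nn s (\<lambda>\<zeta>. \<integral>\<^sup>+z. F z * K (\<zeta> - z) \<partial>lborel)"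
      unfolding Hs_nn_def by (rule nn_integral_cmult) measurable
    also have "\<dots> \<le> 4 * (c * (Hs_nn s F * ?L K + ?L F * Hs_nn s K))"
      unfolding c_def using s by (intro mult_left_mono Hs_nn_convolution) auto
    also have "\<dots> \<le> 4 * (c * (?X F * (l * ?X G * (l * ?X H)) + l * ?X F * (c * (?X G * (l * ?X H) + l * ?X G * ?X H))))"
      by (intro mult_left_mono add_mono mult_mono A L LK AK) auto
    also have "\<dots> = C * (?X F * ?X G * ?X H)"
      unfolding C_def by (simp only: distrib_left distrib_right mult_ac)
    finally show ?thesis unfolding K_def .
  qed
  ultimately show ?thesis using that by blast
qed

section \<open>Fourier inversion\<close>

text \<open>The transform in a general Euclidean space: it is needed in two dimensions for the functions \<open>u\<close>, and in one
  dimension for the symbol as a function of \<open>\<xi>\<close> alone.\<close>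

definition ft :: "('a::euclidean_space \<Rightarrow> complex) \<Rightarrow> 'a \<Rightarrow> complex" where
  "ft u \<zeta> = (\<integral>z. cis (- (z \<bullet> \<zeta>)) * u z \<partial>lborel)"

definition gauss :: "'a::euclidean_space \<Rightarrow> real" where
  "gauss x = exp (- (norm x)\<^sup>2 / 2)"

lemma cis_measurable [measurable]: "cis \<in> borel_measurable borel"
  by (intro borel_measurable_continuous_onI continuous_intros)

lemma gauss_measurable [measurable]: "gauss \<in> borel_measurable borel"
  unfolding gauss_def by measurable

lemma gauss_nonneg [simp]: "0 \<le> gauss x"
  by (simp_all add: gauss_def)

lemma gauss_0: "gauss 0 = 1"
  by (simp add: gauss_def)

lemma gauss_le_1: "gauss x \<le> 1"
  by (simp add: gauss_def)

lemma integrable_cis_mult: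
  fixes u :: "'a::euclidean_space \<Rightarrow> complex"
  assumes u: "integrable lborel u" and [measurable]: "h \<in> borel_measurable borel"
  shows "integrable lborel (\<lambda>z. cis (h z) * u z)"
  by (rule Bochner_Integration.integrable_bound[OF u]) (use borel_measurable_integrable[OF u] in \<open>auto simp: norm_mult\<close>)

lemma integrable_ft_integrand:
  fixes u :: "'a::euclidean_space \<Rightarrow> complex"
  assumes u: "integrable lborel u"
  shows "integrable lborel (\<lambda>z. cis (- (z \<bullet> \<zeta>)) * u z)"
  by (intro integrable_cis_mult u) measurable

lemma norm_ft_le:
  assumes u: "integrable lborel u"
  shows "norm (ft u \<zeta>) \<le> (\<integral>z. norm (u z) \<partial>lborel)"
proof -
  have "norm (ft u \<zeta>) \<le> (\<integral>z. norm (cis (- (z \<bullet> \<zeta>)) * u z) \<partial>lborel)"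
    unfolding ft_def by (rule integral_norm_bound)
  then show ?thesis by (simp add: norm_mult)
qed

lemma continuous_ft:
  fixes u :: "'a::euclidean_space \<Rightarrow> complex"
  assumes u: "integrable lborel u"
  shows "isCont (ft u) \<zeta>"
proof (unfold continuous_at_sequentially, intro allI impI)
  fix X :: "nat \<Rightarrow> 'a" assume X: "X \<longlonglongrightarrow> \<zeta>"
  have [measurable]: "u \<in> borel_measurable borel" using borel_measurable_integrable[OF u] by simp
  show "(ft u \<circ> X) \<longlonglongrightarrow> ft u \<zeta>"
    unfolding ft_def comp_def
  proof (rule integral_dominated_convergence[where w="\<lambda>z. norm (u z)"])
    show "AE z in lborel. (\<lambda>n. cis (- (z \<bullet> X n)) * u z) \<longlonglongrightarrow> cis (- (z \<bullet> \<zeta>)) * u z"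
      by (intro always_eventually allI tendsto_intros X)
  qed (use u in \<open>auto simp: norm_mult\<close>)
qed

lemma ft_measurable [measurable]:
  fixes u :: "'a::euclidean_space \<Rightarrow> complex"
  assumes u: "integrable lborel u"
  shows "ft u \<in> borel_measurable borel"
  by (intro borel_measurable_continuous_onI continuous_at_imp_continuous_on ballI continuous_ft u)

lemma integrable_tensor:
  fixes f :: "'a::euclidean_space \<Rightarrow> complex" and g :: "'b::euclidean_space \<Rightarrow> complex"
  assumes f: "integrable lborel f" and g: "integrable lborel g"
    and h [measurable]: "(\<lambda>(x, y). h x y) \<in> borel_measurable (lborel \<Otimes>\<^sub>M lborel)" and h1: "\<And>x y. norm (h x y) \<le> 1"
  shows "integrable (lborel \<Otimes>\<^sub>M lborel) (\<lambda>(x, y). h x y * (f x * g y) :: complex)"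
proof (rule integrableI_bounded)
  have [measurable]: "f \<in> borel_measurable borel" "g \<in> borel_measurable borel"
    using borel_measurable_integrable[OF f] borel_measurable_integrable[OF g] by auto
  show "(\<lambda>(x, y). h x y * (f x * g y)) \<in> borel_measurable (lborel \<Otimes>\<^sub>M lborel)" by measurable
  have "(\<integral>\<^sup>+z. ennreal (norm (case z of (x, y) \<Rightarrow> h x y * (f x * g y))) \<partial>(lborel \<Otimes>\<^sub>M lborel))
    \<le> (\<integral>\<^sup>+z. ennreal (norm (f (fst z))) * ennreal (norm (g (snd z))) \<partial>(lborel \<Otimes>\<^sub>M lborel))"
  proof (intro nn_integral_mono)
    fix z :: "'a \<times> 'b"
    have "norm (h (fst z) (snd z)) * (norm (f (fst z)) * norm (g (snd z))) \<le> 1 * (norm (f (fst z)) * norm (g (snd z)))"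
      by (intro mult_right_mono h1) auto
    then show "ennreal (norm (case z of (x, y) \<Rightarrow> h x y * (f x * g y))) \<le> ennreal (norm (f (fst z))) * ennreal (norm (g (snd z)))"
      by (simp add: norm_mult split_beta ennreal_mult[symmetric] ennreal_leI)
  qed
  also have "\<dots> = (\<integral>\<^sup>+x. \<integral>\<^sup>+y. ennreal (norm (f x)) * ennreal (norm (g y)) \<partial>lborel \<partial>lborel)"
    by (subst lborel.nn_integral_fst[symmetric]) simp_all
  also have "\<dots> = (\<integral>\<^sup>+x. ennreal (norm (f x)) \<partial>lborel) * (\<integral>\<^sup>+y. ennreal (norm (g y)) \<partial>lborel)"
    by (simp add: nn_integral_cmult nn_integral_multc)
  also have "\<dots> < \<infinity>"
    using f g by (simp add: integrable_iff_bounded ennreal_mult_less_top)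
  finally show "(\<integral>\<^sup>+z. ennreal (norm (case z of (x, y) \<Rightarrow> h x y * (f x * g y))) \<partial>(lborel \<Otimes>\<^sub>M lborel)) < \<infinity>" .
qed

lemma integral_affine:
  fixes f :: "'a::euclidean_space \<Rightarrow> 'b::{banach, second_countable_topology}"
  assumes [measurable]: "f \<in> borel_measurable borel" and c: "c \<noteq> 0"
  shows "(\<integral>x. f x \<partial>lborel) = \<bar>c\<bar> ^ DIM('a) *\<^sub>R (\<integral>x. f (t + c *\<^sub>R x) \<partial>lborel)"
  by (subst lborel_affine[OF c, of t]) (simp add: integral_density integral_distr)

lemma integrable_affine:
  fixes f :: "'a::euclidean_space \<Rightarrow> 'b::{banach, second_countable_topology}"
  assumes f: "integrable lborel f" and c: "c \<noteq> 0"
  shows "integrable lborel (\<lambda>x. f (t + c *\<^sub>R x))"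
proof -
  have [measurable]: "f \<in> borel_measurable borel" using borel_measurable_integrable[OF f] by simp
  have "integrable (density (distr lborel borel (\<lambda>x. t + c *\<^sub>R x)) (\<lambda>_. ennreal (\<bar>c\<bar> ^ DIM('a)))) f"
    using f lborel_affine[OF c, of t] by simp
  then have "integrable lborel (\<lambda>x. \<bar>c\<bar> ^ DIM('a) *\<^sub>R f (t + c *\<^sub>R x))"
    by (simp add: integrable_density integrable_distr_eq)
  then have "integrable lborel (\<lambda>x. inverse (\<bar>c\<bar> ^ DIM('a)) *\<^sub>R (\<bar>c\<bar> ^ DIM('a) *\<^sub>R f (t + c *\<^sub>R x)))"
    by (rule integrable_scaleR_right)
  then show ?thesis using c by simp
qed

text \<open>Inserting \<open>gauss (e * \<zeta>)\<close> makes the double integral absolutely convergent, and Fubini turns the inverse transform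
  into the mean of \<open>u\<close> over a Gaussian of width \<open>e\<close> around \<open>x\<close>. For \<open>e \<rightarrow> 0\<close> both sides converge by dominated
  convergence. The transform of the Gaussian is a hypothesis, so that one proof serves both dimensions.\<close>

lemma ft_inversion_gauss:
  fixes u :: "'a::euclidean_space \<Rightarrow> complex"
  assumes gi: "integrable lborel (gauss :: 'a \<Rightarrow> real)"
    and gft: "\<And>x :: 'a. (\<integral>y. cis (x \<bullet> y) * of_real (gauss y) \<partial>lborel) = of_real (c * gauss x)"
    and u: "integrable lborel u" and cont: "\<And>x. isCont u x" and bd: "\<And>x. norm (u x) \<le> B"
    and ui: "integrable lborel (ft u)"
  shows "(\<integral>\<zeta>. cis (x \<bullet> \<zeta>) * ft u \<zeta> \<partial>lborel) = of_real (c\<^sup>2) * u x"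
proof -
  have um [measurable]: "u \<in> borel_measurable borel" using borel_measurable_integrable[OF u] by simp
  have ftm [measurable]: "ft u \<in> borel_measurable borel" by (rule ft_measurable[OF u])
  define e where "e n = inverse (real (Suc n))" for n
  have e: "0 < e n" for n by (simp add: e_def)
  have e0: "e \<longlonglongrightarrow> 0" unfolding e_def by (rule LIMSEQ_inverse_real_of_nat)
  have gc: "isCont (gauss :: 'a \<Rightarrow> real) y" for y unfolding gauss_def by (intro continuous_intros) auto
  have ci: "integrable lborel (\<lambda>y::'a. complex_of_real (gauss y))"
    using gi by simp
  have g0: "(\<integral>y. complex_of_real (gauss (y :: 'a)) \<partial>lborel) = of_real c"
    using gft[of 0] by (simp add: gauss_0)
  have key: "(\<integral>\<zeta>. cis (x \<bullet> \<zeta>) * ft u \<zeta> * of_real (gauss (e n *\<^sub>R \<zeta>)) \<partial>lborel)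
     = of_real c * (\<integral>w. u (x - e n *\<^sub>R w) * of_real (gauss w) \<partial>lborel)" for n
  proof -
    let ?e = "e n"
    have gi': "integrable lborel (\<lambda>y::'a. complex_of_real (gauss (?e *\<^sub>R y)))"
      using integrable_affine[OF ci, of ?e 0] e[of n] by simp
    have I: "integrable (lborel \<Otimes>\<^sub>M lborel) (\<lambda>(z, \<zeta>). cis ((x - z) \<bullet> \<zeta>) * (u z * complex_of_real (gauss (?e *\<^sub>R \<zeta>))))"
      by (rule integrable_tensor[OF u gi']) auto
    have "(\<integral>\<zeta>. cis (x \<bullet> \<zeta>) * ft u \<zeta> * of_real (gauss (?e *\<^sub>R \<zeta>)) \<partial>lborel) =
       (\<integral>\<zeta>. (\<integral>z. cis ((x - z) \<bullet> \<zeta>) * (u z * complex_of_real (gauss (?e *\<^sub>R \<zeta>))) \<partial>lborel) \<partial>lborel)"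
    proof (rule Bochner_Integration.integral_cong[OF refl])
      fix \<zeta> :: 'a
      have "cis (x \<bullet> \<zeta>) * ft u \<zeta> * of_real (gauss (?e *\<^sub>R \<zeta>)) =
        (\<integral>z. (cis (x \<bullet> \<zeta>) * of_real (gauss (?e *\<^sub>R \<zeta>))) * (cis (- (z \<bullet> \<zeta>)) * u z) \<partial>lborel)"
        unfolding ft_def by simp
      also have "\<dots> = (\<integral>z. cis ((x - z) \<bullet> \<zeta>) * (u z * complex_of_real (gauss (?e *\<^sub>R \<zeta>))) \<partial>lborel)"
      proof (intro Bochner_Integration.integral_cong refl)
        fix z
        have "cis ((x - z) \<bullet> \<zeta>) = cis (x \<bullet> \<zeta>) * cis (- (z \<bullet> \<zeta>))"
          by (simp add: cis_mult inner_diff_left)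
        then show "(cis (x \<bullet> \<zeta>) * of_real (gauss (?e *\<^sub>R \<zeta>))) * (cis (- (z \<bullet> \<zeta>)) * u z) =
           cis ((x - z) \<bullet> \<zeta>) * (u z * complex_of_real (gauss (?e *\<^sub>R \<zeta>)))"
          by (simp only: mult_ac)
      qed
      finally show "cis (x \<bullet> \<zeta>) * ft u \<zeta> * of_real (gauss (?e *\<^sub>R \<zeta>)) =
        (\<integral>z. cis ((x - z) \<bullet> \<zeta>) * (u z * complex_of_real (gauss (?e *\<^sub>R \<zeta>))) \<partial>lborel)" .
    qed
    also have "\<dots> = (\<integral>z. (\<integral>\<zeta>. cis ((x - z) \<bullet> \<zeta>) * (u z * complex_of_real (gauss (?e *\<^sub>R \<zeta>))) \<partial>lborel) \<partial>lborel)"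
      by (rule lborel_pair.Fubini_integral[OF I])
    also have "\<dots> = (\<integral>z. u z * (of_real (inverse (?e ^ DIM('a)) * (c * gauss ((1 / ?e) *\<^sub>R (x - z))))) \<partial>lborel)"
    proof (rule Bochner_Integration.integral_cong[OF refl])
      fix z :: 'a
      have "(\<integral>\<zeta>. cis ((x - z) \<bullet> \<zeta>) * complex_of_real (gauss (?e *\<^sub>R \<zeta>)) \<partial>lborel)
        = \<bar>1 / ?e\<bar> ^ DIM('a) *\<^sub>R (\<integral>\<zeta>. cis ((x - z) \<bullet> (0 + (1 / ?e) *\<^sub>R \<zeta>)) * complex_of_real (gauss (?e *\<^sub>R (0 + (1 / ?e) *\<^sub>R \<zeta>))) \<partial>lborel)"
        using e[of n] by (intro integral_affine) auto
      also have "(\<integral>\<zeta>. cis ((x - z) \<bullet> (0 + (1 / ?e) *\<^sub>R \<zeta>)) * complex_of_real (gauss (?e *\<^sub>R (0 + (1 / ?e) *\<^sub>R \<zeta>))) \<partial>lborel)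
         = (\<integral>\<zeta>. cis (((1 / ?e) *\<^sub>R (x - z)) \<bullet> \<zeta>) * complex_of_real (gauss \<zeta>) \<partial>lborel)"
        using e[of n] by (intro Bochner_Integration.integral_cong) auto
      also have "\<dots> = of_real (c * gauss ((1 / ?e) *\<^sub>R (x - z)))" by (rule gft)
      finally have 1: "(\<integral>\<zeta>. cis ((x - z) \<bullet> \<zeta>) * complex_of_real (gauss (?e *\<^sub>R \<zeta>)) \<partial>lborel)
        = of_real (inverse (?e ^ DIM('a)) * (c * gauss ((1 / ?e) *\<^sub>R (x - z))))"
        using e[of n] by (simp add: scaleR_conv_of_real power_one_over inverse_eq_divide)
      have "(\<integral>\<zeta>. cis ((x - z) \<bullet> \<zeta>) * (u z * complex_of_real (gauss (?e *\<^sub>R \<zeta>))) \<partial>lborel)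
        = (\<integral>\<zeta>. u z * (cis ((x - z) \<bullet> \<zeta>) * complex_of_real (gauss (?e *\<^sub>R \<zeta>))) \<partial>lborel)"
        by (simp add: mult_ac)
      also have "\<dots> = u z * (\<integral>\<zeta>. cis ((x - z) \<bullet> \<zeta>) * complex_of_real (gauss (?e *\<^sub>R \<zeta>)) \<partial>lborel)"
        by simp
      finally show "(\<integral>\<zeta>. cis ((x - z) \<bullet> \<zeta>) * (u z * complex_of_real (gauss (?e *\<^sub>R \<zeta>))) \<partial>lborel)
         = u z * (of_real (inverse (?e ^ DIM('a)) * (c * gauss ((1 / ?e) *\<^sub>R (x - z)))))"
        unfolding 1 by simp
    qed
    also have "\<dots> = \<bar>- ?e\<bar> ^ DIM('a) *\<^sub>R (\<integral>w. u (x + (- ?e) *\<^sub>R w) * (of_real (inverse (?e ^ DIM('a)) * (c * gauss ((1 / ?e) *\<^sub>R (x - (x + (- ?e) *\<^sub>R w)))))) \<partial>lborel)"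
      using e[of n] by (intro integral_affine) auto
    also have "\<dots> = of_real (?e ^ DIM('a)) * (\<integral>w. (of_real (inverse (?e ^ DIM('a))) * of_real c) * (u (x - ?e *\<^sub>R w) * of_real (gauss w)) \<partial>lborel)"
      using e[of n] by (simp add: scaleR_conv_of_real mult_ac)
    also have "\<dots> = (of_real (?e ^ DIM('a)) * of_real (inverse (?e ^ DIM('a)))) * of_real c * (\<integral>w. u (x - ?e *\<^sub>R w) * of_real (gauss w) \<partial>lborel)"
      by (simp only: integral_mult_right_zero mult.assoc)
    also have "of_real (?e ^ DIM('a)) * of_real (inverse (?e ^ DIM('a))) = (1::complex)"
      using e[of n] by (simp add: of_real_mult[symmetric] del: of_real_mult of_real_power of_real_inverse)
    finally show ?thesis by simp
  qed
  have lim1: "(\<lambda>n. \<integral>\<zeta>. cis (x \<bullet> \<zeta>) * ft u \<zeta> * of_real (gauss (e n *\<^sub>R \<zeta>)) \<partial>lborel) \<longlonglongrightarrow> (\<integral>\<zeta>. cis (x \<bullet> \<zeta>) * ft u \<zeta> \<partial>lborel)"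
  proof (rule integral_dominated_convergence[where w="\<lambda>\<zeta>. norm (ft u \<zeta>)"])
    show "AE \<zeta> in lborel. (\<lambda>n. cis (x \<bullet> \<zeta>) * ft u \<zeta> * of_real (gauss (e n *\<^sub>R \<zeta>))) \<longlonglongrightarrow> cis (x \<bullet> \<zeta>) * ft u \<zeta>"
    proof (intro always_eventually allI)
      fix \<zeta> :: 'a
      have "(\<lambda>n. e n *\<^sub>R \<zeta>) \<longlonglongrightarrow> 0 *\<^sub>R \<zeta>" by (intro tendsto_intros e0)
      then have "(\<lambda>n. gauss (e n *\<^sub>R \<zeta>)) \<longlonglongrightarrow> gauss (0 *\<^sub>R \<zeta>)" by (intro isCont_tendsto_compose[OF gc])
      then have "(\<lambda>n. cis (x \<bullet> \<zeta>) * ft u \<zeta> * of_real (gauss (e n *\<^sub>R \<zeta>))) \<longlonglongrightarrow> cis (x \<bullet> \<zeta>) * ft u \<zeta> * of_real (gauss (0 *\<^sub>R \<zeta>))"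
        by (intro tendsto_intros)
      then show "(\<lambda>n. cis (x \<bullet> \<zeta>) * ft u \<zeta> * of_real (gauss (e n *\<^sub>R \<zeta>))) \<longlonglongrightarrow> cis (x \<bullet> \<zeta>) * ft u \<zeta>"
        by (simp add: gauss_def)
    qed
    show "AE \<zeta> in lborel. norm (cis (x \<bullet> \<zeta>) * ft u \<zeta> * of_real (gauss (e n *\<^sub>R \<zeta>))) \<le> norm (ft u \<zeta>)" for n
      by (auto simp: norm_mult gauss_le_1 intro!: mult_left_le)
  qed (use ui in auto)
  have lim2: "(\<lambda>n. \<integral>w. u (x - e n *\<^sub>R w) * of_real (gauss w) \<partial>lborel) \<longlonglongrightarrow> (\<integral>w. u x * of_real (gauss (w::'a)) \<partial>lborel)"
  proof (rule integral_dominated_convergence[where w="\<lambda>w::'a. B * gauss w"])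
    show "AE w in lborel. (\<lambda>n. u (x - e n *\<^sub>R w) * of_real (gauss w)) \<longlonglongrightarrow> u x * of_real (gauss w)"
    proof (intro always_eventually allI)
      fix w :: 'a
      have "(\<lambda>n. x - e n *\<^sub>R w) \<longlonglongrightarrow> x - 0 *\<^sub>R w" by (intro tendsto_intros e0)
      then have "(\<lambda>n. x - e n *\<^sub>R w) \<longlonglongrightarrow> x" by simp
      then have "(\<lambda>n. u (x - e n *\<^sub>R w)) \<longlonglongrightarrow> u x" by (intro isCont_tendsto_compose[OF cont])
      then show "(\<lambda>n. u (x - e n *\<^sub>R w) * of_real (gauss w)) \<longlonglongrightarrow> u x * of_real (gauss w)" by (intro tendsto_intros)
    qed
    show "AE w in lborel. norm (u (x - e n *\<^sub>R w) * of_real (gauss w)) \<le> B * gauss w" for n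
      by (auto simp: norm_mult intro!: mult_right_mono bd)
  qed (use gi in auto)
  have "(\<lambda>n. of_real c * (\<integral>w. u (x - e n *\<^sub>R w) * of_real (gauss w) \<partial>lborel)) \<longlonglongrightarrow> of_real c * (\<integral>w. u x * of_real (gauss (w::'a)) \<partial>lborel)"
    by (intro tendsto_intros lim2)
  with lim1 have "(\<integral>\<zeta>. cis (x \<bullet> \<zeta>) * ft u \<zeta> \<partial>lborel) = of_real c * (\<integral>w. u x * of_real (gauss (w::'a)) \<partial>lborel)"
    unfolding key by (rule LIMSEQ_unique)
  also have "\<dots> = of_real (c\<^sup>2) * u x" using g0 by (simp add: power2_eq_square)
  finally show ?thesis .
qed

text \<open>Read off from the characteristic function of the standard normal distribution.\<close>

lemma gauss_real: "integrable lborel (gauss :: real \<Rightarrow> real)"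
  "(\<integral>y. cis ((x::real) \<bullet> y) * of_real (gauss y) \<partial>lborel) = of_real (sqrt (2 * pi) * gauss x)"
proof -
  have g: "gauss y = sqrt (2 * pi) * std_normal_density y" for y :: real
    by (simp add: gauss_def std_normal_density_def)
  have "integrable lborel (\<lambda>y. std_normal_density y)"
    by simp
  then show "integrable lborel (gauss :: real \<Rightarrow> real)"
    unfolding g[abs_def] by simp
  have "char std_normal_distribution x = complex_of_real (exp (- x\<^sup>2 / 2))"
    by (simp add: char_std_normal_distribution)
  then have "(\<integral>y. std_normal_density y *\<^sub>R iexp (x * y) \<partial>lborel) = complex_of_real (gauss x)"
    unfolding char_def by (simp add: integral_density gauss_def)
  then have "complex_of_real (sqrt (2 * pi)) * (\<integral>y. std_normal_density y *\<^sub>R iexp (x * y) \<partial>lborel) = of_real (sqrt (2 * pi) * gauss x)"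
    by simp
  then have "(\<integral>y. complex_of_real (sqrt (2 * pi)) * (std_normal_density y *\<^sub>R iexp (x * y)) \<partial>lborel) = of_real (sqrt (2 * pi) * gauss x)"
    by (simp only: integral_mult_right_zero)
  moreover have "complex_of_real (sqrt (2 * pi)) * (std_normal_density y *\<^sub>R iexp (x * y)) = cis (x \<bullet> y) * of_real (gauss y)" for y
    by (simp add: g cis_conv_exp scaleR_conv_of_real mult_ac)
  ultimately show "(\<integral>y. cis (x \<bullet> y) * of_real (gauss y) \<partial>lborel) = of_real (sqrt (2 * pi) * gauss x)"
    by simp
qed

text \<open>The Gaussian is a tensor product.\<close>

lemma gauss_R2: "integrable lborel (gauss :: real \<times> real \<Rightarrow> real)"
  "(\<integral>y. cis (x \<bullet> y) * of_real (gauss y) \<partial>lborel) = of_real (2 * pi * gauss (x :: real \<times> real))"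
proof -
  have g: "gauss (a, b) = gauss a * gauss b" for a b :: real
    by (simp add: gauss_def norm_Pair exp_add[symmetric] add_divide_distrib)
  have I: "integrable (lborel \<Otimes>\<^sub>M lborel) (\<lambda>(a, b). h a b * (complex_of_real (gauss a) * complex_of_real (gauss b)))"
    if "(\<lambda>(a, b). h a b) \<in> borel_measurable (lborel \<Otimes>\<^sub>M lborel)" "\<And>a b. norm (h a b) \<le> 1" for h :: "real \<Rightarrow> real \<Rightarrow> complex"
    by (rule integrable_tensor) (use gauss_real(1) that in auto)
  have "integrable (lborel \<Otimes>\<^sub>M lborel) (\<lambda>z. complex_of_real (gauss (z::real \<times> real)))"
  proof -
    have "(\<lambda>(a, b). 1 * (complex_of_real (gauss a) * complex_of_real (gauss b))) = (\<lambda>z. complex_of_real (gauss (z::real \<times> real)))"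
      by (auto simp: g)
    then show ?thesis using I[of "\<lambda>_ _. 1"] by (simp only:) simp
  qed
  from integrable_Re[OF this] show "integrable lborel (gauss :: real \<times> real \<Rightarrow> real)"
    by (simp add: lborel_prod)
  have I2: "integrable (lborel \<Otimes>\<^sub>M lborel) (\<lambda>(a, b). cis (fst x * a + snd x * b) * (complex_of_real (gauss a) * complex_of_real (gauss b)))"
    by (rule I) auto
  have "(\<integral>y. cis (x \<bullet> y) * of_real (gauss y) \<partial>lborel) = (\<integral>y. (case y of (a, b) \<Rightarrow> cis (fst x * a + snd x * b) * (complex_of_real (gauss a) * complex_of_real (gauss b))) \<partial>(lborel \<Otimes>\<^sub>M lborel))"
    unfolding lborel_prod by (intro Bochner_Integration.integral_cong) (auto simp: g inner_prod_def)
  also have "\<dots> = (\<integral>a. (\<integral>b. cis (fst x * a + snd x * b) * (complex_of_real (gauss a) * complex_of_real (gauss b)) \<partial>lborel) \<partial>lborel)"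
    by (rule lborel_pair.integral_fst[symmetric, OF I2])
  also have "\<dots> = (\<integral>a. (\<integral>b. (cis (fst x * a) * complex_of_real (gauss a)) * (cis (snd x \<bullet> b) * complex_of_real (gauss b)) \<partial>lborel) \<partial>lborel)"
    by (simp add: cis_mult[symmetric] mult_ac)
  also have "\<dots> = (\<integral>a. (cis (fst x \<bullet> a) * complex_of_real (gauss a)) * of_real (sqrt (2 * pi) * gauss (snd x)) \<partial>lborel)"
    by (simp only: gauss_real(2) integral_mult_right_zero) simp
  also have "\<dots> = of_real (sqrt (2 * pi) * gauss (fst x)) * of_real (sqrt (2 * pi) * gauss (snd x))"
    by (simp only: gauss_real(2) integral_mult_left_zero)
  also have "\<dots> = of_real (2 * pi * gauss x)"
    using g[of "fst x" "snd x"] by (simp add: of_real_mult[symmetric] mult_ac del: of_real_mult)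
  finally show "(\<integral>y. cis (x \<bullet> y) * of_real (gauss y) \<partial>lborel) = of_real (2 * pi * gauss x)" .
qed

lemma ft_inversion_real:
  fixes u :: "real \<Rightarrow> complex"
  assumes "integrable lborel u" "\<And>x. isCont u x" "\<And>x. norm (u x) \<le> B" "integrable lborel (ft u)"
  shows "(\<integral>\<zeta>. cis (x * \<zeta>) * ft u \<zeta> \<partial>lborel) = of_real (2 * pi) * u x"
  using ft_inversion_gauss[OF gauss_real assms] by (simp add: inner_real_def)

lemma ft_inversion_R2:
  fixes u :: "real \<times> real \<Rightarrow> complex"
  assumes "integrable lborel u" "\<And>x. isCont u x" "\<And>x. norm (u x) \<le> B" "integrable lborel (ft u)"
  shows "(\<integral>\<zeta>. cis (x \<bullet> \<zeta>) * ft u \<zeta> \<partial>lborel) = of_real ((2 * pi)\<^sup>2) * u x"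
  by (rule ft_inversion_gauss[OF gauss_R2 assms])

lemma fourier_eq_ft: "fourier u = ft u"
proof (intro ext)
  fix \<zeta> :: "real \<times> real"
  have "exp (- (\<i> * complex_of_real r)) = cis (- r)" for r
    by (simp add: cis_conv_exp)
  then show "fourier u \<zeta> = ft u \<zeta>"
    by (cases \<zeta>) (simp only: fourier_def ft_def prod.case inner_prod_def fst_conv snd_conv inner_real_def)
qed

lemma inv_fourier_eq: "inv_fourier F z = complex_of_real (1 / (2 * pi)\<^sup>2) * (\<integral>\<zeta>. cis (z \<bullet> \<zeta>) * F \<zeta> \<partial>lborel)"
  by (cases z) (simp add: inv_fourier_def cis_conv_exp inner_prod_def)

lemma inv_fourier_ft:
  fixes u :: "real \<times> real \<Rightarrow> complex"
  assumes "integrable lborel u" "\<And>x. isCont u x" "\<And>x. norm (u x) \<le> B" "integrable lborel (ft u)"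
  shows "inv_fourier (ft u) = u"
  by (intro ext) (simp add: inv_fourier_eq ft_inversion_R2[OF assms])

text \<open>Only one factor is expanded by the inversion formula; for the other one integrability suffices.\<close>

lemma ft_mult:
  fixes u w :: "real \<times> real \<Rightarrow> complex"
  assumes u: "integrable lborel u" "\<And>x. isCont u x" "\<And>x. norm (u x) \<le> B" "integrable lborel (ft u)"
    and w: "integrable lborel w"
  shows "of_real ((2 * pi)\<^sup>2) * ft (\<lambda>z. u z * w z) \<zeta> = (\<integral>\<eta>. ft u \<eta> * ft w (\<zeta> - \<eta>) \<partial>lborel)"
proof -
  have I: "integrable (lborel \<Otimes>\<^sub>M lborel) (\<lambda>(\<eta>, z). cis (- (z \<bullet> (\<zeta> - \<eta>))) * (ft u \<eta> * w z))"
    by (rule integrable_tensor[OF u(4) w]) auto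
  have "of_real ((2 * pi)\<^sup>2) * ft (\<lambda>z. u z * w z) \<zeta> = (\<integral>z. of_real ((2 * pi)\<^sup>2) * (cis (- (z \<bullet> \<zeta>)) * (u z * w z)) \<partial>lborel)"
    unfolding ft_def by simp
  also have "\<dots> = (\<integral>z. (\<integral>\<eta>. cis (- (z \<bullet> (\<zeta> - \<eta>))) * (ft u \<eta> * w z) \<partial>lborel) \<partial>lborel)"
  proof (intro Bochner_Integration.integral_cong refl)
    fix z :: "real \<times> real"
    have "of_real ((2 * pi)\<^sup>2) * (cis (- (z \<bullet> \<zeta>)) * (u z * w z)) = cis (- (z \<bullet> \<zeta>)) * w z * (of_real ((2 * pi)\<^sup>2) * u z)"
      by (simp only: mult_ac)
    also have "\<dots> = (\<integral>\<eta>. cis (- (z \<bullet> \<zeta>)) * w z * (cis (z \<bullet> \<eta>) * ft u \<eta>) \<partial>lborel)"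
      unfolding ft_inversion_R2[OF u, symmetric] by simp
    also have "\<dots> = (\<integral>\<eta>. cis (- (z \<bullet> (\<zeta> - \<eta>))) * (ft u \<eta> * w z) \<partial>lborel)"
    proof (intro Bochner_Integration.integral_cong refl)
      fix \<eta>
      have "cis (- (z \<bullet> (\<zeta> - \<eta>))) = cis (- (z \<bullet> \<zeta>)) * cis (z \<bullet> \<eta>)"
        by (simp add: cis_mult inner_diff_right)
      then show "cis (- (z \<bullet> \<zeta>)) * w z * (cis (z \<bullet> \<eta>) * ft u \<eta>) = cis (- (z \<bullet> (\<zeta> - \<eta>))) * (ft u \<eta> * w z)"
        by (simp only: mult_ac)
    qed
    finally show "of_real ((2 * pi)\<^sup>2) * (cis (- (z \<bullet> \<zeta>)) * (u z * w z)) = (\<integral>\<eta>. cis (- (z \<bullet> (\<zeta> - \<eta>))) * (ft u \<eta> * w z) \<partial>lborel)" .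
  qed
  also have "\<dots> = (\<integral>\<eta>. (\<integral>z. cis (- (z \<bullet> (\<zeta> - \<eta>))) * (ft u \<eta> * w z) \<partial>lborel) \<partial>lborel)"
    by (rule lborel_pair.Fubini_integral[OF I])
  also have "\<dots> = (\<integral>\<eta>. (\<integral>z. ft u \<eta> * (cis (- (z \<bullet> (\<zeta> - \<eta>))) * w z) \<partial>lborel) \<partial>lborel)"
    by (simp only: mult_ac)
  also have "\<dots> = (\<integral>\<eta>. ft u \<eta> * ft w (\<zeta> - \<eta>) \<partial>lborel)"
    by (simp add: ft_def)
  finally show ?thesis .
qed

section \<open>Schwartz functions\<close>

text \<open>Powers of \<open>1 + \<bar>x\<bar>\<close> and \<open>1 + \<bar>t\<bar>\<close> take the place of monomials because they increase with the exponent: a bound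
  with one weight implies the bounds with all smaller ones.\<close>

definition rapid :: "(real \<times> real \<Rightarrow> complex) \<Rightarrow> bool" where
  "rapid f \<longleftrightarrow> (\<forall>i j. \<exists>C. \<forall>x t. (1 + \<bar>x\<bar>) ^ i * (1 + \<bar>t\<bar>) ^ j * norm (f (x, t)) \<le> C)"

lemma rapidD: "rapid f \<Longrightarrow> \<exists>C. \<forall>x t. (1 + \<bar>x\<bar>) ^ i * (1 + \<bar>t\<bar>) ^ j * norm (f (x, t)) \<le> C"
  by (simp add: rapid_def)

lemma rapid_obtain:
  assumes "rapid f"
  obtains C where "0 \<le> C" "\<And>x t. (1 + \<bar>x\<bar>) ^ i * (1 + \<bar>t\<bar>) ^ j * norm (f (x, t)) \<le> C"
proof -
  obtain C where C: "\<And>x t. (1 + \<bar>x\<bar>) ^ i * (1 + \<bar>t\<bar>) ^ j * norm (f (x, t)) \<le> C"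
    using rapidD[OF assms] by blast
  have "0 \<le> (1 + \<bar>0\<bar>) ^ i * (1 + \<bar>0\<bar>) ^ j * norm (f (0, 0))" by simp
  also have "\<dots> \<le> C" by (rule C)
  finally show ?thesis using that C by blast
qed

lemma rapid_bounded:
  assumes "rapid f" obtains B where "\<And>z. norm (f z) \<le> B"
proof -
  obtain C where "\<And>x t. (1 + \<bar>x\<bar>) ^ 0 * (1 + \<bar>t\<bar>) ^ 0 * norm (f (x, t)) \<le> C"
    using rapidD[OF assms] by blast
  then have "norm (f z) \<le> C" for z by (cases z) simp
  then show ?thesis by (rule that)
qed

lemma one_plus_power_le: "(1 + a) ^ i \<le> 2 ^ i * (1 + a ^ i)" if "0 \<le> (a::real)"
proof -
  have "(1 + a) ^ i \<le> (2 * max 1 a) ^ i" using that by (intro power_mono) auto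
  also have "\<dots> = 2 ^ i * max 1 a ^ i" by (simp add: power_mult_distrib)
  also have "\<dots> \<le> 2 ^ i * (1 + a ^ i)" using that by (intro mult_left_mono) (auto simp: max_def)
  finally show ?thesis .
qed

lemma rapid_if_monomials:
  assumes "\<And>i j. \<exists>C. \<forall>x t. \<bar>x\<bar> ^ i * \<bar>t\<bar> ^ j * norm (f (x, t)) \<le> C"
  shows "rapid f"
  unfolding rapid_def
proof (intro allI)
  fix i j
  obtain A where A: "\<And>a b x t. \<bar>x\<bar> ^ a * \<bar>t\<bar> ^ b * norm (f (x, t)) \<le> A a b"
    using assms by metis
  have "(1 + \<bar>x\<bar>) ^ i * (1 + \<bar>t\<bar>) ^ j * norm (f (x, t)) \<le> 2 ^ i * 2 ^ j * (A 0 0 + A 0 j + A i 0 + A i j)" for x t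
  proof -
    have "(1 + \<bar>x\<bar>) ^ i * (1 + \<bar>t\<bar>) ^ j * norm (f (x, t)) \<le> (2 ^ i * (1 + \<bar>x\<bar> ^ i)) * (2 ^ j * (1 + \<bar>t\<bar> ^ j)) * norm (f (x, t))"
      by (intro mult_right_mono mult_mono one_plus_power_le) auto
    also have "\<dots> = 2 ^ i * 2 ^ j * (\<bar>x\<bar> ^ 0 * \<bar>t\<bar> ^ 0 * norm (f (x, t)) + \<bar>x\<bar> ^ 0 * \<bar>t\<bar> ^ j * norm (f (x, t))
        + \<bar>x\<bar> ^ i * \<bar>t\<bar> ^ 0 * norm (f (x, t)) + \<bar>x\<bar> ^ i * \<bar>t\<bar> ^ j * norm (f (x, t)))"
      by (simp add: algebra_simps)
    also have "\<dots> \<le> 2 ^ i * 2 ^ j * (A 0 0 + A 0 j + A i 0 + A i j)"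
      by (intro mult_left_mono add_mono A) auto
    finally show ?thesis .
  qed
  then show "\<exists>C. \<forall>x t. (1 + \<bar>x\<bar>) ^ i * (1 + \<bar>t\<bar>) ^ j * norm (f (x, t)) \<le> C" by blast
qed

lemma rapid_iff_schwartz_bounds:
  "rapid v \<longleftrightarrow> (\<forall>i j :: nat. bounded (range (\<lambda>(x, t). (x ^ i * t ^ j) *\<^sub>R v (x, t))))"
proof
  assume v: "rapid v"
  show "\<forall>i j :: nat. bounded (range (\<lambda>(x, t). (x ^ i * t ^ j) *\<^sub>R v (x, t)))"
  proof (intro allI)
    fix i j
    obtain C where C: "\<And>x t. (1 + \<bar>x\<bar>) ^ i * (1 + \<bar>t\<bar>) ^ j * norm (v (x, t)) \<le> C"
      using rapidD[OF v] by blast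
    have "norm ((x ^ i * t ^ j) *\<^sub>R v (x, t)) \<le> C" for x t
    proof -
      have "norm ((x ^ i * t ^ j) *\<^sub>R v (x, t)) = \<bar>x\<bar> ^ i * \<bar>t\<bar> ^ j * norm (v (x, t))"
        by (simp add: abs_mult power_abs)
      also have "\<dots> \<le> (1 + \<bar>x\<bar>) ^ i * (1 + \<bar>t\<bar>) ^ j * norm (v (x, t))"
        by (intro mult_right_mono mult_mono power_mono) auto
      finally show ?thesis using C order_trans by blast
    qed
    then show "bounded (range (\<lambda>(x, t). (x ^ i * t ^ j) *\<^sub>R v (x, t)))"
      unfolding bounded_iff by (intro exI[of _ C]) auto
  qed
next
  assume b: "\<forall>i j :: nat. bounded (range (\<lambda>(x, t). (x ^ i * t ^ j) *\<^sub>R v (x, t)))"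
  show "rapid v"
  proof (rule rapid_if_monomials)
    fix i j
    obtain C where "\<And>z. norm ((\<lambda>(x, t). (x ^ i * t ^ j) *\<^sub>R v (x, t)) z) \<le> C"
      using b unfolding bounded_iff by (meson rangeI)
    from this[of "(_, _)"] have "norm ((x ^ i * t ^ j) *\<^sub>R v (x, t)) \<le> C" for x t
      by simp
    then show "\<exists>C. \<forall>x t. \<bar>x\<bar> ^ i * \<bar>t\<bar> ^ j * norm (v (x, t)) \<le> C"
      by (auto simp: abs_mult power_abs)
  qed
qed

lemma rapid_add: assumes "rapid f" "rapid g" shows "rapid (\<lambda>z. f z + g z)"
  unfolding rapid_def
proof (intro allI)
  fix i j
  obtain A B where A: "\<And>x t. (1 + \<bar>x\<bar>) ^ i * (1 + \<bar>t\<bar>) ^ j * norm (f (x, t)) \<le> A"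
    and B: "\<And>x t. (1 + \<bar>x\<bar>) ^ i * (1 + \<bar>t\<bar>) ^ j * norm (g (x, t)) \<le> B"
    using rapidD[OF assms(1)] rapidD[OF assms(2)] by metis
  have "(1 + \<bar>x\<bar>) ^ i * (1 + \<bar>t\<bar>) ^ j * norm (f (x, t) + g (x, t)) \<le> A + B" for x t
  proof -
    have "(1 + \<bar>x\<bar>) ^ i * (1 + \<bar>t\<bar>) ^ j * norm (f (x, t) + g (x, t)) \<le> (1 + \<bar>x\<bar>) ^ i * (1 + \<bar>t\<bar>) ^ j * (norm (f (x, t)) + norm (g (x, t)))"
      by (intro mult_left_mono norm_triangle_ineq) auto
    also have "\<dots> \<le> A + B" using add_mono[OF A[of x t] B[of x t]] by (simp add: algebra_simps)
    finally show ?thesis .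
  qed
  then show "\<exists>C. \<forall>x t. (1 + \<bar>x\<bar>) ^ i * (1 + \<bar>t\<bar>) ^ j * norm (f (x, t) + g (x, t)) \<le> C" by blast
qed

lemma rapid_dominated:
  assumes "rapid f" and "\<And>z. norm (g z) \<le> c * norm (f z)" and "0 \<le> c"
  shows "rapid g"
  unfolding rapid_def
proof (intro allI)
  fix i j
  obtain A where A: "\<And>x t. (1 + \<bar>x\<bar>) ^ i * (1 + \<bar>t\<bar>) ^ j * norm (f (x, t)) \<le> A"
    using rapidD[OF assms(1)] by metis
  have "(1 + \<bar>x\<bar>) ^ i * (1 + \<bar>t\<bar>) ^ j * norm (g (x, t)) \<le> c * A" for x t
  proof -
    have "(1 + \<bar>x\<bar>) ^ i * (1 + \<bar>t\<bar>) ^ j * norm (g (x, t)) \<le> (1 + \<bar>x\<bar>) ^ i * (1 + \<bar>t\<bar>) ^ j * (c * norm (f (x, t)))"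
      by (intro mult_left_mono assms) auto
    also have "\<dots> \<le> c * A" using mult_left_mono[OF A[of x t] assms(3)] by (simp add: mult_ac)
    finally show ?thesis .
  qed
  then show "\<exists>C. \<forall>x t. (1 + \<bar>x\<bar>) ^ i * (1 + \<bar>t\<bar>) ^ j * norm (g (x, t)) \<le> C" by blast
qed

lemma rapid_mult: assumes "rapid f" "rapid g" shows "rapid (\<lambda>z. f z * g z)"
proof -
  obtain B where B: "\<And>z. norm (f z) \<le> B" using rapid_bounded[OF assms(1)] by blast
  have B0: "0 \<le> B" by (rule order_trans[OF norm_ge_zero B[of undefined]])
  show ?thesis
  proof (rule rapid_dominated[OF assms(2) _ B0])
    show "norm (f z * g z) \<le> B * norm (g z)" for z
      unfolding norm_mult by (intro mult_right_mono B norm_ge_zero)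
  qed
qed

lemma rapid_polynomial_weight:
  assumes f: "rapid f" and g: "\<And>x t. norm (g (x, t)) \<le> c * ((1 + \<bar>x\<bar>) ^ m * (1 + \<bar>t\<bar>) ^ n * norm (f (x, t)))" and "0 \<le> c"
  shows "rapid g"
  unfolding rapid_def
proof (intro allI)
  fix i j
  obtain A where A: "\<And>x t. (1 + \<bar>x\<bar>) ^ (i + m) * (1 + \<bar>t\<bar>) ^ (j + n) * norm (f (x, t)) \<le> A"
    using rapidD[OF assms(1)] by metis
  have "(1 + \<bar>x\<bar>) ^ i * (1 + \<bar>t\<bar>) ^ j * norm (g (x, t)) \<le> c * A" for x t
  proof -
    have "(1 + \<bar>x\<bar>) ^ i * (1 + \<bar>t\<bar>) ^ j * norm (g (x, t)) \<le> (1 + \<bar>x\<bar>) ^ i * (1 + \<bar>t\<bar>) ^ j * (c * ((1 + \<bar>x\<bar>) ^ m * (1 + \<bar>t\<bar>) ^ n * norm (f (x, t))))"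
      by (intro mult_left_mono assms) auto
    also have "\<dots> = c * ((1 + \<bar>x\<bar>) ^ (i + m) * (1 + \<bar>t\<bar>) ^ (j + n) * norm (f (x, t)))"
      by (simp add: power_add mult_ac)
    also have "\<dots> \<le> c * A" by (rule mult_left_mono[OF A assms(3)])
    finally show ?thesis .
  qed
  then show "\<exists>C. \<forall>x t. (1 + \<bar>x\<bar>) ^ i * (1 + \<bar>t\<bar>) ^ j * norm (g (x, t)) \<le> C" by blast
qed

lemma rapid_shift: assumes "rapid f" shows "rapid (\<lambda>z. f (z + (a, 0)))"
  unfolding rapid_def
proof (intro allI)
  fix i j
  obtain A where A: "\<And>x t. (1 + \<bar>x\<bar>) ^ i * (1 + \<bar>t\<bar>) ^ j * norm (f (x, t)) \<le> A"
    using rapidD[OF assms(1)] by metis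
  have "(1 + \<bar>x\<bar>) ^ i * (1 + \<bar>t\<bar>) ^ j * norm (f ((x, t) + (a, 0))) \<le> (1 + \<bar>a\<bar>) ^ i * A" for x t
  proof -
    have "1 + \<bar>x\<bar> \<le> (1 + \<bar>a\<bar>) * (1 + \<bar>x + a\<bar>)"
    proof -
      have "1 + \<bar>x\<bar> \<le> 1 + \<bar>a\<bar> + \<bar>x + a\<bar>" by linarith
      also have "\<dots> \<le> 1 + \<bar>a\<bar> + \<bar>x + a\<bar> + \<bar>a\<bar> * \<bar>x + a\<bar>" by simp
      finally show ?thesis by (simp add: algebra_simps)
    qed
    then have "(1 + \<bar>x\<bar>) ^ i \<le> ((1 + \<bar>a\<bar>) * (1 + \<bar>x + a\<bar>)) ^ i" by (intro power_mono) auto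
    then have "(1 + \<bar>x\<bar>) ^ i * (1 + \<bar>t\<bar>) ^ j * norm (f (x + a, t)) \<le> ((1 + \<bar>a\<bar>) * (1 + \<bar>x + a\<bar>)) ^ i * (1 + \<bar>t\<bar>) ^ j * norm (f (x + a, t))"
      by (intro mult_right_mono) auto
    also have "\<dots> = (1 + \<bar>a\<bar>) ^ i * ((1 + \<bar>x + a\<bar>) ^ i * (1 + \<bar>t\<bar>) ^ j * norm (f (x + a, t)))"
      by (simp add: power_mult_distrib mult_ac)
    also have "\<dots> \<le> (1 + \<bar>a\<bar>) ^ i * A" by (intro mult_left_mono A) auto
    finally show ?thesis by simp
  qed
  then show "\<exists>C. \<forall>x t. (1 + \<bar>x\<bar>) ^ i * (1 + \<bar>t\<bar>) ^ j * norm (f ((x, t) + (a, 0))) \<le> C" by blast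
qed

lemma schwartz_iff: "u \<in> schwartz \<longleftrightarrow> (\<forall>v \<in> partials u. (\<forall>z. v differentiable (at z)) \<and> rapid v)"
  unfolding schwartz_def rapid_iff_schwartz_bounds by (rule mem_Collect_eq)

lemma schwartzD: assumes "u \<in> schwartz" shows "u differentiable (at z)" "rapid u"
proof -
  have "(\<forall>z. u differentiable (at z)) \<and> rapid u"
    using assms unfolding schwartz_iff by (rule bspec) (rule partials_self)
  then show "u differentiable (at z)" "rapid u"
    by (rule conjunct1[THEN spec], rule conjunct2)
qed

lemma partials_dx_subset: "v \<in> partials (dx u) \<Longrightarrow> v \<in> partials u"
  by (erule partials.induct, rule partials_dx, rule partials_self, erule partials_dx, erule partials_dt)

lemma partials_dt_subset: "v \<in> partials (dt u) \<Longrightarrow> v \<in> partials u"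
  by (erule partials.induct, rule partials_dt, rule partials_self, erule partials_dx, erule partials_dt)

lemma schwartz_dx: "u \<in> schwartz \<Longrightarrow> dx u \<in> schwartz"
  unfolding schwartz_iff by (intro ballI) (drule partials_dx_subset, erule (1) bspec)

lemma schwartz_dt: "u \<in> schwartz \<Longrightarrow> dt u \<in> schwartz"
  unfolding schwartz_iff by (intro ballI) (drule partials_dt_subset, erule (1) bspec)

text \<open>To place \<open>u\<close> in the Schwartz class it suffices to exhibit a class of differentiable rapidly decreasing functions
  that contains \<open>u\<close> and is closed under both partial derivatives.\<close>

lemma schwartz_coinduct:
  assumes "P u" and "\<And>v. P v \<Longrightarrow> (\<forall>z. v differentiable (at z)) \<and> rapid v \<and> P (dx v) \<and> P (dt v)"
  shows "u \<in> schwartz"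
proof -
  have "P v" if "v \<in> partials u" for v
    using that by (induction rule: partials.induct) (rule assms(1), (drule assms(2), elim conjE, assumption)+)
  then show ?thesis using assms(2) unfolding schwartz_iff by blast
qed

lemma has_dx:
  assumes "u differentiable (at (x, t))"
  shows "((\<lambda>y. u (y, t)) has_vector_derivative dx u (x, t)) (at x)"
proof -
  have "(u \<circ> (\<lambda>y. (y, t))) differentiable (at x)"
    by (rule differentiable_chain_at) (intro differentiable_Pair differentiable_ident differentiable_const, rule assms)
  then show ?thesis by (simp add: comp_def dx_def vector_derivative_works)
qed

lemma has_dt:
  assumes "u differentiable (at (x, t))"
  shows "((\<lambda>y. u (x, y)) has_vector_derivative dt u (x, t)) (at t)"
proof -
  have "(u \<circ> (\<lambda>y. (x, y))) differentiable (at t)"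
    by (rule differentiable_chain_at) (intro differentiable_Pair differentiable_ident differentiable_const, rule assms)
  then show ?thesis by (simp add: comp_def dt_def vector_derivative_works)
qed

lemma dx_eqI: "(\<And>x t. ((\<lambda>y. u (y, t)) has_vector_derivative v (x, t)) (at x)) \<Longrightarrow> dx u = v"
  by (auto simp: dx_def vector_derivative_at)

lemma dt_eqI: "(\<And>x t. ((\<lambda>y. u (x, y)) has_vector_derivative v (x, t)) (at t)) \<Longrightarrow> dt u = v"
  by (auto simp: dt_def vector_derivative_at)

text \<open>The closure of the Schwartz class under the operations needed later. It is stable under differentiation by the
  product rule, so it equals the Schwartz class; this avoids an induction over
  iterated derivatives of a product.\<close>

inductive schwartz_alg :: "(real \<times> real \<Rightarrow> complex) \<Rightarrow> bool" where
  base: "u \<in> schwartz \<Longrightarrow> schwartz_alg u"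
| add: "schwartz_alg u \<Longrightarrow> schwartz_alg v \<Longrightarrow> schwartz_alg (\<lambda>z. u z + v z)"
| mult: "schwartz_alg u \<Longrightarrow> schwartz_alg v \<Longrightarrow> schwartz_alg (\<lambda>z. u z * v z)"
| scale: "schwartz_alg u \<Longrightarrow> schwartz_alg (\<lambda>z. c * u z)"
| shift: "schwartz_alg u \<Longrightarrow> schwartz_alg (\<lambda>z. u (z + (a, 0)))"

lemma dx_add: "(\<And>z. u differentiable (at z)) \<Longrightarrow> (\<And>z. v differentiable (at z)) \<Longrightarrow> dx (\<lambda>z. u z + v z) = (\<lambda>z. dx u z + dx v z)"
  by (rule dx_eqI) (intro has_vector_derivative_add has_dx)

lemma dt_add: "(\<And>z. u differentiable (at z)) \<Longrightarrow> (\<And>z. v differentiable (at z)) \<Longrightarrow> dt (\<lambda>z. u z + v z) = (\<lambda>z. dt u z + dt v z)"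
  by (rule dt_eqI) (intro has_vector_derivative_add has_dt)

lemma dx_mult: "(\<And>z. u differentiable (at z)) \<Longrightarrow> (\<And>z. v differentiable (at z)) \<Longrightarrow> dx (\<lambda>z. u z * v z) = (\<lambda>z. u z * dx v z + dx u z * v z)"
  by (rule dx_eqI) (intro has_vector_derivative_mult has_dx)

lemma dt_mult: "(\<And>z. u differentiable (at z)) \<Longrightarrow> (\<And>z. v differentiable (at z)) \<Longrightarrow> dt (\<lambda>z. u z * v z) = (\<lambda>z. u z * dt v z + dt u z * v z)"
  by (rule dt_eqI) (intro has_vector_derivative_mult has_dt)

lemma dx_scale: "(\<And>z. u differentiable (at z)) \<Longrightarrow> dx (\<lambda>z. c * u z) = (\<lambda>z. c * dx u z)"
  by (rule dx_eqI) (intro has_vector_derivative_mult_right has_dx)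

lemma dt_scale: "(\<And>z. u differentiable (at z)) \<Longrightarrow> dt (\<lambda>z. c * u z) = (\<lambda>z. c * dt u z)"
  by (rule dt_eqI) (intro has_vector_derivative_mult_right has_dt)

lemma dx_shift:
  assumes "\<And>z. u differentiable (at z)"
  shows "dx (\<lambda>z. u (z + (a, 0))) = (\<lambda>z. dx u (z + (a, 0)))"
proof (rule dx_eqI)
  fix x t
  have "((\<lambda>y. u (y, t)) has_vector_derivative dx u (x + a, t)) (at (x + a))" by (rule has_dx[OF assms])
  moreover have "((\<lambda>y. y + a) has_vector_derivative 1) (at x)" by (auto intro!: derivative_eq_intros)
  ultimately have "((\<lambda>y. u (y, t)) \<circ> (\<lambda>y. y + a) has_vector_derivative 1 *\<^sub>R dx u (x + a, t)) (at x)"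
    by (intro vector_diff_chain_at) auto
  then show "((\<lambda>y. u ((y, t) + (a, 0))) has_vector_derivative dx u ((x, t) + (a, 0))) (at x)"
    by (simp add: comp_def)
qed

lemma dt_shift:
  assumes "\<And>z. u differentiable (at z)"
  shows "dt (\<lambda>z. u (z + (a, 0))) = (\<lambda>z. dt u (z + (a, 0)))"
  by (rule dt_eqI) (use has_dt[OF assms, of "_ + a"] in simp)

lemma schwartz_alg_step:
  "schwartz_alg v \<Longrightarrow> (\<forall>z. v differentiable (at z)) \<and> rapid v \<and> schwartz_alg (dx v) \<and> schwartz_alg (dt v)"
proof (induction rule: schwartz_alg.induct)
  case (base u)
  then show ?case by (auto simp: schwartzD intro: schwartz_alg.base schwartz_dx schwartz_dt)
next
  case (add u v)
  have u: "\<And>z. u differentiable (at z)" "rapid u" "schwartz_alg (dx u)" "schwartz_alg (dt u)"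
    and v: "\<And>z. v differentiable (at z)" "rapid v" "schwartz_alg (dx v)" "schwartz_alg (dt v)"
    using add.IH by blast+
  show ?case unfolding dx_add[OF u(1) v(1)] dt_add[OF u(1) v(1)]
    by (intro conjI allI differentiable_add rapid_add schwartz_alg.add u v)
next
  case (mult u v)
  have u: "\<And>z. u differentiable (at z)" "rapid u" "schwartz_alg (dx u)" "schwartz_alg (dt u)"
    and v: "\<And>z. v differentiable (at z)" "rapid v" "schwartz_alg (dx v)" "schwartz_alg (dt v)"
    using mult.IH by blast+
  show ?case unfolding dx_mult[OF u(1) v(1)] dt_mult[OF u(1) v(1)]
    by (intro conjI allI differentiable_mult rapid_mult schwartz_alg.add schwartz_alg.mult mult.hyps u v)
next
  case (scale u c)
  have u: "\<And>z. u differentiable (at z)" "rapid u" "schwartz_alg (dx u)" "schwartz_alg (dt u)"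
    using scale.IH by blast+
  have "rapid (\<lambda>z. c * u z)"
    by (rule rapid_dominated[OF u(2), of _ "norm c"]) (simp_all add: norm_mult)
  then show ?case unfolding dx_scale[OF u(1)] dt_scale[OF u(1)]
    by (intro conjI allI differentiable_mult differentiable_const schwartz_alg.scale u)
next
  case (shift u a)
  have u: "\<And>z. u differentiable (at z)" "rapid u" "schwartz_alg (dx u)" "schwartz_alg (dt u)"
    using shift.IH by blast+
  have "(\<lambda>z. u (z + (a, 0))) differentiable (at z)" for z
  proof -
    have "(\<lambda>z. z + (a, 0)) differentiable (at z)" by (intro differentiable_add differentiable_ident differentiable_const)
    then have "(u \<circ> (\<lambda>z. z + (a, 0))) differentiable (at z)"
      by (rule differentiable_chain_at) (rule u)
    then show ?thesis by (simp add: comp_def)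
  qed
  then show ?case unfolding dx_shift[OF u(1)] dt_shift[OF u(1)]
    by (intro conjI allI rapid_shift schwartz_alg.shift u)
qed

lemma schwartz_alg_iff: "schwartz_alg u \<longleftrightarrow> u \<in> schwartz"
  using schwartz_coinduct[of schwartz_alg u] schwartz_alg_step base by blast

lemmas schwartz_add = schwartz_alg.add[unfolded schwartz_alg_iff]
lemmas schwartz_mult = schwartz_alg.mult[unfolded schwartz_alg_iff]
lemmas schwartz_scale = schwartz_alg.scale[unfolded schwartz_alg_iff]
lemmas schwartz_shift = schwartz_alg.shift[unfolded schwartz_alg_iff]

lemma schwartz_diff:
  assumes "u \<in> schwartz" "v \<in> schwartz" shows "(\<lambda>z. u z - v z) \<in> schwartz"
  using schwartz_add[OF assms(1) schwartz_scale[OF assms(2), of "-1"]] by simp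

lemma schwartz_continuous: "u \<in> schwartz \<Longrightarrow> isCont u z"
  by (simp add: schwartzD differentiable_imp_continuous_within)

lemma schwartz_measurable: "u \<in> schwartz \<Longrightarrow> u \<in> borel_measurable borel"
  by (intro borel_measurable_continuous_onI continuous_at_imp_continuous_on ballI schwartz_continuous)

lemma inverse_sq_le_jbracket: "inverse ((1 + \<bar>x\<bar>)\<^sup>2) \<le> jbracket x powr (- 2)"
proof -
  have "inverse ((1 + \<bar>x\<bar>)\<^sup>2) \<le> inverse ((jbracket x)\<^sup>2)"
    by (intro le_imp_inverse_le power_mono jbracket_le_abs) auto
  then show ?thesis by (simp add: powr_minus)
qed

lemma rapid_integrable:
  assumes f: "rapid f" and [measurable]: "f \<in> borel_measurable borel"
  shows "integrable lborel f"
proof (rule integrableI_bounded)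
  obtain C where C: "0 \<le> C" "\<And>x t. (1 + \<bar>x\<bar>)\<^sup>2 * (1 + \<bar>t\<bar>)\<^sup>2 * norm (f (x, t)) \<le> C"
    using rapid_obtain[OF f] by blast
  have bd: "norm (f (x, t)) \<le> C * (jbracket x powr (- 2) * jbracket t powr (- 2))" for x t
  proof -
    have p: "0 < (1 + \<bar>x\<bar>)\<^sup>2 * (1 + \<bar>t\<bar>)\<^sup>2" by (intro mult_pos_pos zero_less_power) auto
    have "norm (f (x, t)) \<le> C / ((1 + \<bar>x\<bar>)\<^sup>2 * (1 + \<bar>t\<bar>)\<^sup>2)"
      using C(2)[of x t] p by (simp add: pos_le_divide_eq mult_ac)
    also have "\<dots> = C * (inverse ((1 + \<bar>x\<bar>)\<^sup>2) * inverse ((1 + \<bar>t\<bar>)\<^sup>2))"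
      by (simp add: divide_inverse)
    also have "\<dots> \<le> C * (jbracket x powr (- 2) * jbracket t powr (- 2))"
      by (intro mult_left_mono mult_mono inverse_sq_le_jbracket C) auto
    finally show ?thesis .
  qed
  have "(\<integral>\<^sup>+z. ennreal (norm (f z)) \<partial>lborel) = (\<integral>\<^sup>+x. \<integral>\<^sup>+t. ennreal (norm (f (x, t))) \<partial>lborel \<partial>lborel)"
    by (rule nn_integral_R2) measurable
  also have "\<dots> \<le> (\<integral>\<^sup>+x. \<integral>\<^sup>+t. ennreal C * (ennreal (jbracket x powr (- 2)) * ennreal (jbracket t powr (- 2))) \<partial>lborel \<partial>lborel)"
    using bd C by (intro nn_integral_mono) (simp add: ennreal_mult[symmetric] ennreal_leI del: ennreal_mult'')
  also have "\<dots> = ennreal C * (jbracket_integral 2 * jbracket_integral 2)"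
    unfolding jbracket_integral_def by (simp add: nn_integral_cmult nn_integral_multc)
  also have "\<dots> < \<infinity>" using jbracket_integral_finite[of 2] by (simp add: ennreal_mult_less_top)
  finally show "(\<integral>\<^sup>+z. ennreal (norm (f z)) \<partial>lborel) < \<infinity>" .
qed simp

lemma schwartz_integrable: "u \<in> schwartz \<Longrightarrow> integrable lborel u"
  by (intro rapid_integrable schwartzD schwartz_measurable)

lemma integral_derivative_zero:
  fixes W w :: "real \<Rightarrow> complex"
  assumes "\<And>x. (W has_vector_derivative w x) (at x)" "\<And>x. isCont w x" and w: "integrable lborel w"
    and "(W \<longlongrightarrow> 0) at_top" "(W \<longlongrightarrow> 0) at_bot"
  shows "(\<integral>x. w x \<partial>lborel) = 0"
proof -
  have "(LBINT x=-\<infinity>..\<infinity>. w x) = 0 - 0"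
    by (rule interval_integral_FTC_integrable[where F=W])
      (use assms in \<open>auto simp: ereal_tendsto_simps set_integrable_def\<close>)
  then show ?thesis by (simp add: interval_lebesgue_integral_def set_lebesgue_integral_def)
qed

lemma integrable_slice_bound:
  fixes f :: "real \<Rightarrow> complex"
  assumes [measurable]: "f \<in> borel_measurable borel" and "\<And>x. norm (f x) \<le> C * inverse ((1 + \<bar>x\<bar>)\<^sup>2)"
  shows "integrable lborel f"
proof (rule integrableI_bounded)
  have C: "0 \<le> C" using assms(2)[of 0] norm_ge_zero[of "f 0"] by (simp, linarith)
  have "(\<integral>\<^sup>+x. ennreal (norm (f x)) \<partial>lborel) \<le> (\<integral>\<^sup>+x. ennreal C * ennreal (jbracket x powr (- 2)) \<partial>lborel)"
  proof (intro nn_integral_mono)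
    fix x
    have "norm (f x) \<le> C * jbracket x powr (- 2)"
      using assms(2)[of x] mult_left_mono[OF inverse_sq_le_jbracket C, of x] by linarith
    then show "ennreal (norm (f x)) \<le> ennreal C * ennreal (jbracket x powr (- 2))"
      using C by (simp add: ennreal_mult[symmetric] ennreal_leI del: ennreal_mult'')
  qed
  also have "\<dots> = ennreal C * jbracket_integral 2" unfolding jbracket_integral_def by (rule nn_integral_cmult) measurable
  also have "\<dots> < \<infinity>" using jbracket_integral_finite[of 2] by (simp add: ennreal_mult_less_top)
  finally show "(\<integral>\<^sup>+x. ennreal (norm (f x)) \<partial>lborel) < \<infinity>" .
qed simp

lemma integral_x_derivative_zero:
  assumes U: "rapid U" and w: "rapid w" and wc: "\<And>z. isCont w z"
    and d: "\<And>x t. ((\<lambda>y. U (y, t)) has_vector_derivative w (x, t)) (at x)"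
  shows "(\<integral>z. w z \<partial>lborel) = 0"
proof -
  have wm [measurable]: "w \<in> borel_measurable borel"
    by (intro borel_measurable_continuous_onI continuous_at_imp_continuous_on ballI wc)
  have wi: "integrable (lborel \<Otimes>\<^sub>M lborel) w" using rapid_integrable[OF w wm] by (simp add: lborel_prod)
  have "(\<integral>x. w (x, t) \<partial>lborel) = 0" for t
  proof (rule integral_derivative_zero[where W="\<lambda>x. U (x, t)"])
    show "isCont (\<lambda>x. w (x, t)) x" for x
      by (rule isCont_o2[where g=w]) (auto intro!: continuous_intros wc)
    obtain C where C: "0 \<le> C" "\<And>x t. (1 + \<bar>x\<bar>)\<^sup>2 * (1 + \<bar>t\<bar>) ^ 0 * norm (w (x, t)) \<le> C"
      using rapid_obtain[OF w] by blast
    show "integrable lborel (\<lambda>x. w (x, t))"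
    proof (rule integrable_slice_bound[of _ C])
      fix x :: real
      have "0 < (1 + \<bar>x\<bar>)\<^sup>2" by (intro zero_less_power) auto
      then show "norm (w (x, t)) \<le> C * inverse ((1 + \<bar>x\<bar>)\<^sup>2)"
        using C(2)[of x t] by (simp add: divide_inverse[symmetric] pos_le_divide_eq mult_ac)
    qed measurable
    obtain B where B: "0 \<le> B" "\<And>x t. (1 + \<bar>x\<bar>) ^ 1 * (1 + \<bar>t\<bar>) ^ 0 * norm (U (x, t)) \<le> B"
      using rapid_obtain[OF U] by blast
    have le: "norm (U (x, t)) \<le> B * inverse (1 + \<bar>x\<bar>)" for x
      using B(2)[of x t] by (simp add: divide_inverse[symmetric] pos_le_divide_eq mult_ac)
    have *: "((\<lambda>x. B * inverse (1 + \<bar>x\<bar>)) \<longlongrightarrow> 0) at_top" "((\<lambda>x. B * inverse (1 + \<bar>x\<bar>)) \<longlongrightarrow> 0) at_bot"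
      by real_asymp+
    show "((\<lambda>x. U (x, t)) \<longlongrightarrow> 0) at_top" "((\<lambda>x. U (x, t)) \<longlongrightarrow> 0) at_bot"
      by (rule Lim_null_comparison[OF always_eventually *(1)] Lim_null_comparison[OF always_eventually *(2)], simp add: le)+
  qed (rule d)
  then have "(\<integral>t. \<integral>x. w (x, t) \<partial>lborel \<partial>lborel) = 0" by simp
  moreover have "(\<integral>t. \<integral>x. w (x, t) \<partial>lborel \<partial>lborel) = integral\<^sup>L (lborel \<Otimes>\<^sub>M lborel) w"
    using lborel_pair.integral_snd[of "\<lambda>x t. w (x, t)"] wi by simp
  ultimately show ?thesis by (simp add: lborel_prod)
qed

lemma integral_t_derivative_zero:
  assumes U: "rapid U" and w: "rapid w" and wc: "\<And>z. isCont w z"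
    and d: "\<And>x t. ((\<lambda>y. U (x, y)) has_vector_derivative w (x, t)) (at t)"
  shows "(\<integral>z. w z \<partial>lborel) = 0"
proof -
  have wm [measurable]: "w \<in> borel_measurable borel"
    by (intro borel_measurable_continuous_onI continuous_at_imp_continuous_on ballI wc)
  have swap: "rapid (\<lambda>z. f (snd z, fst z))" if "rapid f" for f
    using that unfolding rapid_def by (simp add: mult.commute) (metis mult.commute)
  have "(\<integral>z. w (snd z, fst z) \<partial>lborel) = 0"
  proof (rule integral_x_derivative_zero[where U="\<lambda>z. U (snd z, fst z)"])
    show "isCont (\<lambda>z. w (snd z, fst z)) z" for z :: "real \<times> real"
      by (rule isCont_o2[where g=w]) (auto intro!: continuous_intros wc)
  qed (use d in \<open>auto intro!: swap U w\<close>)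
  moreover have "(\<integral>z. w (snd z, fst z) \<partial>lborel) = (\<integral>z. w z \<partial>lborel)"
    using lborel_pair.integral_product_swap[of w] by (simp add: lborel_prod case_prod_unfold)
  ultimately show ?thesis by simp
qed

section \<open>Fourier transforms of Schwartz functions\<close>

lemma ft_linear:
  assumes "integrable lborel u" "integrable lborel v"
  shows "ft (\<lambda>z. u z + v z) \<zeta> = ft u \<zeta> + ft v \<zeta>" "ft (\<lambda>z. u z - v z) \<zeta> = ft u \<zeta> - ft v \<zeta>"
proof -
  note i = assms[THEN integrable_ft_integrand, of \<zeta>]
  show "ft (\<lambda>z. u z + v z) \<zeta> = ft u \<zeta> + ft v \<zeta>"
    unfolding ft_def distrib_left by (rule Bochner_Integration.integral_add[OF i])
  show "ft (\<lambda>z. u z - v z) \<zeta> = ft u \<zeta> - ft v \<zeta>"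
    unfolding ft_def right_diff_distrib by (rule Bochner_Integration.integral_diff[OF i])
qed

lemma ft_scale: "ft (\<lambda>z. c * u z) \<zeta> = c * ft u \<zeta>"
proof -
  have "ft (\<lambda>z. c * u z) \<zeta> = (\<integral>z. c * (cis (- (z \<bullet> \<zeta>)) * u z) \<partial>lborel)"
    unfolding ft_def by (simp only: mult_ac)
  then show ?thesis unfolding ft_def by simp
qed

lemma rapid_cis_mult: "rapid u \<Longrightarrow> rapid (\<lambda>z. cis (h z) * u z)"
  by (rule rapid_dominated[of u _ 1]) (simp_all add: norm_mult)

lemma cis_has_vector_derivative:
  assumes "(h has_real_derivative d) (at x)"
  shows "((\<lambda>x. cis (h x)) has_vector_derivative (\<i> * of_real d * cis (h x))) (at x)"
proof -
  have "((\<lambda>x. cis (h x)) has_derivative (\<lambda>t. (d * t) *\<^sub>R (\<i> * cis (h x)))) (at x)"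
    using assms unfolding has_field_derivative_def by (rule has_derivative_cis)
  then show ?thesis
    unfolding has_vector_derivative_def by (simp add: scaleR_conv_of_real mult_ac)
qed

text \<open>The \<open>x\<close>-derivative of \<open>u(x, t)\<close> times the character is integrable with integral zero.\<close>

lemma ft_dx:
  assumes u: "u \<in> schwartz"
  shows "ft (dx u) \<zeta> = \<i> * of_real (fst \<zeta>) * ft u \<zeta>"
proof -
  define e where "e z = cis (- (z \<bullet> \<zeta>))" for z :: "real \<times> real"
  define c where "c = \<i> * complex_of_real (fst \<zeta>)"
  have i: "integrable lborel (\<lambda>z. e z * dx u z)" "integrable lborel (\<lambda>z. e z * u z)"
    unfolding e_def by (intro integrable_ft_integrand schwartz_integrable schwartz_dx u)+
  have ec: "isCont e z" for z unfolding e_def isCont_def by (intro tendsto_intros)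
  have "(\<integral>z. e z * dx u z - c * (e z * u z) \<partial>lborel) = 0"
  proof (rule integral_x_derivative_zero[where U="\<lambda>z. e z * u z"])
    show "rapid (\<lambda>z. e z * u z)" unfolding e_def by (intro rapid_cis_mult schwartzD u)
    have "rapid (\<lambda>z. e z * (dx u z - c * u z))"
      unfolding e_def by (intro rapid_cis_mult schwartzD(2) schwartz_diff schwartz_dx schwartz_scale u)
    then show "rapid (\<lambda>z. e z * dx u z - c * (e z * u z))"
      by (simp add: right_diff_distrib mult.left_commute)
    show "isCont (\<lambda>z. e z * dx u z - c * (e z * u z)) z" for z
      by (intro continuous_intros ec schwartz_continuous schwartz_dx u)
    fix x t
    have "((\<lambda>y. e (y, t) * u (y, t)) has_vector_derivative (e (x, t) * dx u (x, t) + (\<i> * of_real (- fst \<zeta>) * e (x, t)) * u (x, t))) (at x)"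
    proof (rule has_vector_derivative_mult)
      show "((\<lambda>y. e (y, t)) has_vector_derivative (\<i> * of_real (- fst \<zeta>) * e (x, t))) (at x)"
        unfolding e_def by (rule cis_has_vector_derivative) (auto simp: inner_prod_def intro!: derivative_eq_intros)
    qed (rule has_dx, rule schwartzD, rule u)
    then show "((\<lambda>y. e (y, t) * u (y, t)) has_vector_derivative (e (x, t) * dx u (x, t) - c * (e (x, t) * u (x, t)))) (at x)"
      by (simp add: c_def mult_ac)
  qed
  then have "(\<integral>z. e z * dx u z \<partial>lborel) - (\<integral>z. c * (e z * u z) \<partial>lborel) = 0"
    using i by (subst (asm) Bochner_Integration.integral_diff) auto
  then show ?thesis unfolding ft_def e_def[symmetric] c_def[symmetric] by simp
qed

lemma ft_dt:
  assumes u: "u \<in> schwartz"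
  shows "ft (dt u) \<zeta> = \<i> * of_real (snd \<zeta>) * ft u \<zeta>"
proof -
  define e where "e z = cis (- (z \<bullet> \<zeta>))" for z :: "real \<times> real"
  define c where "c = \<i> * complex_of_real (snd \<zeta>)"
  have i: "integrable lborel (\<lambda>z. e z * dt u z)" "integrable lborel (\<lambda>z. e z * u z)"
    unfolding e_def by (intro integrable_ft_integrand schwartz_integrable schwartz_dt u)+
  have ec: "isCont e z" for z unfolding e_def isCont_def by (intro tendsto_intros)
  have "(\<integral>z. e z * dt u z - c * (e z * u z) \<partial>lborel) = 0"
  proof (rule integral_t_derivative_zero[where U="\<lambda>z. e z * u z"])
    show "rapid (\<lambda>z. e z * u z)" unfolding e_def by (intro rapid_cis_mult schwartzD u)
    have "rapid (\<lambda>z. e z * (dt u z - c * u z))"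
      unfolding e_def by (intro rapid_cis_mult schwartzD(2) schwartz_diff schwartz_dt schwartz_scale u)
    then show "rapid (\<lambda>z. e z * dt u z - c * (e z * u z))"
      by (simp add: right_diff_distrib mult.left_commute)
    show "isCont (\<lambda>z. e z * dt u z - c * (e z * u z)) z" for z
      by (intro continuous_intros ec schwartz_continuous schwartz_dt u)
    fix x t
    have "((\<lambda>y. e (x, y) * u (x, y)) has_vector_derivative (e (x, t) * dt u (x, t) + (\<i> * of_real (- snd \<zeta>) * e (x, t)) * u (x, t))) (at t)"
    proof (rule has_vector_derivative_mult)
      show "((\<lambda>y. e (x, y)) has_vector_derivative (\<i> * of_real (- snd \<zeta>) * e (x, t))) (at t)"
        unfolding e_def by (rule cis_has_vector_derivative) (auto simp: inner_prod_def intro!: derivative_eq_intros)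
    qed (rule has_dt, rule schwartzD, rule u)
    then show "((\<lambda>y. e (x, y) * u (x, y)) has_vector_derivative (e (x, t) * dt u (x, t) - c * (e (x, t) * u (x, t)))) (at t)"
      by (simp add: c_def mult_ac)
  qed
  then have "(\<integral>z. e z * dt u z \<partial>lborel) - (\<integral>z. c * (e z * u z) \<partial>lborel) = 0"
    using i by (subst (asm) Bochner_Integration.integral_diff) auto
  then show ?thesis unfolding ft_def e_def[symmetric] c_def[symmetric] by simp
qed

text \<open>Powers of the dual variables are transforms of derivatives, hence the transform of a Schwartz function decreases
  rapidly.\<close>

lemma schwartz_ft_moments:
  assumes u: "u \<in> schwartz"
  shows "\<exists>v\<in>schwartz. \<forall>\<zeta>. norm (ft v \<zeta>) = \<bar>fst \<zeta>\<bar> ^ i * \<bar>snd \<zeta>\<bar> ^ j * norm (ft u \<zeta>)"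
proof (induction i)
  case 0
  show ?case
  proof (induction j)
    case 0
    show ?case using u by auto
  next
    case (Suc j)
    then obtain v where "v \<in> schwartz" "\<forall>\<zeta>. norm (ft v \<zeta>) = \<bar>fst \<zeta>\<bar> ^ 0 * \<bar>snd \<zeta>\<bar> ^ j * norm (ft u \<zeta>)" by blast
    then show ?case by (intro bexI[of _ "dt v"] schwartz_dt) (simp_all add: ft_dt norm_mult)
  qed
next
  case (Suc i)
  then obtain v where "v \<in> schwartz" "\<forall>\<zeta>. norm (ft v \<zeta>) = \<bar>fst \<zeta>\<bar> ^ i * \<bar>snd \<zeta>\<bar> ^ j * norm (ft u \<zeta>)" by blast
  then show ?case by (intro bexI[of _ "dx v"] schwartz_dx) (simp_all add: ft_dx norm_mult)
qed

lemma rapid_ft: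
  assumes u: "u \<in> schwartz"
  shows "rapid (ft u)"
proof (rule rapid_if_monomials)
  fix i j
  obtain v where v: "v \<in> schwartz" "\<And>\<zeta>. norm (ft v \<zeta>) = \<bar>fst \<zeta>\<bar> ^ i * \<bar>snd \<zeta>\<bar> ^ j * norm (ft u \<zeta>)"
    using schwartz_ft_moments[OF u] by blast
  have "\<bar>x\<bar> ^ i * \<bar>t\<bar> ^ j * norm (ft u (x, t)) \<le> (\<integral>z. norm (v z) \<partial>lborel)" for x t
    using norm_ft_le[OF schwartz_integrable[OF v(1)], of "(x, t)"] v(2)[of "(x, t)"] by simp
  then show "\<exists>C. \<forall>x t. \<bar>x\<bar> ^ i * \<bar>t\<bar> ^ j * norm (ft u (x, t)) \<le> C" by blast
qed

lemma schwartz_ft_measurable: "u \<in> schwartz \<Longrightarrow> ft u \<in> borel_measurable borel"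
  by (intro ft_measurable schwartz_integrable)

lemma schwartz_ft_integrable: "u \<in> schwartz \<Longrightarrow> integrable lborel (ft u)"
  by (intro rapid_integrable rapid_ft schwartz_ft_measurable)

lemma schwartz_bounded:
  assumes "u \<in> schwartz" obtains B where "\<And>z. norm (u z) \<le> B"
  using rapid_bounded[OF schwartzD(2)[OF assms]] by blast

lemma schwartz_ft_mult:
  assumes u: "u \<in> schwartz" and w: "w \<in> schwartz"
  shows "of_real ((2 * pi)\<^sup>2) * ft (\<lambda>z. u z * w z) \<zeta> = (\<integral>\<eta>. ft u \<eta> * ft w (\<zeta> - \<eta>) \<partial>lborel)"
proof -
  obtain B where B: "\<And>z. norm (u z) \<le> B" using schwartz_bounded[OF u] by blast
  show ?thesis
    by (rule ft_mult[OF _ _ B]) (intro schwartz_integrable schwartz_continuous schwartz_ft_integrable u w)+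
qed

text \<open>The convolution theorem carries the constant \<open>(2\<pi>)\<^sup>-\<^sup>2 \<le> 1\<close>, which is dropped.\<close>

lemma norm_schwartz_ft_mult_le:
  assumes u: "u \<in> schwartz" and w: "w \<in> schwartz"
  shows "ennreal (norm (ft (\<lambda>z. u z * w z) \<zeta>)) \<le> (\<integral>\<^sup>+\<eta>. ennreal (norm (ft u \<eta>)) * ennreal (norm (ft w (\<zeta> - \<eta>))) \<partial>lborel)"
proof -
  let ?F = "ft (\<lambda>z. u z * w z) \<zeta>"
  have "1 \<le> (2 * pi)\<^sup>2" using pi_ge_two by (intro one_le_power) linarith
  then have "norm ?F \<le> norm (of_real ((2 * pi)\<^sup>2) * ?F)"
    by (simp only: norm_mult norm_of_real) (rule mult_le_cancel_right1[THEN iffD2], simp add: mult_le_cancel_right1)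
  also have "\<dots> = norm (\<integral>\<eta>. ft u \<eta> * ft w (\<zeta> - \<eta>) \<partial>lborel)"
    by (simp only: schwartz_ft_mult[OF u w])
  finally have "ennreal (norm ?F) \<le> ennreal (norm (\<integral>\<eta>. ft u \<eta> * ft w (\<zeta> - \<eta>) \<partial>lborel))" by (rule ennreal_leI)
  also have "\<dots> \<le> (\<integral>\<^sup>+\<eta>. ennreal (norm (ft u \<eta> * ft w (\<zeta> - \<eta>))) \<partial>lborel)"
    by (cases "integrable lborel (\<lambda>\<eta>. ft u \<eta> * ft w (\<zeta> - \<eta>))")
      (auto intro: integral_norm_bound_ennreal simp: not_integrable_integral_eq)
  also have "\<dots> = (\<integral>\<^sup>+\<eta>. ennreal (norm (ft u \<eta>)) * ennreal (norm (ft w (\<zeta> - \<eta>))) \<partial>lborel)"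
    by (simp add: norm_mult ennreal_mult)
  finally show ?thesis .
qed

text \<open>The weights grow at most polynomially, because \<open>\<phi>\<close> does.\<close>

lemma rapid_X_weight:
  assumes k: "\<bar>k\<bar> \<le> 1" and f: "rapid f"
  shows "rapid (\<lambda>\<zeta>. of_real (X_weight k s b \<zeta> * norm (f \<zeta>)))"
proof -
  define n m where "n = nat \<lceil>\<bar>s\<bar>\<rceil>" and "m = nat \<lceil>\<bar>b\<bar>\<rceil>"
  have nm: "\<bar>s\<bar> \<le> real n" "\<bar>b\<bar> \<le> real m" by (auto simp: n_def m_def real_nat_ceiling_ge)
  have pw: "jbracket y powr r \<le> jbracket y ^ l" if "\<bar>r\<bar> \<le> real l" for y r l
  proof -
    have "jbracket y powr r \<le> jbracket y powr (real l)"
      using that jbracket_ge_1 by (intro powr_mono) auto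
    then show ?thesis by (simp add: powr_realpow)
  qed
  have W: "X_weight k s b (x, t) \<le> 1 * ((1 + \<bar>x\<bar>) ^ (n + 3 * m) * (1 + \<bar>t\<bar>) ^ m)" for x t
  proof -
    have "jbracket (\<bar>t\<bar> - phi k x) \<le> (1 + \<bar>x\<bar>) ^ 3 * (1 + \<bar>t\<bar>)"
    proof -
      have "phi k x \<le> \<bar>x\<bar> * (1 + x\<^sup>2)"
        unfolding phi_eq_qphi by (intro mult_left_mono qphi_le k) auto
      also have "\<dots> \<le> (1 + \<bar>x\<bar>) ^ 3 - 1"
        by (simp add: power3_eq_cube power2_eq_square algebra_simps)
      finally have p: "phi k x \<le> (1 + \<bar>x\<bar>) ^ 3 - 1" .
      have o: "1 \<le> (1 + \<bar>x\<bar>) ^ 3" by (rule one_le_power) simp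
      have "jbracket (\<bar>t\<bar> - phi k x) \<le> 1 + \<bar>\<bar>t\<bar> - phi k x\<bar>" by (rule jbracket_le_abs)
      also have "\<dots> \<le> \<bar>t\<bar> + (1 + \<bar>x\<bar>) ^ 3" using p phi_nonneg[OF k, of x] by linarith
      also have "\<dots> \<le> (1 + \<bar>x\<bar>) ^ 3 * \<bar>t\<bar> + (1 + \<bar>x\<bar>) ^ 3"
        using mult_right_mono[OF o, of "\<bar>t\<bar>"] by simp
      finally show ?thesis by (simp add: algebra_simps)
    qed
    then have "jbracket (\<bar>t\<bar> - phi k x) ^ m \<le> ((1 + \<bar>x\<bar>) ^ 3 * (1 + \<bar>t\<bar>)) ^ m" by (intro power_mono) auto
    moreover have "jbracket x ^ n \<le> (1 + \<bar>x\<bar>) ^ n" by (intro power_mono jbracket_le_abs) auto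
    ultimately have "jbracket x powr s * jbracket (\<bar>t\<bar> - phi k x) powr b \<le> (1 + \<bar>x\<bar>) ^ n * ((1 + \<bar>x\<bar>) ^ 3 * (1 + \<bar>t\<bar>)) ^ m"
      using pw[OF nm(1), of x] pw[OF nm(2), of "\<bar>t\<bar> - phi k x"] by (intro mult_mono) auto
    moreover have "(1 + \<bar>x\<bar>) ^ (n + 3 * m) = (1 + \<bar>x\<bar>) ^ n * ((1 + \<bar>x\<bar>) ^ 3) ^ m"
      by (simp only: power_add power_mult)
    ultimately show ?thesis by (simp add: X_weight_def power_mult_distrib mult_ac)
  qed
  show ?thesis
  proof (rule rapid_polynomial_weight[OF f, of _ 1 "n + 3 * m" m])
    show "norm (complex_of_real (X_weight k s b (x, t) * norm (f (x, t)))) \<le> 1 * ((1 + \<bar>x\<bar>) ^ (n + 3 * m) * (1 + \<bar>t\<bar>) ^ m * norm (f (x, t)))" for x t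
      using mult_right_mono[OF W, of "norm (f (x, t))" x t] by (simp add: norm_mult)
  qed simp
qed

lemma rapid_X_integrable:
  assumes k: "\<bar>k\<bar> \<le> 1" and f: "rapid f" and [measurable]: "f \<in> borel_measurable borel"
  shows "integrable lborel (\<lambda>\<zeta>. (X_weight k s b \<zeta> * norm (f \<zeta>))\<^sup>2)"
proof -
  let ?g = "\<lambda>\<zeta>. complex_of_real (X_weight k s b \<zeta> * norm (f \<zeta>))"
  have "rapid (\<lambda>z. ?g z * ?g z)" by (intro rapid_mult rapid_X_weight k f)
  then have "integrable lborel (\<lambda>z. ?g z * ?g z)" by (rule rapid_integrable) measurable
  then have "integrable lborel (\<lambda>z. Re (?g z * ?g z))" by (rule integrable_Re)
  then show ?thesis by (simp add: power2_eq_square)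
qed

lemma schwartz_X_fun: "\<bar>k\<bar> \<le> 1 \<Longrightarrow> u \<in> schwartz \<Longrightarrow> u \<in> X_fun k s b"
  unfolding X_fun_def fourier_eq_ft
  by (auto intro!: schwartz_integrable rapid_X_integrable rapid_ft schwartz_ft_measurable)

section \<open>Inverse transform of the singular symbol\<close>

text \<open>\<open>\<xi>\<^sup>2 / \<phi>(\<xi>) = (1 + \<xi>\<^sup>2) \<bar>\<xi>\<bar> a(\<xi>)\<close> with this smooth function \<open>a\<close>. The factor \<open>1 + \<xi>\<^sup>2\<close> is the symbol of
  \<open>g \<mapsto> g - g\<^sub>x\<^sub>x\<close>; taking it out leaves \<open>\<bar>\<xi>\<bar> a(\<xi>)\<close>, which is integrable and whose only singularity is a corner at the
  origin.\<close>

definition symbol_factor :: "real \<Rightarrow> real \<Rightarrow> real" where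
  "symbol_factor k x = inverse ((1 + x\<^sup>2) * qphi k x)"

text \<open>The derivatives of \<open>a\<close> are \<open>a\<close> times polynomials in the bounded functions \<open>- a' / a\<close> and \<open>(- a' / a)'\<close>, so the
  decay of \<open>a\<close> passes to them.\<close>

definition symbol_factor_log_deriv :: "real \<Rightarrow> real \<Rightarrow> real" where
  "symbol_factor_log_deriv k x = 2 * x / (1 + x\<^sup>2) + (2 * x ^ 3 + k * x) / (x ^ 4 + k * x\<^sup>2 + 1)"

definition symbol_factor_log_deriv' :: "real \<Rightarrow> real \<Rightarrow> real" where
  "symbol_factor_log_deriv' k x = (2 - 2 * x\<^sup>2) / (1 + x\<^sup>2)\<^sup>2 + ((6 * x\<^sup>2 + k) / (x ^ 4 + k * x\<^sup>2 + 1) - 2 * ((2 * x ^ 3 + k * x) / (x ^ 4 + k * x\<^sup>2 + 1))\<^sup>2)"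

lemma quartic_pos:
  fixes k x :: real
  assumes "\<bar>k\<bar> \<le> 1" shows "0 < x ^ 4 + k * x\<^sup>2 + 1"
proof -
  have "0 < ((1 + x\<^sup>2) / 2)\<^sup>2" by (intro zero_less_power) (simp add: add_pos_nonneg)
  then show ?thesis using qphi_sq(2)[OF assms, of x] by linarith
qed

lemma one_plus_sq_pos: "0 < 1 + x\<^sup>2" for x :: real by (simp add: add_pos_nonneg)

lemma one_plus_sq_nz [simp]: "1 + x\<^sup>2 \<noteq> 0" for x :: real
  using one_plus_sq_pos[of x] by linarith

lemma symbol_factor_nonneg: "\<bar>k\<bar> \<le> 1 \<Longrightarrow> 0 \<le> symbol_factor k x"
  using qphi_pos[of k x] one_plus_sq_pos[of x] by (simp add: symbol_factor_def)

lemma symbol_factor_deriv: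
  assumes k: "\<bar>k\<bar> \<le> 1"
  shows "(symbol_factor k has_real_derivative - symbol_factor k x * symbol_factor_log_deriv k x) (at x)"
proof -
  define Q where "Q = x ^ 4 + k * x\<^sup>2 + 1"
  have Q: "0 < Q" unfolding Q_def by (rule quartic_pos[OF k])
  have q: "0 < qphi k x" by (rule qphi_pos[OF k])
  have qq: "qphi k x * qphi k x = Q" using qphi_sq(1)[OF k, of x] by (simp add: Q_def power2_eq_square)
  have "((\<lambda>x. x ^ 4 + k * x\<^sup>2 + 1) has_real_derivative (4 * x ^ 3 + 2 * k * x)) (at x)"
    by (auto intro!: derivative_eq_intros)
  then have *: "((\<lambda>x. sqrt (x ^ 4 + k * x\<^sup>2 + 1)) has_real_derivative (inverse (sqrt Q) / 2 * (4 * x ^ 3 + 2 * k * x))) (at x)"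
    using Q unfolding Q_def by (intro DERIV_chain2[OF DERIV_real_sqrt]) auto
  have qd: "(qphi k has_real_derivative ((2 * x ^ 3 + k * x) / qphi k x)) (at x)"
  proof -
    have e: "4 * x ^ 3 + 2 * k * x = 2 * (2 * x ^ 3 + k * x)" by (simp add: algebra_simps)
    have gen: "inverse a / 2 * (2 * b) = b / a" for a b :: real
    proof -
      have "inverse a / 2 * (2 * b) = inverse a * b" by simp
      then show ?thesis by (simp only: divide_inverse mult.commute)
    qed
    have f: "qphi k = (\<lambda>x. sqrt (x ^ 4 + k * x\<^sup>2 + 1))" by (simp add: qphi_def fun_eq_iff)
    have "sqrt Q = qphi k x" by (simp add: qphi_def Q_def)
    with *[folded f] show ?thesis by (simp only: e gen)
  qed
  have Ad: "((\<lambda>x. 1 + x\<^sup>2) has_real_derivative 2 * x) (at x)"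
    by (auto intro!: derivative_eq_intros)
  have "(symbol_factor k has_real_derivative - ((2 * x * qphi k x + (2 * x ^ 3 + k * x) / qphi k x * (1 + x\<^sup>2)) * inverse (((1 + x\<^sup>2) * qphi k x) ^ Suc (Suc 0)))) (at x)"
    unfolding symbol_factor_def[abs_def] by (rule DERIV_inverse_fun[OF DERIV_mult[OF Ad qd]]) (use q in simp)
  moreover have "- ((2 * x * qphi k x + (2 * x ^ 3 + k * x) / qphi k x * (1 + x\<^sup>2)) * inverse (((1 + x\<^sup>2) * qphi k x) ^ Suc (Suc 0))) = - symbol_factor k x * symbol_factor_log_deriv k x"
  proof -
    define A B q' where "A = 1 + x\<^sup>2" and "B = 2 * x ^ 3 + k * x" and "q' = qphi k x"
    have pos: "0 < A" "0 < q'" using q one_plus_sq_pos[of x] by (auto simp: A_def q'_def)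
    have "(2 * x * q' + B / q' * A) * inverse ((A * q') ^ Suc (Suc 0)) = inverse (A * q') * (2 * x / A + B / (q' * q'))"
      using pos by (simp add: field_simps)
    then show ?thesis unfolding symbol_factor_def symbol_factor_log_deriv_def A_def[symmetric] B_def[symmetric] q'_def[symmetric] Q_def[symmetric] qq[folded q'_def, symmetric]
      by simp
  qed
  ultimately show ?thesis by (rule DERIV_cong)
qed

lemma symbol_factor_log_deriv_deriv:
  assumes k: "\<bar>k\<bar> \<le> 1"
  shows "(symbol_factor_log_deriv k has_real_derivative symbol_factor_log_deriv' k x) (at x)"
proof -
  define Q where "Q = x ^ 4 + k * x\<^sup>2 + 1"
  have Q: "Q \<noteq> 0" unfolding Q_def using quartic_pos[OF k, of x] by simp
  have 1: "((\<lambda>x. 2 * x / (1 + x\<^sup>2)) has_real_derivative ((2 - 2 * x\<^sup>2) / (1 + x\<^sup>2)\<^sup>2)) (at x)"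
  proof -
    have "((\<lambda>x. 2 * x / (1 + x\<^sup>2)) has_real_derivative ((2 * (1 + x\<^sup>2) - 2 * x * (2 * x)) / ((1 + x\<^sup>2) * (1 + x\<^sup>2)))) (at x)"
      by (intro DERIV_divide) (auto intro!: derivative_eq_intros)
    moreover have "2 * (1 + x\<^sup>2) - 2 * x * (2 * x) = 2 - 2 * x\<^sup>2"
      by (simp add: power2_eq_square algebra_simps)
    ultimately show ?thesis by (simp only: power2_eq_square[of "1 + x\<^sup>2"])
  qed
  have "((\<lambda>x. (2 * x ^ 3 + k * x) / (x ^ 4 + k * x\<^sup>2 + 1)) has_real_derivative
      (((6 * x\<^sup>2 + k) * Q - (2 * x ^ 3 + k * x) * (4 * x ^ 3 + 2 * k * x)) / (Q * Q))) (at x)"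
    using Q unfolding Q_def by (intro DERIV_divide) (auto intro!: derivative_eq_intros)
  moreover have "((6 * x\<^sup>2 + k) * Q - (2 * x ^ 3 + k * x) * (4 * x ^ 3 + 2 * k * x)) / (Q * Q)
     = (6 * x\<^sup>2 + k) / Q - 2 * ((2 * x ^ 3 + k * x) / Q)\<^sup>2"
    using Q by (simp add: power2_eq_square divide_simps algebra_simps)
  ultimately have 2: "((\<lambda>x. (2 * x ^ 3 + k * x) / (x ^ 4 + k * x\<^sup>2 + 1)) has_real_derivative
      ((6 * x\<^sup>2 + k) / Q - 2 * ((2 * x ^ 3 + k * x) / Q)\<^sup>2)) (at x)" by (rule DERIV_cong)
  show ?thesis unfolding symbol_factor_log_deriv_def[abs_def] symbol_factor_log_deriv'_def Q_def[symmetric]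
    by (rule DERIV_add[OF 1 2])
qed

lemma symbol_factor_log_deriv_bounds:
  assumes k: "\<bar>k\<bar> \<le> 1"
  shows "\<bar>symbol_factor_log_deriv k x\<bar> \<le> 5" "\<bar>symbol_factor_log_deriv' k x\<bar> \<le> 58"
proof -
  define z Q B where "z = x\<^sup>2" and "Q = x ^ 4 + k * x\<^sup>2 + 1" and "B = 2 * x ^ 3 + k * x"
  have z: "0 \<le> z" by (simp add: z_def)
  have Q4: "(1 + z)\<^sup>2 / 4 \<le> Q" using qphi_sq(2)[OF k, of x] by (simp add: Q_def z_def power_divide)
  have Q: "0 < Q" unfolding Q_def by (rule quartic_pos[OF k])
  have x1: "2 * \<bar>x\<bar> \<le> 1 + z" using zero_le_power2[of "\<bar>x\<bar> - 1"] by (simp add: z_def power2_eq_square algebra_simps)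
  have B: "\<bar>B\<bar> \<le> 4 * Q"
  proof -
    have "B = x * (2 * z + k)" by (simp add: B_def z_def power3_eq_cube power2_eq_square algebra_simps)
    then have "\<bar>B\<bar> = \<bar>x\<bar> * \<bar>2 * z + k\<bar>" by (simp add: abs_mult)
    also have "\<dots> \<le> ((1 + z) / 2) * (2 * (1 + z))" using k z x1 by (intro mult_mono) auto
    also have "\<dots> = (1 + z)\<^sup>2" by (simp add: power2_eq_square)
    also have "\<dots> \<le> 4 * Q" using Q4 by simp
    finally show ?thesis .
  qed
  have BQ: "\<bar>B / Q\<bar> \<le> 4" using B Q by (simp add: abs_divide divide_le_eq)
  have "\<bar>2 * x / (1 + z)\<bar> \<le> 1" using x1 z by (simp add: abs_divide abs_mult divide_le_eq)
  with BQ show "\<bar>symbol_factor_log_deriv k x\<bar> \<le> 5"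
    unfolding symbol_factor_log_deriv_def z_def[symmetric] Q_def[symmetric, unfolded z_def[symmetric]] B_def[symmetric] by linarith
  have t1: "\<bar>(2 - 2 * z) / (1 + z)\<^sup>2\<bar> \<le> 2"
  proof -
    have "\<bar>2 - 2 * z\<bar> \<le> 2 * (1 + z)" using z by (simp add: abs_le_iff)
    also have "\<dots> \<le> 2 * (1 + z)\<^sup>2" using z by (simp add: power2_eq_square algebra_simps)
    finally show ?thesis using z by (simp add: abs_divide divide_le_eq)
  qed
  have t2: "\<bar>(6 * z + k) / Q\<bar> \<le> 24"
  proof -
    have "\<bar>6 * z + k\<bar> \<le> 6 * (1 + z)" using z k by (simp add: abs_le_iff)
    also have "\<dots> \<le> 6 * (1 + z)\<^sup>2" using z by (simp add: power2_eq_square algebra_simps)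
    also have "\<dots> \<le> 24 * Q" using Q4 by simp
    finally show ?thesis using Q by (simp add: abs_divide divide_le_eq)
  qed
  have "\<bar>B / Q\<bar>\<^sup>2 \<le> 4\<^sup>2" by (intro power_mono BQ abs_ge_zero)
  then have t3: "(B / Q)\<^sup>2 \<le> 16" "0 \<le> (B / Q)\<^sup>2" unfolding power2_abs by simp_all
  show "\<bar>symbol_factor_log_deriv' k x\<bar> \<le> 58"
    unfolding symbol_factor_log_deriv'_def z_def[symmetric] Q_def[symmetric, unfolded z_def[symmetric]] B_def[symmetric]
    using t1 t2 t3 by linarith
qed

lemma symbol_factor_decay:
  assumes k: "\<bar>k\<bar> \<le> 1"
  shows "symbol_factor k x * (1 + \<bar>x\<bar>) \<le> 8 * inverse ((1 + \<bar>x\<bar>)\<^sup>2)"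
proof -
  define y where "y = 1 + \<bar>x\<bar>"
  have y: "1 \<le> y" by (simp add: y_def)
  have z: "y\<^sup>2 \<le> 2 * (1 + x\<^sup>2)"
    using zero_le_power2[of "\<bar>x\<bar> - 1"] by (simp add: y_def power2_eq_square algebra_simps)
  have "y\<^sup>2 * y\<^sup>2 \<le> (2 * (1 + x\<^sup>2)) * (4 * qphi k x)"
    using z qphi_ge[OF k, of x] by (intro mult_mono) auto
  then have le: "y ^ 4 \<le> 8 * ((1 + x\<^sup>2) * qphi k x)" by (simp add: power4_eq_xxxx power2_eq_square mult_ac)
  have pos: "0 < (1 + x\<^sup>2) * qphi k x" using qphi_pos[OF k, of x] one_plus_sq_pos[of x] by simp
  have "y ^ 3 \<le> y ^ 4" using y by (intro power_increasing) auto
  then have "y * y\<^sup>2 \<le> 8 * ((1 + x\<^sup>2) * qphi k x)" using le by (simp add: power3_eq_cube power2_eq_square)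
  then have "inverse ((1 + x\<^sup>2) * qphi k x) * y \<le> 8 * inverse (y\<^sup>2)"
    using pos y by (simp add: field_simps)
  then show ?thesis by (simp add: symbol_factor_def y_def)
qed

text \<open>On each half line \<open>\<bar>\<xi>\<bar> a(\<xi>)\<close> agrees up to sign with the odd function \<open>\<xi> a(\<xi>)\<close>, which is smooth on the whole line.\<close>

definition odd_symbol :: "real \<Rightarrow> real \<Rightarrow> real" where "odd_symbol k x = x * symbol_factor k x"
definition odd_symbol' :: "real \<Rightarrow> real \<Rightarrow> real" where "odd_symbol' k x = symbol_factor k x - x * symbol_factor k x * symbol_factor_log_deriv k x"
definition odd_symbol'' :: "real \<Rightarrow> real \<Rightarrow> real" where
  "odd_symbol'' k x = symbol_factor k x * (- 2 * symbol_factor_log_deriv k x + x * ((symbol_factor_log_deriv k x)\<^sup>2 - symbol_factor_log_deriv' k x))"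

lemma odd_symbol_deriv:
  assumes k: "\<bar>k\<bar> \<le> 1"
  shows "(odd_symbol k has_real_derivative odd_symbol' k x) (at x)" "(odd_symbol' k has_real_derivative odd_symbol'' k x) (at x)"
proof -
  note d = symbol_factor_deriv[OF k, of x] symbol_factor_log_deriv_deriv[OF k, of x]
  have "(odd_symbol k has_real_derivative (1 * symbol_factor k x + (- symbol_factor k x * symbol_factor_log_deriv k x) * x)) (at x)"
    unfolding odd_symbol_def[abs_def] by (rule DERIV_mult[OF DERIV_ident d(1)])
  then show "(odd_symbol k has_real_derivative odd_symbol' k x) (at x)"
    by (rule DERIV_cong) (simp add: odd_symbol'_def mult_ac)
  have "(odd_symbol' k has_real_derivative (- symbol_factor k x * symbol_factor_log_deriv k x - ((1 * symbol_factor k x + (- symbol_factor k x * symbol_factor_log_deriv k x) * x) * symbol_factor_log_deriv k x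
      + symbol_factor_log_deriv' k x * (x * symbol_factor k x)))) (at x)"
    unfolding odd_symbol'_def[abs_def] by (rule DERIV_diff[OF d(1) DERIV_mult[OF DERIV_mult[OF DERIV_ident d(1)] d(2)]])
  then show "(odd_symbol' k has_real_derivative odd_symbol'' k x) (at x)"
    by (rule DERIV_cong) (simp add: odd_symbol''_def power2_eq_square algebra_simps)
qed

lemma odd_symbol_bounds:
  assumes k: "\<bar>k\<bar> \<le> 1"
  shows "\<bar>odd_symbol k x\<bar> \<le> 744 * inverse ((1 + \<bar>x\<bar>)\<^sup>2)" "\<bar>odd_symbol' k x\<bar> \<le> 744 * inverse ((1 + \<bar>x\<bar>)\<^sup>2)" "\<bar>odd_symbol'' k x\<bar> \<le> 744 * inverse ((1 + \<bar>x\<bar>)\<^sup>2)"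
proof -
  let ?a = "symbol_factor k x" and ?r = "symbol_factor_log_deriv k x" and ?r' = "symbol_factor_log_deriv' k x"
  note a0 = symbol_factor_nonneg[OF k, of x]
  note r = symbol_factor_log_deriv_bounds[OF k, of x]
  have r2: "\<bar>?r\<^sup>2\<bar> \<le> 25"
  proof -
    have "\<bar>?r\<bar>\<^sup>2 \<le> 5\<^sup>2" by (intro power_mono r(1) abs_ge_zero)
    then show ?thesis by simp
  qed
  have main: "\<bar>?a * c\<bar> \<le> 744 * inverse ((1 + \<bar>x\<bar>)\<^sup>2)" if "\<bar>c\<bar> \<le> 93 * (1 + \<bar>x\<bar>)" for c
  proof -
    have "\<bar>?a * c\<bar> \<le> ?a * (93 * (1 + \<bar>x\<bar>))" using a0 that by (simp add: abs_mult mult_left_mono)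
    also have "\<dots> = 93 * (?a * (1 + \<bar>x\<bar>))" by (simp only: mult.left_commute)
    also have "\<dots> \<le> 93 * (8 * inverse ((1 + \<bar>x\<bar>)\<^sup>2))"
      by (intro mult_left_mono symbol_factor_decay k) simp
    finally show ?thesis by simp
  qed
  show "\<bar>odd_symbol k x\<bar> \<le> 744 * inverse ((1 + \<bar>x\<bar>)\<^sup>2)" using main[of x] by (simp add: odd_symbol_def mult.commute)
  have "\<bar>1 - x * ?r\<bar> \<le> 1 + \<bar>x\<bar> * 5"
    using mult_left_mono[OF r(1), of "\<bar>x\<bar>"] by (simp add: abs_mult[symmetric])
  then show "\<bar>odd_symbol' k x\<bar> \<le> 744 * inverse ((1 + \<bar>x\<bar>)\<^sup>2)"
    using main[of "1 - x * ?r"] by (simp add: odd_symbol'_def algebra_simps)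
  have "\<bar>x * (?r\<^sup>2 - ?r')\<bar> \<le> \<bar>x\<bar> * 83"
  proof -
    have "\<bar>?r\<^sup>2 - ?r'\<bar> \<le> 83" using r(2) r2 zero_le_power2[of ?r] by linarith
    then show ?thesis unfolding abs_mult by (intro mult_left_mono) auto
  qed
  then show "\<bar>odd_symbol'' k x\<bar> \<le> 744 * inverse ((1 + \<bar>x\<bar>)\<^sup>2)"
    unfolding odd_symbol''_def using r(1) by (intro main) (auto simp: abs_le_iff)
qed

lemma odd_symbol_continuous:
  assumes k: "\<bar>k\<bar> \<le> 1"
  shows "isCont (odd_symbol k) x" "isCont (odd_symbol' k) x" "isCont (odd_symbol'' k) x"
proof -
  show "isCont (odd_symbol k) x" "isCont (odd_symbol' k) x" by (rule DERIV_isCont[OF odd_symbol_deriv(1)[OF k]] DERIV_isCont[OF odd_symbol_deriv(2)[OF k]])+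
  have c: "isCont (symbol_factor k) x" "isCont (symbol_factor_log_deriv k) x"
    by (rule DERIV_isCont[OF symbol_factor_deriv[OF k]] DERIV_isCont[OF symbol_factor_log_deriv_deriv[OF k]])+
  have "isCont (symbol_factor_log_deriv' k) x"
    unfolding symbol_factor_log_deriv'_def[abs_def] using quartic_pos[OF k, of x]
    by (intro continuous_intros) auto
  with c show "isCont (odd_symbol'' k) x" unfolding odd_symbol''_def[abs_def] by (intro continuous_intros)
qed

lemma odd_symbol_measurable [measurable]: "odd_symbol k \<in> borel_measurable borel" "odd_symbol'' k \<in> borel_measurable borel"
  unfolding odd_symbol_def odd_symbol''_def symbol_factor_def symbol_factor_log_deriv_def symbol_factor_log_deriv'_def qphi_def by measurable

text \<open>Two integrations by parts on the half line. The first boundary term vanishes because the symbol does at the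
  origin; the second one, from the corner, limits the decay to \<open>y\<^sup>-\<^sup>2\<close>, which is integrable at infinity.\<close>

lemma half_line_fourier_decay:
  assumes k: "\<bar>k\<bar> \<le> 1" and y: "y \<noteq> 0"
  shows "norm (\<integral>x. indicator {0<..} x * (cis (y * x) * of_real (odd_symbol k x)) \<partial>lborel)
     \<le> ((\<integral>x. \<bar>odd_symbol'' k x\<bar> \<partial>lborel) + \<bar>odd_symbol' k 0\<bar>) / y\<^sup>2"
proof -
  define c where "c = \<i> * complex_of_real y"
  have c: "c \<noteq> 0" "c\<^sup>2 = - (of_real (y\<^sup>2))" using y by (auto simp: c_def power_mult_distrib)
  have nc: "norm c = \<bar>y\<bar>" by (simp add: c_def norm_mult)
  \<comment> \<open>Both integrations by parts at once: \<open>F\<close> is an antiderivative of the integrand minus its second order remainder.\<close>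
  define F where "F x = cis (y * x) * (of_real (odd_symbol k x) / c - of_real (odd_symbol' k x) / c\<^sup>2)" for x
  define f where "f x = cis (y * x) * (of_real (odd_symbol k x) - of_real (odd_symbol'' k x) / c\<^sup>2)" for x
  have cisd: "((\<lambda>x. cis (y * x)) has_vector_derivative (\<i> * of_real y * cis (y * x))) (at x)" for x
    by (rule cis_has_vector_derivative) (auto intro!: derivative_eq_intros)
  have ord: "((\<lambda>x. complex_of_real (g x)) has_vector_derivative of_real g') (at x)" if "(g has_real_derivative g') (at x)" for g g' x
    using that by (rule has_vector_derivative_of_real)
  have Fd: "(F has_vector_derivative f x) (at x)" for x
  proof -
    have "(F has_vector_derivative (cis (y * x) * (of_real (odd_symbol' k x) / c - of_real (odd_symbol'' k x) / c\<^sup>2)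
        + (\<i> * of_real y * cis (y * x)) * (of_real (odd_symbol k x) / c - of_real (odd_symbol' k x) / c\<^sup>2))) (at x)"
      unfolding F_def
      by (rule has_vector_derivative_mult[OF cisd has_vector_derivative_diff[OF has_vector_derivative_divide[OF ord[OF odd_symbol_deriv(1)[OF k]]]
            has_vector_derivative_divide[OF ord[OF odd_symbol_deriv(2)[OF k]]]]])
    moreover have "cis (y * x) * (of_real (odd_symbol' k x) / c - of_real (odd_symbol'' k x) / c\<^sup>2)
        + (\<i> * of_real y * cis (y * x)) * (of_real (odd_symbol k x) / c - of_real (odd_symbol' k x) / c\<^sup>2) = f x"
      unfolding f_def c_def[symmetric] using c(1) by (simp add: field_simps power2_eq_square)
    ultimately show ?thesis by simp
  qed
  have kc: "isCont (\<lambda>x. cis (y * x)) x" for x :: real unfolding isCont_def by (intro tendsto_intros)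
  have fc: "isCont f x" for x
    unfolding f_def using c by (intro continuous_intros kc isCont_of_real odd_symbol_continuous[OF k]) auto
  have [measurable]: "f \<in> borel_measurable borel"
    by (intro borel_measurable_continuous_onI continuous_at_imp_continuous_on ballI fc)
  have i: "integrable lborel (\<lambda>x. complex_of_real (odd_symbol k x))" "integrable lborel (\<lambda>x. complex_of_real (odd_symbol'' k x))"
    using odd_symbol_bounds[OF k] by (auto intro!: integrable_slice_bound)
  have i1: "integrable lborel (\<lambda>x. cis (y * x) * complex_of_real (odd_symbol k x))" "integrable lborel (\<lambda>x. cis (y * x) * complex_of_real (odd_symbol'' k x))"
    by (intro integrable_cis_mult i; measurable)+
  have i2: "integrable lborel (\<lambda>x. indicator {0<..} x * (cis (y * x) * complex_of_real (odd_symbol k x)))"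
     "integrable lborel (\<lambda>x. indicator {0<..} x * (cis (y * x) * complex_of_real (odd_symbol'' k x)))"
    using i1[THEN integrable_mult_indicator[of "{0<..}" lborel, rotated]]
    by (auto simp: scaleR_conv_of_real of_real_indicator)
  have fi: "integrable lborel f"
  proof -
    have "integrable lborel (\<lambda>x. cis (y * x) * complex_of_real (odd_symbol k x) - (cis (y * x) * complex_of_real (odd_symbol'' k x)) / c\<^sup>2)"
      by (intro Bochner_Integration.integrable_diff i1 integrable_divide)
    then show ?thesis unfolding f_def by (simp add: right_diff_distrib)
  qed
  have lim0: "(F \<longlongrightarrow> - (of_real (odd_symbol' k 0) / c\<^sup>2)) (at_right 0)"
  proof -
    have "isCont F 0" by (rule has_vector_derivative_continuous[OF Fd])
    then have "(F \<longlongrightarrow> F 0) (at_right 0)" unfolding isCont_def by (rule filterlim_mono) (auto simp: at_within_le_at)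
    then show ?thesis by (simp add: F_def odd_symbol_def)
  qed
  have limi: "(F \<longlongrightarrow> 0) at_top"
  proof (rule Lim_null_comparison)
    have "norm (F x) \<le> (744 / \<bar>y\<bar> + 744 / y\<^sup>2) * inverse ((1 + \<bar>x\<bar>)\<^sup>2)" for x
    proof -
      have "norm (F x) \<le> norm (of_real (odd_symbol k x) / c) + norm (of_real (odd_symbol' k x) / c\<^sup>2)"
        unfolding F_def norm_mult norm_cis mult_1 by (rule norm_triangle_ineq4)
      also have "\<dots> = \<bar>odd_symbol k x\<bar> / \<bar>y\<bar> + \<bar>odd_symbol' k x\<bar> / y\<^sup>2"
        by (simp add: norm_divide norm_power nc)
      also have "\<dots> \<le> 744 * inverse ((1 + \<bar>x\<bar>)\<^sup>2) / \<bar>y\<bar> + 744 * inverse ((1 + \<bar>x\<bar>)\<^sup>2) / y\<^sup>2"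
        by (intro add_mono divide_right_mono odd_symbol_bounds[OF k]) auto
      finally show ?thesis by (simp add: algebra_simps)
    qed
    then show "\<forall>\<^sub>F x in at_top. norm (F x) \<le> (744 / \<bar>y\<bar> + 744 / y\<^sup>2) * inverse ((1 + \<bar>x\<bar>)\<^sup>2)"
      by (intro always_eventually) auto
    have "((\<lambda>x::real. inverse ((1 + \<bar>x\<bar>)\<^sup>2)) \<longlongrightarrow> 0) at_top" by real_asymp
    then show "((\<lambda>x. (744 / \<bar>y\<bar> + 744 / y\<^sup>2) * inverse ((1 + \<bar>x\<bar>)\<^sup>2)) \<longlongrightarrow> 0) at_top"
      by (rule tendsto_mult_right_zero)
  qed
  have "(LBINT x=0..\<infinity>. f x) = 0 - (- (of_real (odd_symbol' k 0) / c\<^sup>2))"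
  proof (rule interval_integral_FTC_integrable[where F=F])
    show "((F \<circ> real_of_ereal) \<longlongrightarrow> - (of_real (odd_symbol' k 0) / c\<^sup>2)) (at_right 0)"
      unfolding zero_ereal_def ereal_tendsto_simps by (rule lim0)
    show "((F \<circ> real_of_ereal) \<longlongrightarrow> 0) (at_left \<infinity>)"
      unfolding ereal_tendsto_simps by (rule limi)
    show "set_integrable lborel (einterval 0 \<infinity>) f"
      unfolding set_integrable_def by (intro integrable_mult_indicator fi) simp
  qed (use Fd fc in auto)
  moreover have "einterval 0 \<infinity> = {0<..}"
    by (auto simp: einterval_def zero_ereal_def)
  ultimately have "(\<integral>x. indicator {0<..} x *\<^sub>R f x \<partial>lborel) = of_real (odd_symbol' k 0) / c\<^sup>2"
    by (simp add: interval_lebesgue_integral_def set_lebesgue_integral_def)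
  moreover have "(\<integral>x. indicator {0<..} x *\<^sub>R f x \<partial>lborel) =
      (\<integral>x. indicator {0<..} x * (cis (y * x) * complex_of_real (odd_symbol k x)) - (indicator {0<..} x * (cis (y * x) * complex_of_real (odd_symbol'' k x))) / c\<^sup>2 \<partial>lborel)"
    by (intro Bochner_Integration.integral_cong refl) (simp add: f_def scaleR_conv_of_real of_real_indicator algebra_simps)
  moreover have "\<dots> = (\<integral>x. indicator {0<..} x * (cis (y * x) * complex_of_real (odd_symbol k x)) \<partial>lborel) - (\<integral>x. indicator {0<..} x * (cis (y * x) * complex_of_real (odd_symbol'' k x)) \<partial>lborel) / c\<^sup>2"
    by (subst Bochner_Integration.integral_diff) (use i2 in auto)
  ultimately have "(\<integral>x. indicator {0<..} x * (cis (y * x) * complex_of_real (odd_symbol k x)) \<partial>lborel)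
     = ((\<integral>x. indicator {0<..} x * (cis (y * x) * complex_of_real (odd_symbol'' k x)) \<partial>lborel) + of_real (odd_symbol' k 0)) / c\<^sup>2"
    by (simp add: add_divide_distrib algebra_simps)
  then have "norm (\<integral>x. indicator {0<..} x * (cis (y * x) * complex_of_real (odd_symbol k x)) \<partial>lborel)
     = norm ((\<integral>x. indicator {0<..} x * (cis (y * x) * complex_of_real (odd_symbol'' k x)) \<partial>lborel) + of_real (odd_symbol' k 0)) / y\<^sup>2"
    by (simp add: norm_divide norm_power nc)
  also have "\<dots> \<le> ((\<integral>x. \<bar>odd_symbol'' k x\<bar> \<partial>lborel) + \<bar>odd_symbol' k 0\<bar>) / y\<^sup>2"
  proof (intro divide_right_mono order_trans[OF norm_triangle_ineq] add_mono)
    have "norm (\<integral>x. indicator {0<..} x * (cis (y * x) * complex_of_real (odd_symbol'' k x)) \<partial>lborel) \<le> (\<integral>x. norm (indicator {0<..} x * (cis (y * x) * complex_of_real (odd_symbol'' k x))) \<partial>lborel)"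
      by (rule integral_norm_bound)
    also have "\<dots> \<le> (\<integral>x. \<bar>odd_symbol'' k x\<bar> \<partial>lborel)"
    proof (rule integral_mono)
      show "integrable lborel (\<lambda>x. norm (indicator {0<..} x * (cis (y * x) * complex_of_real (odd_symbol'' k x))))"
        by (rule integrable_norm[OF i2(2)])
      show "integrable lborel (\<lambda>x. \<bar>odd_symbol'' k x\<bar>)" using integrable_norm[OF i(2)] by simp
    qed (auto simp: norm_mult indicator_def)
    finally show "norm (\<integral>x. indicator {0<..} x * (cis (y * x) * complex_of_real (odd_symbol'' k x)) \<partial>lborel) \<le> (\<integral>x. \<bar>odd_symbol'' k x\<bar> \<partial>lborel)" .
  qed auto
  finally show ?thesis .
qed

section \<open>The multiplier operator\<close>

text \<open>The symbol \<open>\<bar>\<xi>\<bar> a(\<xi>)\<close> as a complex valued function, to which the transform applies.\<close>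

definition even_symbol :: "real \<Rightarrow> real \<Rightarrow> complex" where
  "even_symbol k x = of_real (\<bar>x\<bar> * symbol_factor k x)"

lemma symbol_factor_minus [simp]: "symbol_factor k (- x) = symbol_factor k x"
  by (simp add: symbol_factor_def)

lemma even_symbol_minus [simp]: "even_symbol k (- x) = even_symbol k x"
  by (simp add: even_symbol_def)

lemma norm_even_symbol: "\<bar>k\<bar> \<le> 1 \<Longrightarrow> norm (even_symbol k x) = \<bar>odd_symbol k x\<bar>"
  using symbol_factor_nonneg[of k x] by (simp add: even_symbol_def odd_symbol_def abs_mult norm_mult)

lemma even_symbol_mult: "\<bar>k\<bar> \<le> 1 \<Longrightarrow> even_symbol k x * of_real (1 + x\<^sup>2) = of_real (x\<^sup>2 / phi k x)"
proof -
  assume k: "\<bar>k\<bar> \<le> 1"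
  have q: "qphi k x \<noteq> 0" using qphi_pos[OF k, of x] by simp
  have "\<bar>x\<bar> * symbol_factor k x * (1 + x\<^sup>2) = x\<^sup>2 / phi k x"
  proof (cases "x = 0")
    case False
    have "x\<^sup>2 / phi k x = \<bar>x\<bar> * \<bar>x\<bar> / (\<bar>x\<bar> * qphi k x)" by (simp add: phi_eq_qphi power2_eq_square)
    also have "\<dots> = \<bar>x\<bar> / qphi k x" by (rule mult_divide_mult_cancel_left) (use False in simp)
    also have "\<dots> = \<bar>x\<bar> * symbol_factor k x * (1 + x\<^sup>2)"
      unfolding symbol_factor_def using q by (simp add: divide_inverse)
    finally show ?thesis by simp
  qed simp
  then show ?thesis unfolding even_symbol_def of_real_mult[symmetric] by simp
qed

lemma even_symbol_integrable: "\<bar>k\<bar> \<le> 1 \<Longrightarrow> integrable lborel (even_symbol k)"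
proof (rule integrable_slice_bound)
  assume k: "\<bar>k\<bar> \<le> 1"
  show "even_symbol k \<in> borel_measurable borel"
    unfolding even_symbol_def[abs_def] symbol_factor_def qphi_def by measurable
  show "norm (even_symbol k x) \<le> 744 * inverse ((1 + \<bar>x\<bar>)\<^sup>2)" for x
    unfolding norm_even_symbol[OF k] by (rule odd_symbol_bounds(1)[OF k])
qed

lemma even_symbol_continuous: "\<bar>k\<bar> \<le> 1 \<Longrightarrow> isCont (even_symbol k) x"
  unfolding even_symbol_def[abs_def] by (intro continuous_intros isCont_of_real DERIV_isCont[OF symbol_factor_deriv])

lemma even_symbol_bounded: assumes k: "\<bar>k\<bar> \<le> 1" shows "norm (even_symbol k x) \<le> 744"
proof -
  have "inverse ((1 + \<bar>x\<bar>)\<^sup>2) \<le> 1" by (intro inverse_le_1_iff[THEN iffD2] disjI2 one_le_power) simp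
  then show ?thesis using odd_symbol_bounds(1)[OF k, of x] unfolding norm_even_symbol[OF k] by linarith
qed

text \<open>The transform splits into two half line integrals; near \<open>y = 0\<close> the bound by the \<open>L\<^sup>1\<close> norm of the symbol is
  used.\<close>

lemma ft_even_symbol_decay:
  assumes k: "\<bar>k\<bar> \<le> 1"
  obtains C where "\<And>y. norm (ft (even_symbol k) y) \<le> C * inverse ((1 + \<bar>y\<bar>)\<^sup>2)"
proof -
  define D where "D = (\<integral>x. \<bar>odd_symbol'' k x\<bar> \<partial>lborel) + \<bar>odd_symbol' k 0\<bar>"
  define E where "E = (\<integral>x. norm (even_symbol k x) \<partial>lborel)"
  have DE: "0 \<le> D" "0 \<le> E" by (auto simp: D_def E_def)
  have le1: "norm (ft (even_symbol k) y) \<le> E" for y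
    unfolding E_def by (rule norm_ft_le[OF even_symbol_integrable[OF k]])
  have i: "integrable lborel (\<lambda>x. complex_of_real (odd_symbol k x))"
    using odd_symbol_bounds[OF k] by (auto intro!: integrable_slice_bound)
  have le2: "norm (ft (even_symbol k) y) \<le> 2 * D / y\<^sup>2" if y: "y \<noteq> 0" for y
  proof -
    define A where "A y x = indicator {0<..} x * (cis (y * x) * complex_of_real (odd_symbol k x))" for y x :: real
    have Ai: "integrable lborel (A y)" for y
    proof -
      have "integrable lborel (\<lambda>x. cis (y * x) * complex_of_real (odd_symbol k x))"
        by (rule integrable_cis_mult[OF i]) measurable
      from integrable_mult_indicator[OF _ this, of "{0<..}"] show ?thesis
        unfolding A_def[abs_def] by (simp add: scaleR_conv_of_real of_real_indicator)
    qed
    have "ft (even_symbol k) y = (\<integral>x. A (- y) x + A y (0 + (-1) *\<^sub>R x) \<partial>lborel)"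
      unfolding ft_def
    proof (intro Bochner_Integration.integral_cong refl)
      fix x :: real
      consider "x < 0" | "x = 0" | "0 < x" by linarith
      then show "cis (- (x \<bullet> y)) * even_symbol k x = A (- y) x + A y (0 + (-1) *\<^sub>R x)"
        by cases (auto simp: A_def even_symbol_def odd_symbol_def mult.commute)
    qed
    also have "\<dots> = (\<integral>x. A (- y) x \<partial>lborel) + (\<integral>x. A y (0 + (-1) *\<^sub>R x) \<partial>lborel)"
      by (intro Bochner_Integration.integral_add Ai integrable_affine) simp
    also have "(\<integral>x. A y (0 + (-1) *\<^sub>R x) \<partial>lborel) = (\<integral>x. A y x \<partial>lborel)"
      using integral_affine[of "A y" "-1" 0] borel_measurable_integrable[OF Ai] by simp
    finally have "norm (ft (even_symbol k) y) \<le> norm (\<integral>x. A (- y) x \<partial>lborel) + norm (\<integral>x. A y x \<partial>lborel)"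
      by (simp add: norm_triangle_ineq)
    also have "\<dots> \<le> D / (- y)\<^sup>2 + D / y\<^sup>2"
      unfolding A_def D_def using y by (intro add_mono half_line_fourier_decay[OF k]) auto
    finally show ?thesis by simp
  qed
  have "norm (ft (even_symbol k) y) \<le> (8 * D + 4 * E) * inverse ((1 + \<bar>y\<bar>)\<^sup>2)" for y
  proof -
    have pos: "0 < (1 + \<bar>y\<bar>)\<^sup>2" by (intro zero_less_power) auto
    have "norm (ft (even_symbol k) y) * (1 + \<bar>y\<bar>)\<^sup>2 \<le> 8 * D + 4 * E"
    proof (cases "\<bar>y\<bar> < 1")
      case True
      then have "(1 + \<bar>y\<bar>)\<^sup>2 \<le> 2\<^sup>2" by (intro power_mono) auto
      then have "norm (ft (even_symbol k) y) * (1 + \<bar>y\<bar>)\<^sup>2 \<le> E * 4" using le1[of y] DE by (intro mult_mono) auto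
      then show ?thesis using DE by linarith
    next
      case False
      then have y: "y \<noteq> 0" "0 < y\<^sup>2" by auto
      have "(1 + \<bar>y\<bar>)\<^sup>2 \<le> (2 * \<bar>y\<bar>)\<^sup>2" using False by (intro power_mono) auto
      then have "norm (ft (even_symbol k) y) * (1 + \<bar>y\<bar>)\<^sup>2 \<le> 2 * D / y\<^sup>2 * (4 * y\<^sup>2)"
        using le2[OF y(1)] DE y by (intro mult_mono) (auto simp: power_mult_distrib)
      also have "\<dots> = 8 * D" using y by simp
      finally show ?thesis using DE by linarith
    qed
    then show ?thesis using pos by (simp add: divide_inverse[symmetric] pos_le_divide_eq)
  qed
  then show ?thesis by (rule that)
qed

lemma ft_even_symbol_integrable:
  assumes k: "\<bar>k\<bar> \<le> 1" shows "integrable lborel (ft (even_symbol k))"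
proof -
  obtain C where "\<And>y. norm (ft (even_symbol k) y) \<le> C * inverse ((1 + \<bar>y\<bar>)\<^sup>2)" using ft_even_symbol_decay[OF k] by blast
  then show ?thesis by (intro integrable_slice_bound ft_measurable even_symbol_integrable k)
qed

lemma ft_ft_even_symbol:
  assumes k: "\<bar>k\<bar> \<le> 1"
  shows "(\<integral>y. cis (- (y * \<xi>)) * ft (even_symbol k) y \<partial>lborel) = of_real (2 * pi) * even_symbol k \<xi>"
proof -
  have "(\<integral>y. cis ((- \<xi>) * y) * ft (even_symbol k) y \<partial>lborel) = of_real (2 * pi) * even_symbol k (- \<xi>)"
    by (rule ft_inversion_real[OF even_symbol_integrable[OF k] even_symbol_continuous[OF k] even_symbol_bounded[OF k] ft_even_symbol_integrable[OF k]])
  then show ?thesis by (simp add: mult.commute)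
qed

lemma integral_translate:
  fixes f :: "'a::euclidean_space \<Rightarrow> 'b::{banach, second_countable_topology}"
  assumes f: "f \<in> borel_measurable borel"
  shows "(\<integral>z. f (z - a) \<partial>lborel) = (\<integral>z. f z \<partial>lborel)"
proof -
  have "(\<integral>z. f (- a + 1 *\<^sub>R z) \<partial>lborel) = (\<integral>z. f (z - a) \<partial>lborel)"
    by (intro Bochner_Integration.integral_cong refl arg_cong[where f=f]) simp
  then show ?thesis using integral_affine[OF f, of 1 "- a"] by simp
qed

text \<open>Convolution in the space variable only, since the symbol does not depend on \<open>\<tau>\<close>.\<close>

definition x_convolution :: "(real \<Rightarrow> complex) \<Rightarrow> (real \<times> real \<Rightarrow> complex) \<Rightarrow> real \<times> real \<Rightarrow> complex" where
  "x_convolution \<kappa> w z = (\<integral>y. \<kappa> y * w (z - (y, 0)) \<partial>lborel)"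

lemma x_convolution_integrable_ft:
  fixes \<kappa> :: "real \<Rightarrow> complex"
  assumes \<kappa>: "integrable lborel \<kappa>" and w: "integrable lborel w"
  shows "integrable lborel (x_convolution \<kappa> w)"
    and "ft (x_convolution \<kappa> w) \<zeta> = (\<integral>y. cis (- (y * fst \<zeta>)) * \<kappa> y \<partial>lborel) * ft w \<zeta>"
proof -
  have [measurable]: "\<kappa> \<in> borel_measurable borel" "w \<in> borel_measurable borel"
    using borel_measurable_integrable[OF \<kappa>] borel_measurable_integrable[OF w] by auto
  have [measurable]: "(\<lambda>y::real. (y, 0::real)) \<in> borel_measurable borel"
    by (intro borel_measurable_continuous_onI continuous_intros)
  have wi: "integrable lborel (\<lambda>z. w (z - (y, 0)))" for y
  proof -
    have "(\<lambda>z. w (- (y, 0) + 1 *\<^sub>R z)) = (\<lambda>z. w (z - (y, 0)))"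
      by (intro ext arg_cong[where f=w]) (simp add: prod_eq_iff)
    then show ?thesis using integrable_affine[OF w, of 1 "- (y, 0)"] by simp
  qed
  have I: "integrable (lborel \<Otimes>\<^sub>M lborel) (\<lambda>(y, z). \<kappa> y * w (z - (y, 0)))"
  proof (rule lborel_pair.Fubini_integrable)
    have "(\<integral>z. norm (\<kappa> y * w (z - (y, 0))) \<partial>lborel) = norm (\<kappa> y) * (\<integral>z. norm (w z) \<partial>lborel)" for y
      using integral_translate[of "\<lambda>z. norm (w z)" "(y, 0)"] by (simp add: norm_mult)
    then show "integrable lborel (\<lambda>y. \<integral>z. norm (case (y, z) of (y, z) \<Rightarrow> \<kappa> y * w (z - (y, 0))) \<partial>lborel)"
      using \<kappa> by simp
    show "AE y in lborel. integrable lborel (\<lambda>z. case (y, z) of (y, z) \<Rightarrow> \<kappa> y * w (z - (y, 0)))"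
      using wi by simp
  qed measurable
  show "integrable lborel (x_convolution \<kappa> w)"
    unfolding x_convolution_def[abs_def] by (rule lborel_pair.integrable_snd[OF I])
  have I2: "integrable (lborel \<Otimes>\<^sub>M lborel) (\<lambda>(y, z). cis (- (z \<bullet> \<zeta>)) * (\<kappa> y * w (z - (y, 0))))"
    by (rule Bochner_Integration.integrable_bound[OF I]) (auto simp: norm_mult)
  have "ft (x_convolution \<kappa> w) \<zeta> = (\<integral>z. \<integral>y. cis (- (z \<bullet> \<zeta>)) * (\<kappa> y * w (z - (y, 0))) \<partial>lborel \<partial>lborel)"
    unfolding ft_def x_convolution_def by simp
  also have "\<dots> = (\<integral>y. \<integral>z. cis (- (z \<bullet> \<zeta>)) * (\<kappa> y * w (z - (y, 0))) \<partial>lborel \<partial>lborel)"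
    by (rule lborel_pair.Fubini_integral[OF I2])
  also have "\<dots> = (\<integral>y. cis (- (y * fst \<zeta>)) * \<kappa> y * ft w \<zeta> \<partial>lborel)"
  proof (intro Bochner_Integration.integral_cong refl)
    fix y :: real
    have "(\<integral>z. cis (- (z \<bullet> \<zeta>)) * (\<kappa> y * w (z - (y, 0))) \<partial>lborel)
       = (\<integral>z. cis (- (y * fst \<zeta>)) * \<kappa> y * (cis (- ((z - (y, 0)) \<bullet> \<zeta>)) * w (z - (y, 0))) \<partial>lborel)"
    proof (intro Bochner_Integration.integral_cong refl)
      fix z :: "real \<times> real"
      have "cis (- (z \<bullet> \<zeta>)) = cis (- (y * fst \<zeta>)) * cis (- ((z - (y, 0)) \<bullet> \<zeta>))"
        by (simp add: cis_mult inner_diff_left inner_prod_def algebra_simps)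
      then show "cis (- (z \<bullet> \<zeta>)) * (\<kappa> y * w (z - (y, 0))) = cis (- (y * fst \<zeta>)) * \<kappa> y * (cis (- ((z - (y, 0)) \<bullet> \<zeta>)) * w (z - (y, 0)))"
        by (simp only: mult_ac)
    qed
    also have "\<dots> = cis (- (y * fst \<zeta>)) * \<kappa> y * (\<integral>z. cis (- ((z - (y, 0)) \<bullet> \<zeta>)) * w (z - (y, 0)) \<partial>lborel)"
      by simp
    also have "(\<integral>z. cis (- ((z - (y, 0)) \<bullet> \<zeta>)) * w (z - (y, 0)) \<partial>lborel) = ft w \<zeta>"
      unfolding ft_def by (rule integral_translate[where f="\<lambda>z. cis (- (z \<bullet> \<zeta>)) * w z"]) measurable
    finally show "(\<integral>z. cis (- (z \<bullet> \<zeta>)) * (\<kappa> y * w (z - (y, 0))) \<partial>lborel) = cis (- (y * fst \<zeta>)) * \<kappa> y * ft w \<zeta>" .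
  qed
  also have "\<dots> = (\<integral>y. cis (- (y * fst \<zeta>)) * \<kappa> y \<partial>lborel) * ft w \<zeta>" by simp
  finally show "ft (x_convolution \<kappa> w) \<zeta> = (\<integral>y. cis (- (y * fst \<zeta>)) * \<kappa> y \<partial>lborel) * ft w \<zeta>" .
qed

lemma x_convolution_continuous_bounded:
  fixes \<kappa> :: "real \<Rightarrow> complex"
  assumes \<kappa>: "integrable lborel \<kappa>" and wc: "\<And>z. isCont w z" and B: "\<And>z. norm (w z) \<le> B"
  shows "isCont (x_convolution \<kappa> w) z" "norm (x_convolution \<kappa> w z) \<le> (\<integral>y. norm (\<kappa> y) * B \<partial>lborel)"
proof -
  have [measurable]: "\<kappa> \<in> borel_measurable borel" using borel_measurable_integrable[OF \<kappa>] by simp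
  have [measurable]: "w \<in> borel_measurable borel"
    by (intro borel_measurable_continuous_onI continuous_at_imp_continuous_on ballI wc)
  have [measurable]: "(\<lambda>y::real. (y, 0::real)) \<in> borel_measurable borel"
    by (intro borel_measurable_continuous_onI continuous_intros)
  have bd: "norm (\<kappa> y * w z) \<le> norm (\<kappa> y) * B" for y z
    unfolding norm_mult by (intro mult_left_mono B) auto
  have dom: "integrable lborel (\<lambda>y. norm (\<kappa> y) * B)" using \<kappa> by simp
  show "isCont (x_convolution \<kappa> w) z"
  proof (unfold continuous_at_sequentially, intro allI impI)
    fix X :: "nat \<Rightarrow> real \<times> real" assume X: "X \<longlonglongrightarrow> z"
    show "(x_convolution \<kappa> w \<circ> X) \<longlonglongrightarrow> x_convolution \<kappa> w z"
      unfolding x_convolution_def comp_def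
    proof (rule integral_dominated_convergence[where w="\<lambda>y. norm (\<kappa> y) * B"])
      show "AE y in lborel. (\<lambda>n. \<kappa> y * w (X n - (y, 0))) \<longlonglongrightarrow> \<kappa> y * w (z - (y, 0))"
        by (intro always_eventually allI tendsto_intros isCont_tendsto_compose[OF wc] X)
    qed (use dom bd in auto)
  qed
  have "norm (x_convolution \<kappa> w z) \<le> (\<integral>y. norm (\<kappa> y * w (z - (y, 0))) \<partial>lborel)"
    unfolding x_convolution_def by (rule integral_norm_bound)
  also have "\<dots> \<le> (\<integral>y. norm (\<kappa> y) * B \<partial>lborel)"
    by (intro integral_mono bd dom) (rule Bochner_Integration.integrable_bound[OF dom], measurable,
      simp only: real_norm_def, intro AE_I2 order_trans[OF _ abs_ge_self], simp only: abs_norm_cancel bd)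
  finally show "norm (x_convolution \<kappa> w z) \<le> (\<integral>y. norm (\<kappa> y) * B \<partial>lborel)" .
qed

lemma ft_dx_dx:
  assumes g: "g \<in> schwartz"
  shows "ft (dx (dx g)) \<zeta> = - of_real ((fst \<zeta>)\<^sup>2) * ft g \<zeta>"
proof -
  have "\<i> * a * (\<i> * a * b) = - (a\<^sup>2) * b" for a b :: complex
    by (simp add: power2_eq_square mult_ac)
  then show ?thesis by (simp add: ft_dx schwartz_dx g)
qed

definition phi_op :: "real \<Rightarrow> (real \<times> real \<Rightarrow> complex) \<Rightarrow> real \<times> real \<Rightarrow> complex" where
  "phi_op k g = inv_fourier (\<lambda>(\<xi>, \<tau>). fourier (dx (dx g)) (\<xi>, \<tau>) / complex_of_real (phi k \<xi>))"

text \<open>The candidate for the output is the convolution \<open>f\<close> of \<open>- (g - g\<^sub>x\<^sub>x)\<close> with the inverse transform of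
  \<open>\<bar>\<xi>\<bar> a(\<xi>)\<close>, an even function. This \<open>f\<close> is integrable, continuous and bounded, and has the transform required. As this
  transform is integrable, inversion identifies \<open>f\<close> with \<open>phi_op k g\<close>.\<close>

lemma phi_op_props:
  assumes k: "\<bar>k\<bar> \<le> 1" and g: "g \<in> schwartz"
  shows "integrable lborel (phi_op k g)"
    and "ft (phi_op k g) \<zeta> = - of_real ((fst \<zeta>)\<^sup>2 / phi k (fst \<zeta>)) * ft g \<zeta>"
proof -
  define w where "w z = g z - dx (dx g) z" for z
  have w: "w \<in> schwartz" unfolding w_def by (intro schwartz_diff schwartz_dx g)
  have ftw: "ft w \<zeta> = of_real (1 + (fst \<zeta>)\<^sup>2) * ft g \<zeta>" for \<zeta>
  proof -
    have "ft w \<zeta> = ft g \<zeta> - ft (dx (dx g)) \<zeta>"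
      unfolding w_def by (intro ft_linear schwartz_integrable schwartz_dx g)
    also have "ft (dx (dx g)) \<zeta> = - of_real ((fst \<zeta>)\<^sup>2) * ft g \<zeta>"
      by (rule ft_dx_dx[OF g])
    finally show ?thesis by (simp add: algebra_simps)
  qed
  define f where "f z = - of_real (1 / (2 * pi)) * x_convolution (ft (even_symbol k)) w z" for z
  note \<kappa> = ft_even_symbol_integrable[OF k]
  note xi = x_convolution_integrable_ft[OF \<kappa> schwartz_integrable[OF w]]
  obtain B where B: "\<And>z. norm (w z) \<le> B" using schwartz_bounded[OF w] by blast
  note xc = x_convolution_continuous_bounded[OF \<kappa> schwartz_continuous[OF w] B]
  have fi: "integrable lborel f" unfolding f_def using xi(1) by simp
  have ftf: "ft f \<zeta> = - (even_symbol k (fst \<zeta>) * ft w \<zeta>)" for \<zeta>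
  proof -
    have "ft f \<zeta> = - of_real (1 / (2 * pi)) * ft (x_convolution (ft (even_symbol k)) w) \<zeta>"
      unfolding f_def by (rule ft_scale)
    also have "\<dots> = - of_real (1 / (2 * pi)) * (of_real (2 * pi) * even_symbol k (fst \<zeta>) * ft w \<zeta>)"
      unfolding xi(2) ft_ft_even_symbol[OF k] ..
    finally show ?thesis by simp
  qed
  have ftf': "ft f \<zeta> = - of_real ((fst \<zeta>)\<^sup>2 / phi k (fst \<zeta>)) * ft g \<zeta>" for \<zeta>
    unfolding ftf ftw by (simp add: even_symbol_mult[OF k, symmetric] del: of_real_add of_real_divide)
  have "rapid (ft f)"
    by (rule rapid_dominated[OF rapid_ft[OF w], of _ 744]) (auto simp: ftf norm_mult intro!: mult_right_mono even_symbol_bounded[OF k])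
  then have ftfi: "integrable lborel (ft f)"
    by (rule rapid_integrable) (rule ft_measurable[OF fi])
  have "phi_op k g = inv_fourier (ft f)"
    unfolding phi_op_def
  proof (rule arg_cong[where f=inv_fourier], rule ext)
    fix \<zeta> :: "real \<times> real"
    show "(case \<zeta> of (\<xi>, \<tau>) \<Rightarrow> fourier (dx (dx g)) (\<xi>, \<tau>) / complex_of_real (phi k \<xi>)) = ft f \<zeta>"
      unfolding ftf' fourier_eq_ft by (cases \<zeta>) (simp add: ft_dx_dx g)
  qed
  also have "\<dots> = f"
  proof (rule inv_fourier_ft[OF fi _ _ ftfi])
    show "isCont f x" for x unfolding f_def by (intro continuous_intros xc(1))
    show "norm (f z) \<le> norm (complex_of_real (1 / (2 * pi))) * (\<integral>y. norm (ft (even_symbol k) y) * B \<partial>lborel)" for z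
      unfolding f_def norm_mult norm_minus_cancel by (intro mult_left_mono xc(2)) auto
  qed
  finally have "phi_op k g = f" .
  with fi ftf' show "integrable lborel (phi_op k g)" "ft (phi_op k g) \<zeta> = - of_real ((fst \<zeta>)\<^sup>2 / phi k (fst \<zeta>)) * ft g \<zeta>"
    by simp_all
qed

section \<open>Approximation by Schwartz functions\<close>

lemma op_quad_eq: "op_quad k u = phi_op k (\<lambda>z. u z * dx (dx u) z)"
  by (simp add: op_quad_def phi_op_def)

lemma op_cubic_eq: "op_cubic k u = phi_op k (\<lambda>z. u z ^ 3)"
  by (simp add: op_cubic_def phi_op_def)

lemma ft_shift:
  fixes w :: "real \<times> real \<Rightarrow> complex"
  assumes w: "integrable lborel w"
  shows "ft (\<lambda>z. w (z + (a, 0))) \<zeta> = cis (a * fst \<zeta>) * ft w \<zeta>"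
proof -
  have [measurable]: "w \<in> borel_measurable borel" using borel_measurable_integrable[OF w] by simp
  let ?f = "\<lambda>z. cis (- ((z - (a, 0)) \<bullet> \<zeta>)) * w z"
  have "ft (\<lambda>z. w (z + (a, 0))) \<zeta> = (\<integral>z. ?f (z - - (a, 0)) \<partial>lborel)"
    unfolding ft_def by (simp only: diff_minus_eq_add add_diff_cancel)
  also have "\<dots> = (\<integral>z. ?f z \<partial>lborel)"
    by (rule integral_translate) measurable
  also have "\<dots> = (\<integral>z. cis (a * fst \<zeta>) * (cis (- (z \<bullet> \<zeta>)) * w z) \<partial>lborel)"
  proof (intro Bochner_Integration.integral_cong refl)
    fix z :: "real \<times> real"
    have "cis (- ((z - (a, 0)) \<bullet> \<zeta>)) = cis (a * fst \<zeta>) * cis (- (z \<bullet> \<zeta>))"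
      by (simp add: cis_mult inner_diff_left inner_prod_def algebra_simps)
    then show "?f z = cis (a * fst \<zeta>) * (cis (- (z \<bullet> \<zeta>)) * w z)" by (simp only: mult.assoc)
  qed
  finally show ?thesis unfolding ft_def by simp
qed

text \<open>The average of the translates by \<open>a\<close> and \<open>- a\<close>.\<close>

lemma cos_multiplier:
  assumes g: "g \<in> schwartz"
  shows "\<exists>v\<in>schwartz. \<forall>\<zeta>. ft v \<zeta> = of_real (cos (a * fst \<zeta>)) * ft g \<zeta>"
proof (intro bexI allI)
  let ?v = "\<lambda>z. (1 / 2) * (g (z + (a, 0)) + g (z + (- a, 0)))"
  show "?v \<in> schwartz" by (intro schwartz_scale schwartz_add schwartz_shift g)
  fix \<zeta> :: "real \<times> real"
  have s: "integrable lborel (\<lambda>z. g (z + (b, 0)))" for b by (intro schwartz_integrable schwartz_shift g)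
  have "ft ?v \<zeta> = (1 / 2) * ft (\<lambda>z. g (z + (a, 0)) + g (z + (- a, 0))) \<zeta>"
    by (rule ft_scale)
  also have "\<dots> = (1 / 2) * (cis (a * fst \<zeta>) * ft g \<zeta> + cis (- a * fst \<zeta>) * ft g \<zeta>)"
    by (simp only: ft_linear(1)[OF s s] ft_shift[OF schwartz_integrable[OF g]])
  also have "\<dots> = (1 / 2) * (cis (a * fst \<zeta>) + cis (- (a * fst \<zeta>))) * ft g \<zeta>"
    by (simp add: algebra_simps)
  also have "(1 / 2) * (cis (a * fst \<zeta>) + cis (- (a * fst \<zeta>))) = of_real (cos (a * fst \<zeta>))"
    by (simp add: complex_eq_iff)
  finally show "ft ?v \<zeta> = of_real (cos (a * fst \<zeta>)) * ft g \<zeta>" .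
qed

lemma cos_polynomial_multiplier:
  assumes "real_polynomial_function p" and "g \<in> schwartz"
  shows "\<exists>v\<in>schwartz. \<forall>\<zeta>. ft v \<zeta> = of_real (p (cos (a * fst \<zeta>))) * ft g \<zeta>"
  using assms
proof (induction arbitrary: g rule: real_polynomial_function.induct)
  case (linear f)
  have f: "f y = y * f 1" for y
    using linear_cmul[OF bounded_linear.linear[OF linear(1)], of y 1] by simp
  obtain v where v: "v \<in> schwartz" "\<And>\<zeta>. ft v \<zeta> = of_real (cos (a * fst \<zeta>)) * ft g \<zeta>"
    using cos_multiplier[OF linear(2)] by blast
  show ?case
  proof (intro bexI allI)
    show "(\<lambda>z. of_real (f 1) * v z) \<in> schwartz" by (intro schwartz_scale v)
    show "ft (\<lambda>z. of_real (f 1) * v z) \<zeta> = of_real (f (cos (a * fst \<zeta>))) * ft g \<zeta>" for \<zeta>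
      by (subst ft_scale, subst f) (simp add: v(2))
  qed
next
  case (const c)
  show ?case
  proof (intro bexI allI)
    show "(\<lambda>z. of_real c * g z) \<in> schwartz" by (intro schwartz_scale const)
    show "ft (\<lambda>z. of_real c * g z) \<zeta> = of_real c * ft g \<zeta>" for \<zeta>
      by (rule ft_scale)
  qed
next
  case (add p q)
  obtain v where v: "v \<in> schwartz" "\<And>\<zeta>. ft v \<zeta> = of_real (p (cos (a * fst \<zeta>))) * ft g \<zeta>" using add by blast
  obtain w where w: "w \<in> schwartz" "\<And>\<zeta>. ft w \<zeta> = of_real (q (cos (a * fst \<zeta>))) * ft g \<zeta>" using add by blast
  show ?case
  proof (intro bexI allI)
    show "(\<lambda>z. v z + w z) \<in> schwartz" by (intro schwartz_add v w)
    show "ft (\<lambda>z. v z + w z) \<zeta> = of_real (p (cos (a * fst \<zeta>)) + q (cos (a * fst \<zeta>))) * ft g \<zeta>" for \<zeta>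
      by (subst ft_linear(1)[OF schwartz_integrable[OF v(1)] schwartz_integrable[OF w(1)]]) (simp add: v(2) w(2) distrib_right)
  qed
next
  case (mult p q)
  obtain v where v: "v \<in> schwartz" "\<And>\<zeta>. ft v \<zeta> = of_real (q (cos (a * fst \<zeta>))) * ft g \<zeta>" using mult by blast
  obtain w where w: "w \<in> schwartz" "\<And>\<zeta>. ft w \<zeta> = of_real (p (cos (a * fst \<zeta>))) * ft v \<zeta>" using mult v(1) by blast
  show ?case by (intro bexI[OF _ w(1)]) (simp add: w(2) v(2))
qed

text \<open>On \<open>[- N, N]\<close> the even function \<open>M\<close> is a continuous function of \<open>cos (\<pi> x / N)\<close>, because \<open>cos\<close> is injective on
  \<open>[0, \<pi>]\<close>. Weierstrass' theorem supplies a polynomial, and its composition with the cosine inherits a global bound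
  by periodicity.\<close>

lemma multiplier_approximation:
  fixes M :: "real \<Rightarrow> real"
  assumes cont: "\<And>x. isCont M x" and even: "\<And>x. M (- x) = M x" and bd: "\<And>x. \<bar>M x\<bar> \<le> 1"
  shows "\<exists>p. real_polynomial_function p \<and> (\<forall>x. \<bar>x\<bar> \<le> real (Suc n) \<longrightarrow> \<bar>p (cos (pi / real (Suc n) * x)) - M x\<bar> < 1 / real (Suc n))
       \<and> (\<forall>x. \<bar>p (cos x)\<bar> \<le> 2)"
proof -
  define N where "N = real (Suc n)"
  have N: "1 \<le> N" by (simp add: N_def)
  \<comment> \<open>\<open>M\<close> expressed through \<open>y = cos (\<pi> x / N)\<close>.\<close>
  define h where "h y = M (N / pi * arccos y)" for y
  have "continuous_on {-1..1} (\<lambda>y. N / pi * arccos y)"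
    by (rule continuous_on_mult[OF continuous_on_const continuous_on_arccos'])
  moreover have "continuous_on UNIV M"
    by (rule continuous_at_imp_continuous_on) (use cont in blast)
  ultimately have "continuous_on {-1..1} h"
    unfolding h_def using continuous_on_compose2[of UNIV M "{-1..1}" "\<lambda>y. N / pi * arccos y"] by blast
  then obtain p where p: "real_polynomial_function p" "\<And>y. y \<in> {-1..1} \<Longrightarrow> \<bar>h y - p y\<bar> < 1 / N"
    using Stone_Weierstrass_real_polynomial_function[of "{-1..1::real}" h "1 / N"] N by auto
  have "\<bar>p (cos (pi / N * x)) - M x\<bar> < 1 / N" if "\<bar>x\<bar> \<le> N" for x
  proof -
    have "cos (pi / N * x) = cos (pi / N * \<bar>x\<bar>)" by (simp add: abs_if)
    moreover have "arccos (cos (pi / N * \<bar>x\<bar>)) = pi / N * \<bar>x\<bar>"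
      using that N by (intro arccos_cos) (auto simp: divide_simps)
    ultimately have "h (cos (pi / N * x)) = M \<bar>x\<bar>" using N by (simp add: h_def)
    also have "M \<bar>x\<bar> = M x" using even by (simp add: abs_if)
    finally show ?thesis using p(2)[of "cos (pi / N * x)"] by (simp add: abs_minus_commute)
  qed
  moreover have "\<bar>p (cos x)\<bar> \<le> 2" for x
  proof -
    have "\<bar>h (cos x) - p (cos x)\<bar> < 1 / N" by (rule p(2)) simp
    moreover have "\<bar>h (cos x)\<bar> \<le> 1" unfolding h_def by (rule bd)
    moreover have "1 / N \<le> 1" using N by simp
    ultimately show ?thesis by linarith
  qed
  ultimately show ?thesis using p(1) unfolding N_def by blast
qed

definition phi_multiplier :: "real \<Rightarrow> real \<Rightarrow> real" where
  "phi_multiplier k x = x\<^sup>2 / phi k x"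

lemma phi_multiplier_props:
  assumes k: "\<bar>k\<bar> \<le> 1"
  shows "isCont (phi_multiplier k) x" "phi_multiplier k (- x) = phi_multiplier k x"
    "\<bar>phi_multiplier k x\<bar> \<le> 1" "0 \<le> phi_multiplier k x"
proof -
  let ?M = "phi_multiplier k"
  note M_def = phi_multiplier_def
  have M: "?M = (\<lambda>x. \<bar>x\<bar> * symbol_factor k x * (1 + x\<^sup>2))"
  proof
    fix x
    have "complex_of_real (?M x) = complex_of_real (\<bar>x\<bar> * symbol_factor k x * (1 + x\<^sup>2))"
      unfolding M_def even_symbol_mult[OF k, symmetric] even_symbol_def of_real_mult ..
    then show "?M x = \<bar>x\<bar> * symbol_factor k x * (1 + x\<^sup>2)" by (simp only: of_real_eq_iff)
  qed
  show "isCont ?M x" unfolding M by (intro continuous_intros DERIV_isCont[OF symbol_factor_deriv[OF k]])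
  show "?M (- x) = ?M x" by (simp add: M_def)
  show p: "0 \<le> ?M x" using phi_nonneg[OF k, of x] by (simp add: M_def)
  have "?M x \<le> 2 * \<bar>x\<bar> / (jbracket x)\<^sup>2" unfolding M_def by (rule sq_div_phi_le[OF k])
  also have "\<dots> \<le> 1"
  proof -
    have "2 * \<bar>x\<bar> \<le> 1 + x\<^sup>2" using zero_le_power2[of "\<bar>x\<bar> - 1"] by (simp add: power2_eq_square algebra_simps)
    then show ?thesis unfolding jbracket_sq using one_plus_sq_pos[of x] by (simp add: divide_le_eq)
  qed
  finally show "\<bar>?M x\<bar> \<le> 1" using p by simp
qed

lemma phi_op_X_fun:
  assumes k: "\<bar>k\<bar> \<le> 1" and g: "g \<in> schwartz"
  shows "phi_op k g \<in> X_fun k s b"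
proof -
  have "rapid (ft (phi_op k g))"
    by (rule rapid_dominated[OF rapid_ft[OF g], of _ 1])
      (simp_all only: phi_op_props(2)[OF k g] phi_multiplier_def[symmetric] norm_mult norm_minus_cancel norm_of_real mult_right_mono norm_ge_zero phi_multiplier_props(3)[OF k] zero_le_one)
  then show ?thesis
    unfolding X_fun_def fourier_eq_ft
    by (intro CollectI conjI phi_op_props(1)[OF k g] rapid_X_integrable[OF k] ft_measurable)
qed

text \<open>The approximants have bounded multipliers that converge pointwise, and the transform of \<open>g\<close> lies in the weighted
  \<open>L\<^sup>2\<close> space, so dominated convergence applies. This shows that \<open>phi_op k g\<close> represents an element of the completion,
  although the operator does not preserve the Schwartz class.\<close>

lemma phi_op_density:
  assumes k: "\<bar>k\<bar> \<le> 1" and g: "g \<in> schwartz" and e: "0 < e"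
  shows "\<exists>v\<in>schwartz. X_norm k s b (\<lambda>z. v z - phi_op k g z) < e"
proof -
  let ?M = "phi_multiplier k"
  note Mm = phi_multiplier_props[OF k]
  obtain p where p: "\<And>n. real_polynomial_function (p n)"
     "\<And>n x. \<bar>x\<bar> \<le> real (Suc n) \<Longrightarrow> \<bar>p n (cos (pi / real (Suc n) * x)) - ?M x\<bar> < 1 / real (Suc n)"
     "\<And>n x. \<bar>p n (cos x)\<bar> \<le> 2"
    using multiplier_approximation[of ?M, OF Mm(1-3)] by metis
  have gm: "(\<lambda>z. - g z) \<in> schwartz" using schwartz_scale[OF g, of "-1"] by (simp only: mult_minus1)
  have ftgm: "ft (\<lambda>z. - g z) \<zeta> = - ft g \<zeta>" for \<zeta>
  proof -
    have "ft (\<lambda>z. (-1) * g z) \<zeta> = (-1) * ft g \<zeta>"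
      by (rule ft_scale)
    then show ?thesis by (simp only: mult_minus1)
  qed
  obtain V where V: "\<And>n. V n \<in> schwartz" "\<And>n \<zeta>. ft (V n) \<zeta> = of_real (p n (cos (pi / real (Suc n) * fst \<zeta>))) * ft (\<lambda>z. - g z) \<zeta>"
  proof -
    have "\<forall>n. \<exists>v. v \<in> schwartz \<and> (\<forall>\<zeta>. ft v \<zeta> = of_real (p n (cos (pi / real (Suc n) * fst \<zeta>))) * ft (\<lambda>z. - g z) \<zeta>)"
      using cos_polynomial_multiplier[OF p(1) gm] by (simp only: Bex_def) blast
    from choice[OF this] show ?thesis using that by blast
  qed
  define P where "P n x = p n (cos (pi / real (Suc n) * x))" for n x
  have diff: "fourier (\<lambda>z. V n z - phi_op k g z) \<zeta> = of_real (?M (fst \<zeta>) - P n (fst \<zeta>)) * ft g \<zeta>" for n \<zeta>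
    unfolding fourier_eq_ft ft_linear(2)[OF schwartz_integrable[OF V(1)] phi_op_props(1)[OF k g]] V(2) ftgm phi_op_props(2)[OF k g]
    by (simp add: P_def phi_multiplier_def algebra_simps)
  let ?w = "\<lambda>\<zeta>. (X_weight k s b \<zeta> * norm (ft g \<zeta>))\<^sup>2"
  let ?F = "\<lambda>n \<zeta>. (X_weight k s b \<zeta> * norm (fourier (\<lambda>z. V n z - phi_op k g z) \<zeta>))\<^sup>2"
  have F: "?F n \<zeta> = (?M (fst \<zeta>) - P n (fst \<zeta>))\<^sup>2 * ?w \<zeta>" for n \<zeta>
    unfolding diff by (simp add: norm_mult power_mult_distrib mult_ac del: of_real_diff)
  have "(\<lambda>n. \<integral>\<zeta>. ?F n \<zeta> \<partial>lborel) \<longlonglongrightarrow> (\<integral>\<zeta>. 0 \<partial>(lborel :: (real \<times> real) measure))"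
  proof (rule integral_dominated_convergence[where w="\<lambda>\<zeta>. 9 * ?w \<zeta>"])
    have "fourier (\<lambda>z. V n z - phi_op k g z) \<in> borel_measurable borel" for n
      unfolding fourier_eq_ft
      by (intro ft_measurable Bochner_Integration.integrable_diff schwartz_integrable V phi_op_props k g)
    then show "?F n \<in> borel_measurable lborel" for n by measurable
    show "integrable lborel (\<lambda>\<zeta>. 9 * ?w \<zeta>)"
      by (intro integrable_mult_right rapid_X_integrable k rapid_ft g schwartz_ft_measurable)
    have le: "(?M x - P n x)\<^sup>2 \<le> 9" for n x
    proof -
      have "\<bar>?M x - P n x\<bar> \<le> 3" using Mm(3)[of x] p(3)[of n "pi / real (Suc n) * x"] unfolding P_def by linarith
      then have "\<bar>?M x - P n x\<bar>\<^sup>2 \<le> 3\<^sup>2" by (intro power_mono) auto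
      then show ?thesis by simp
    qed
    show "AE \<zeta> in lborel. norm (?F n \<zeta>) \<le> 9 * ?w \<zeta>" for n
      unfolding F by (intro AE_I2) (simp add: mult_right_mono le)
    show "AE \<zeta> in lborel. (\<lambda>n. ?F n \<zeta>) \<longlonglongrightarrow> 0"
      unfolding F
    proof (intro AE_I2 tendsto_mult_left_zero)
      fix \<zeta> :: "real \<times> real"
      have "(\<lambda>n. ?M (fst \<zeta>) - P n (fst \<zeta>)) \<longlonglongrightarrow> 0"
      proof (rule Lim_null_comparison)
        obtain n0 where n0: "\<bar>fst \<zeta>\<bar> \<le> real n0" using real_arch_simple by blast
        have "norm (?M (fst \<zeta>) - P n (fst \<zeta>)) \<le> inverse (real (Suc n))" if "n0 \<le> n" for n
          using p(2)[of "fst \<zeta>" n] n0 that by (simp add: P_def abs_minus_commute inverse_eq_divide)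
        then show "\<forall>\<^sub>F n in sequentially. norm (?M (fst \<zeta>) - P n (fst \<zeta>)) \<le> inverse (real (Suc n))"
          unfolding eventually_sequentially by blast
        show "(\<lambda>n. inverse (real (Suc n))) \<longlonglongrightarrow> 0" by (rule LIMSEQ_inverse_real_of_nat)
      qed
      then have "(\<lambda>n. (?M (fst \<zeta>) - P n (fst \<zeta>))\<^sup>2) \<longlonglongrightarrow> 0\<^sup>2" by (rule tendsto_power)
      then show "(\<lambda>n. (?M (fst \<zeta>) - P n (fst \<zeta>))\<^sup>2) \<longlonglongrightarrow> 0" by simp
    qed
  qed simp
  then have "(\<lambda>n. sqrt (\<integral>\<zeta>. ?F n \<zeta> \<partial>lborel)) \<longlonglongrightarrow> sqrt 0" by (intro tendsto_real_sqrt) simp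
  then have "(\<lambda>n. X_norm k s b (\<lambda>z. V n z - phi_op k g z)) \<longlonglongrightarrow> 0" unfolding X_norm_def by simp
  from order_tendstoD(2)[OF this e] obtain n where "X_norm k s b (\<lambda>z. V n z - phi_op k g z) < e"
    unfolding eventually_sequentially by blast
  then show ?thesis using V(1) by blast
qed

section \<open>The completion as a metric space\<close>

definition X_dist :: "real \<Rightarrow> real \<Rightarrow> real \<Rightarrow> (real \<times> real \<Rightarrow> complex) \<Rightarrow> (real \<times> real \<Rightarrow> complex) \<Rightarrow> real" where
  "X_dist k s b u v = X_norm k s b (\<lambda>z. u z - v z)"

lemma X_norm_nonneg [simp]: "0 \<le> X_norm k s b u"
  by (simp add: X_norm_def)

lemma X_dist_nonneg [simp]: "0 \<le> X_dist k s b u v"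
  by (simp add: X_dist_def)

lemma X_norm_sq: "(X_norm k s b u)\<^sup>2 = (\<integral>\<zeta>. (X_weight k s b \<zeta> * norm (fourier u \<zeta>))\<^sup>2 \<partial>lborel)"
  by (simp add: X_norm_def)

lemma X_funD:
  assumes "u \<in> X_fun k s b"
  shows "integrable lborel u" "integrable lborel (\<lambda>\<zeta>. (X_weight k s b \<zeta> * norm (fourier u \<zeta>))\<^sup>2)"
    "fourier u \<in> borel_measurable borel"
  using assms unfolding X_fun_def fourier_eq_ft by (auto intro: ft_measurable)

lemma X_nn_eq_X_norm:
  assumes "u \<in> X_fun k s b"
  shows "X_nn k s b (\<lambda>\<zeta>. ennreal (norm (fourier u \<zeta>))) = ennreal ((X_norm k s b u)\<^sup>2)"
proof -
  have "X_nn k s b (\<lambda>\<zeta>. ennreal (norm (fourier u \<zeta>))) = (\<integral>\<^sup>+\<zeta>. ennreal ((X_weight k s b \<zeta> * norm (fourier u \<zeta>))\<^sup>2) \<partial>lborel)"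
    unfolding X_nn_def by (simp add: ennreal_mult[symmetric] ennreal_power)
  also have "\<dots> = ennreal (\<integral>\<zeta>. (X_weight k s b \<zeta> * norm (fourier u \<zeta>))\<^sup>2 \<partial>lborel)"
    by (rule nn_integral_eq_integral[OF X_funD(2)[OF assms]]) simp
  finally show ?thesis by (simp add: X_norm_sq)
qed

text \<open>Minkowski's inequality from the pointwise bound \<open>(a + b)\<^sup>2 \<le> (1 + t) a\<^sup>2 + (1 + 1/t) b\<^sup>2\<close>; the optimal \<open>t\<close> is the
  quotient of the two norms.\<close>

lemma X_norm_triangle:
  assumes u: "u \<in> X_fun k s b" and v: "v \<in> X_fun k s b"
  shows "(\<lambda>z. u z + v z) \<in> X_fun k s b" "X_norm k s b (\<lambda>z. u z + v z) \<le> X_norm k s b u + X_norm k s b v"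
proof -
  let ?w = "X_weight k s b"
  let ?A = "X_norm k s b u" and ?B = "X_norm k s b v"
  have i: "integrable lborel (\<lambda>z. u z + v z)" by (intro Bochner_Integration.integrable_add X_funD(1)[OF u] X_funD(1)[OF v])
  have f: "fourier (\<lambda>z. u z + v z) \<zeta> = fourier u \<zeta> + fourier v \<zeta>" for \<zeta>
    unfolding fourier_eq_ft by (rule ft_linear(1)[OF X_funD(1)[OF u] X_funD(1)[OF v]])
  note [measurable] = X_funD(3)[OF u] X_funD(3)[OF v]
  have pt: "(?w \<zeta> * norm (fourier u \<zeta> + fourier v \<zeta>))\<^sup>2 \<le> (1 + t) * (?w \<zeta> * norm (fourier u \<zeta>))\<^sup>2 + (1 + 1 / t) * (?w \<zeta> * norm (fourier v \<zeta>))\<^sup>2"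
    if t: "0 < t" for t \<zeta>
  proof -
    let ?a = "?w \<zeta> * norm (fourier u \<zeta>)" and ?b = "?w \<zeta> * norm (fourier v \<zeta>)"
    have "?w \<zeta> * norm (fourier u \<zeta> + fourier v \<zeta>) \<le> ?a + ?b"
      using mult_left_mono[OF norm_triangle_ineq X_weight_nonneg] by (simp add: distrib_left)
    then have "(?w \<zeta> * norm (fourier u \<zeta> + fourier v \<zeta>))\<^sup>2 \<le> (?a + ?b)\<^sup>2" by (intro power_mono) auto
    also have "\<dots> = (1 + t) * ?a\<^sup>2 + (1 + 1 / t) * ?b\<^sup>2 - (t * ?a - ?b)\<^sup>2 / t"
      using t by (simp add: field_simps power2_eq_square)
    also have "\<dots> \<le> (1 + t) * ?a\<^sup>2 + (1 + 1 / t) * ?b\<^sup>2" using t by simp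
    finally show ?thesis .
  qed
  have dom: "integrable lborel (\<lambda>\<zeta>. (1 + t) * (?w \<zeta> * norm (fourier u \<zeta>))\<^sup>2 + (1 + 1 / t) * (?w \<zeta> * norm (fourier v \<zeta>))\<^sup>2)" for t
    by (intro Bochner_Integration.integrable_add integrable_mult_right X_funD(2)[OF u] X_funD(2)[OF v])
  have I: "integrable lborel (\<lambda>\<zeta>. (?w \<zeta> * norm (fourier u \<zeta> + fourier v \<zeta>))\<^sup>2)"
  proof (rule Bochner_Integration.integrable_bound[OF dom[of 1]])
    show "AE \<zeta> in lborel. norm ((?w \<zeta> * norm (fourier u \<zeta> + fourier v \<zeta>))\<^sup>2) \<le>
       norm ((1 + 1) * (?w \<zeta> * norm (fourier u \<zeta>))\<^sup>2 + (1 + 1 / 1) * (?w \<zeta> * norm (fourier v \<zeta>))\<^sup>2)"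
      using pt[of 1] by (intro AE_I2) (auto intro: order_trans[OF _ abs_ge_self])
  qed measurable
  show "(\<lambda>z. u z + v z) \<in> X_fun k s b" using i I by (simp add: X_fun_def f)
  show "X_norm k s b (\<lambda>z. u z + v z) \<le> ?A + ?B"
  proof (rule field_le_epsilon)
    fix e :: real assume e: "0 < e"
    \<comment> \<open>The norms may vanish, so they are enlarged before their quotient is formed.\<close>
    define A B where "A = ?A + e / 2" and "B = ?B + e / 2"
    have AB: "0 < A" "0 < B" "?A \<le> A" "?B \<le> B" using e by (auto simp: A_def B_def add_nonneg_pos)
    define t where "t = B / A"
    have t: "0 < t" using AB by (simp add: t_def)
    have "(X_norm k s b (\<lambda>z. u z + v z))\<^sup>2 \<le> (\<integral>\<zeta>. (1 + t) * (?w \<zeta> * norm (fourier u \<zeta>))\<^sup>2 + (1 + 1 / t) * (?w \<zeta> * norm (fourier v \<zeta>))\<^sup>2 \<partial>lborel)"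
      unfolding X_norm_sq f by (intro integral_mono I dom pt t)
    also have "\<dots> = (1 + t) * ?A\<^sup>2 + (1 + 1 / t) * ?B\<^sup>2"
      unfolding X_norm_sq by (subst Bochner_Integration.integral_add) (auto intro!: integrable_mult_right X_funD(2)[OF u] X_funD(2)[OF v])
    also have "\<dots> \<le> (1 + t) * A\<^sup>2 + (1 + 1 / t) * B\<^sup>2"
      using t AB by (intro add_mono mult_left_mono power_mono) auto
    also have "\<dots> = (A + B)\<^sup>2" using AB by (simp add: t_def field_simps power2_eq_square)
    finally have "X_norm k s b (\<lambda>z. u z + v z) \<le> A + B" by (rule power2_le_imp_le) (use AB in auto)
    then show "X_norm k s b (\<lambda>z. u z + v z) \<le> ?A + ?B + e" by (simp add: A_def B_def)
  qed
qed

lemma X_fun_uminus: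
  assumes u: "u \<in> X_fun k s b"
  shows "(\<lambda>z. - u z) \<in> X_fun k s b" "X_norm k s b (\<lambda>z. - u z) = X_norm k s b u"
proof -
  have f: "fourier (\<lambda>z. - u z) \<zeta> = - fourier u \<zeta>" for \<zeta>
  proof -
    have "ft (\<lambda>z. (-1) * u z) \<zeta> = (-1) * ft u \<zeta>" by (rule ft_scale)
    then show ?thesis unfolding fourier_eq_ft by (simp only: mult_minus1)
  qed
  show "X_norm k s b (\<lambda>z. - u z) = X_norm k s b u" unfolding X_norm_def f norm_minus_cancel ..
  show "(\<lambda>z. - u z) \<in> X_fun k s b"
    using X_funD[OF u] by (simp add: X_fun_def f)
qed

lemma X_fun_diff: "u \<in> X_fun k s b \<Longrightarrow> v \<in> X_fun k s b \<Longrightarrow> (\<lambda>z. u z - v z) \<in> X_fun k s b"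
  using X_norm_triangle(1)[OF _ X_fun_uminus(1), of u k s b v] by simp

lemma X_norm_0 [simp]: "X_norm k s b (\<lambda>_. 0) = 0"
  by (simp add: X_norm_def fourier_eq_ft ft_def)

lemma X_dist_refl [simp]: "X_dist k s b u u = 0"
  by (simp add: X_dist_def)

lemma X_dist_0 [simp]: "X_dist k s b u (\<lambda>_. 0) = X_norm k s b u"
  by (simp add: X_dist_def)

lemma X_dist_commute: "u \<in> X_fun k s b \<Longrightarrow> v \<in> X_fun k s b \<Longrightarrow> X_dist k s b u v = X_dist k s b v u"
  using X_fun_uminus(2)[OF X_fun_diff, of u k s b v] by (simp add: X_dist_def)

lemma X_dist_triangle:
  assumes "u \<in> X_fun k s b" "v \<in> X_fun k s b" "w \<in> X_fun k s b"
  shows "X_dist k s b u w \<le> X_dist k s b u v + X_dist k s b v w"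
  using X_norm_triangle(2)[OF X_fun_diff[OF assms(1,2)] X_fun_diff[OF assms(2,3)]] by (simp add: X_dist_def)

text \<open>The form of the triangle inequality from which convergence of distances along Cauchy sequences, and independence of
  the representatives, are immediate.\<close>

lemma X_dist_quadrilateral:
  assumes "u \<in> X_fun k s b" "v \<in> X_fun k s b" "u' \<in> X_fun k s b" "v' \<in> X_fun k s b"
  shows "\<bar>X_dist k s b u v - X_dist k s b u' v'\<bar> \<le> X_dist k s b u u' + X_dist k s b v v'"
proof -
  have "X_dist k s b u v \<le> X_dist k s b u u' + (X_dist k s b u' v' + X_dist k s b v' v)"
    using X_dist_triangle[OF assms(1,3,2)] X_dist_triangle[OF assms(3,4,2)] by linarith
  moreover have "X_dist k s b u' v' \<le> X_dist k s b u' u + (X_dist k s b u v + X_dist k s b v v')"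
    using X_dist_triangle[OF assms(3,1,4)] X_dist_triangle[OF assms(1,2,4)] by linarith
  ultimately show ?thesis
    using X_dist_commute[OF assms(1,3)] X_dist_commute[OF assms(2,4)] by linarith
qed

lemma X_cauchy_iff: "u \<in> X_cauchy k s b \<longleftrightarrow> (\<forall>n. u n \<in> schwartz) \<and> (\<forall>e>0. \<exists>N. \<forall>m\<ge>N. \<forall>n\<ge>N. X_dist k s b (u m) (u n) < e)"
  by (simp add: X_cauchy_def X_dist_def)

lemma X_rel_iff: "(u, v) \<in> X_rel k s b \<longleftrightarrow> u \<in> X_cauchy k s b \<and> v \<in> X_cauchy k s b \<and> (\<lambda>n. X_dist k s b (u n) (v n)) \<longlonglongrightarrow> 0"
  by (simp add: X_rel_def X_dist_def)

lemma schwartz_zero: "(\<lambda>_. 0) \<in> schwartz"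
proof -
  have d: "dx (\<lambda>_. 0) = (\<lambda>_. 0)" "dt (\<lambda>_. 0) = (\<lambda>_. 0)"
    by (auto intro!: dx_eqI dt_eqI)
  have "rapid (\<lambda>_. 0)" unfolding rapid_def by auto
  then show ?thesis
    by (intro schwartz_coinduct[of "\<lambda>v. v = (\<lambda>_. 0)"]) (auto simp: d)
qed

lemma X_cauchy_const: "u \<in> schwartz \<Longrightarrow> (\<lambda>_. u) \<in> X_cauchy k s b"
  by (simp add: X_cauchy_iff)

context
  fixes k s b :: real
  assumes k: "\<bar>k\<bar> \<le> 1"
begin

lemma X_cauchy_X_fun: "u \<in> X_cauchy k s b \<Longrightarrow> u n \<in> X_fun k s b"
  unfolding X_cauchy_iff by (intro schwartz_X_fun k) blast

lemma X_dist_convergent: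
  assumes u: "u \<in> X_cauchy k s b" and v: "v \<in> X_cauchy k s b"
  shows "convergent (\<lambda>n. X_dist k s b (u n) (v n))"
proof (rule Cauchy_convergent, unfold Cauchy_def, intro allI impI)
  fix e :: real assume "0 < e"
  then have e: "0 < e / 2" by simp
  obtain N1 where N1: "\<forall>m\<ge>N1. \<forall>n\<ge>N1. X_dist k s b (u m) (u n) < e / 2" using u e unfolding X_cauchy_iff by blast
  obtain N2 where N2: "\<forall>m\<ge>N2. \<forall>n\<ge>N2. X_dist k s b (v m) (v n) < e / 2" using v e unfolding X_cauchy_iff by blast
  have "dist (X_dist k s b (u m) (v m)) (X_dist k s b (u n) (v n)) < e" if "m \<ge> max N1 N2" "n \<ge> max N1 N2" for m n
  proof -
    have "X_dist k s b (u m) (u n) < e / 2" "X_dist k s b (v m) (v n) < e / 2" using N1 N2 that by auto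
    then show ?thesis
      using X_dist_quadrilateral[of "u m" k s b "v m" "u n" "v n"] X_cauchy_X_fun[OF u] X_cauchy_X_fun[OF v]
      unfolding dist_real_def by force
  qed
  then show "\<exists>M. \<forall>m\<ge>M. \<forall>n\<ge>M. dist (X_dist k s b (u m) (v m)) (X_dist k s b (u n) (v n)) < e" by blast
qed

lemma X_rel_limit:
  assumes u: "(u, u') \<in> X_rel k s b" and v: "(v, v') \<in> X_rel k s b" and r: "(\<lambda>n. X_dist k s b (u n) (v n)) \<longlonglongrightarrow> r"
  shows "(\<lambda>n. X_dist k s b (u' n) (v' n)) \<longlonglongrightarrow> r"
proof -
  have "(\<lambda>n. X_dist k s b (u' n) (v' n) - X_dist k s b (u n) (v n)) \<longlonglongrightarrow> 0"
  proof (rule Lim_null_comparison)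
    show "\<forall>\<^sub>F n in sequentially. norm (X_dist k s b (u' n) (v' n) - X_dist k s b (u n) (v n)) \<le> X_dist k s b (u n) (u' n) + X_dist k s b (v n) (v' n)"
    proof (intro always_eventually allI)
      fix n
      have "u n \<in> X_fun k s b" "u' n \<in> X_fun k s b" "v n \<in> X_fun k s b" "v' n \<in> X_fun k s b"
        using u v unfolding X_rel_iff by (auto intro: X_cauchy_X_fun)
      then show "norm (X_dist k s b (u' n) (v' n) - X_dist k s b (u n) (v n)) \<le> X_dist k s b (u n) (u' n) + X_dist k s b (v n) (v' n)"
        using X_dist_quadrilateral[of "u n" k s b "v n" "u' n" "v' n"] by (simp add: abs_minus_commute)
    qed
    have "(\<lambda>n. X_dist k s b (u n) (u' n) + X_dist k s b (v n) (v' n)) \<longlonglongrightarrow> 0 + 0"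
      using u v unfolding X_rel_iff by (intro tendsto_add) auto
    then show "(\<lambda>n. X_dist k s b (u n) (u' n) + X_dist k s b (v n) (v' n)) \<longlonglongrightarrow> 0" by simp
  qed
  from tendsto_add[OF this r] show ?thesis by simp
qed

lemma X_rel_equiv: "equiv (X_cauchy k s b) (X_rel k s b)"
proof (rule equivI)
  have sym: "(v, u) \<in> X_rel k s b" if "(u, v) \<in> X_rel k s b" for u v
  proof -
    have "X_dist k s b (u n) (v n) = X_dist k s b (v n) (u n)" for n
      using that unfolding X_rel_iff by (intro X_dist_commute X_cauchy_X_fun) auto
    then show ?thesis using that unfolding X_rel_iff by simp
  qed
  show "X_rel k s b \<subseteq> X_cauchy k s b \<times> X_cauchy k s b" by (auto simp: X_rel_iff)
  show "refl_on (X_cauchy k s b) (X_rel k s b)" by (rule refl_onI) (auto simp: X_rel_iff)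
  show "sym (X_rel k s b)" using sym by (rule symI)
  show "trans (X_rel k s b)"
  proof (rule transI)
    fix u v w assume uv: "(u, v) \<in> X_rel k s b" and vw: "(v, w) \<in> X_rel k s b"
    have "(u, u) \<in> X_rel k s b" using uv by (simp add: X_rel_iff)
    from X_rel_limit[OF this vw] have "(\<lambda>n. X_dist k s b (u n) (w n)) \<longlonglongrightarrow> 0" using uv by (simp add: X_rel_iff)
    then show "(u, w) \<in> X_rel k s b" using uv vw by (simp add: X_rel_iff)
  qed
qed

lemma X_space_cases:
  assumes "U \<in> X_space k s b"
  obtains u where "u \<in> X_cauchy k s b" "u \<in> U" "U = X_rel k s b `` {u}"
proof -
  obtain u where u: "U = X_rel k s b `` {u}" "u \<in> X_cauchy k s b"
    using assms unfolding X_space_def by (rule quotientE)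
  from equiv_class_self[OF X_rel_equiv u(2)] u show ?thesis by (intro that) auto
qed

lemma X_space_memD:
  assumes "U \<in> X_space k s b" "u \<in> U"
  shows "u \<in> X_cauchy k s b" "U = X_rel k s b `` {u}"
proof -
  obtain v where v: "v \<in> X_cauchy k s b" "U = X_rel k s b `` {v}" using X_space_cases[OF assms(1)] by blast
  then have "(v, u) \<in> X_rel k s b" using assms(2) by simp
  then show "u \<in> X_cauchy k s b" "U = X_rel k s b `` {u}"
    using v(2) equiv_class_eq[OF X_rel_equiv] by (auto simp: X_rel_iff)
qed

lemma X_class_in_space: "u \<in> X_cauchy k s b \<Longrightarrow> X_rel k s b `` {u} \<in> X_space k s b"
  unfolding X_space_def by (rule quotientI)

text \<open>Distances in the completion can be computed along any representatives, which resolves the definite description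
  in their definition.\<close>

lemma X_space_dist_limit:
  assumes U: "U \<in> X_space k s b" "u \<in> U" and V: "V \<in> X_space k s b" "v \<in> V"
  shows "(\<lambda>n. X_dist k s b (u n) (v n)) \<longlonglongrightarrow> X_space_dist k s b U V"
proof -
  note u = X_space_memD[OF U] and v = X_space_memD[OF V]
  obtain r where r: "(\<lambda>n. X_dist k s b (u n) (v n)) \<longlonglongrightarrow> r"
    using X_dist_convergent[OF u(1) v(1)] by (auto simp: convergent_def)
  have all: "\<forall>u'\<in>U. \<forall>v'\<in>V. (\<lambda>n. X_norm k s b (\<lambda>z. u' n z - v' n z)) \<longlonglongrightarrow> r"
    unfolding X_dist_def[symmetric] using u(2) v(2) by (auto intro: X_rel_limit[OF _ _ r])
  have "(THE r. \<forall>u'\<in>U. \<forall>v'\<in>V. (\<lambda>n. X_norm k s b (\<lambda>z. u' n z - v' n z)) \<longlonglongrightarrow> r) = r"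
  proof (rule the_equality, rule all)
    fix r' assume "\<forall>u'\<in>U. \<forall>v'\<in>V. (\<lambda>n. X_norm k s b (\<lambda>z. u' n z - v' n z)) \<longlonglongrightarrow> r'"
    then have "(\<lambda>n. X_dist k s b (u n) (v n)) \<longlonglongrightarrow> r'" using U(2) V(2) unfolding X_dist_def by blast
    then show "r' = r" using r by (rule LIMSEQ_unique)
  qed
  then show ?thesis using r U(1) V(1) by (simp add: X_space_dist_def)
qed

text \<open>The norm is the distance from the class of the zero sequence.\<close>

lemma X_space_norm_limit:
  assumes U: "U \<in> X_space k s b" "u \<in> U"
  shows "(\<lambda>n. X_norm k s b (u n)) \<longlonglongrightarrow> X_space_norm k s b U"
proof -
  note u = X_space_memD[OF U]
  let ?z = "\<lambda>_::nat. \<lambda>_::real \<times> real. 0::complex"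
  have z: "(?z, ?z) \<in> X_rel k s b" by (simp add: X_rel_iff X_cauchy_const schwartz_zero)
  obtain r where r: "(\<lambda>n. X_dist k s b (u n) (?z n)) \<longlonglongrightarrow> r"
    using X_dist_convergent[OF u(1), of ?z] X_cauchy_const[OF schwartz_zero] by (auto simp: convergent_def)
  have all: "\<forall>u'\<in>U. (\<lambda>n. X_norm k s b (u' n)) \<longlonglongrightarrow> r"
    using u(2) X_rel_limit[OF _ z r] by auto
  have "(THE r. \<forall>u'\<in>U. (\<lambda>n. X_norm k s b (u' n)) \<longlonglongrightarrow> r) = r"
  proof (rule the_equality, rule all)
    fix r' assume "\<forall>u'\<in>U. (\<lambda>n. X_norm k s b (u' n)) \<longlonglongrightarrow> r'"
    then have "(\<lambda>n. X_dist k s b (u n) (?z n)) \<longlonglongrightarrow> r'" using U(2) by simp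
    then show "r' = r" using r by (rule LIMSEQ_unique)
  qed
  then show ?thesis using r by (simp add: X_space_norm_def)
qed

lemma X_metric_space: "Metric_space (X_space k s b) (X_space_dist k s b)"
proof
  fix U V
  show "0 \<le> X_space_dist k s b U V"
  proof (cases "U \<in> X_space k s b \<and> V \<in> X_space k s b")
    case True
    then obtain u v where uv: "u \<in> U" "v \<in> V" using X_space_cases by metis
    show ?thesis
      by (rule LIMSEQ_le_const[OF X_space_dist_limit[of U u V v]]) (use True uv in auto)
  qed (auto simp: X_space_dist_def)
  show "X_space_dist k s b U V = X_space_dist k s b V U"
  proof (cases "U \<in> X_space k s b \<and> V \<in> X_space k s b")
    case True
    then obtain u v where uv: "u \<in> U" "v \<in> V" using X_space_cases by metis
    have "X_dist k s b (u n) (v n) = X_dist k s b (v n) (u n)" for n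
      using True uv by (intro X_dist_commute X_cauchy_X_fun X_space_memD) auto
    then show ?thesis
      using X_space_dist_limit[of U u V v] X_space_dist_limit[of V v U u] True uv by (auto intro: LIMSEQ_unique)
  qed (auto simp: X_space_dist_def)
next
  fix U V assume U: "U \<in> X_space k s b" and V: "V \<in> X_space k s b"
  obtain u where u: "u \<in> U" using X_space_cases[OF U] by blast
  obtain v where v: "v \<in> V" using X_space_cases[OF V] by blast
  note L = X_space_dist_limit[OF U u V v]
  show "X_space_dist k s b U V = 0 \<longleftrightarrow> U = V"
  proof
    assume "X_space_dist k s b U V = 0"
    then have "(u, v) \<in> X_rel k s b" using L X_space_memD[OF U u] X_space_memD[OF V v] by (simp add: X_rel_iff)
    then show "U = V" using X_space_memD(2)[OF U u] X_space_memD(2)[OF V v] equiv_class_eq[OF X_rel_equiv] by simp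
  next
    assume "U = V"
    then show "X_space_dist k s b U V = 0"
      using X_space_dist_limit[OF U u U u] by (simp add: LIMSEQ_const_iff)
  qed
next
  fix U V W assume U: "U \<in> X_space k s b" and V: "V \<in> X_space k s b" and W: "W \<in> X_space k s b"
  obtain u where u: "u \<in> U" using X_space_cases[OF U] by blast
  obtain v where v: "v \<in> V" using X_space_cases[OF V] by blast
  obtain w where w: "w \<in> W" using X_space_cases[OF W] by blast
  show "X_space_dist k s b U W \<le> X_space_dist k s b U V + X_space_dist k s b V W"
  proof (rule LIMSEQ_le[OF X_space_dist_limit[OF U u W w] tendsto_add[OF X_space_dist_limit[OF U u V v] X_space_dist_limit[OF V v W w]]])
    show "\<exists>N. \<forall>n\<ge>N. X_dist k s b (u n) (w n) \<le> X_dist k s b (u n) (v n) + X_dist k s b (v n) (w n)"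
      using X_cauchy_X_fun X_space_memD(1)[OF U u] X_space_memD(1)[OF V v] X_space_memD(1)[OF W w]
      by (intro exI[of _ 0] allI impI X_dist_triangle) auto
  qed
qed

lemma X_space_norm_nonneg: "U \<in> X_space k s b \<Longrightarrow> 0 \<le> X_space_norm k s b U"
proof -
  assume U: "U \<in> X_space k s b"
  then obtain u where u: "u \<in> U" using X_space_cases by metis
  show ?thesis by (rule LIMSEQ_le_const[OF X_space_norm_limit[OF U u]]) auto
qed

lemma X_space_norm_le_dist:
  assumes U: "U \<in> X_space k s b" and V: "V \<in> X_space k s b"
  shows "X_space_norm k s b V \<le> X_space_norm k s b U + X_space_dist k s b U V"
proof -
  obtain u where u: "u \<in> U" using X_space_cases[OF U] by blast
  obtain v where v: "v \<in> V" using X_space_cases[OF V] by blast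
  show ?thesis
  proof (rule LIMSEQ_le[OF X_space_norm_limit[OF V v] tendsto_add[OF X_space_norm_limit[OF U u] X_space_dist_limit[OF U u V v]]])
    have "X_norm k s b (v n) \<le> X_norm k s b (u n) + X_dist k s b (u n) (v n)" for n
    proof -
      have f: "v n \<in> X_fun k s b" "u n \<in> X_fun k s b" "(\<lambda>_. 0) \<in> X_fun k s b"
        using X_cauchy_X_fun X_space_memD(1)[OF U u] X_space_memD(1)[OF V v] by (auto intro: schwartz_X_fun[OF k schwartz_zero])
      show ?thesis using X_dist_triangle[OF f] X_dist_commute[OF f(1,2)] by simp
    qed
    then show "\<exists>N. \<forall>n\<ge>N. X_norm k s b (v n) \<le> X_norm k s b (u n) + X_dist k s b (u n) (v n)" by blast
  qed
qed

lemma X_embed_schwartz: "u \<in> schwartz \<Longrightarrow> X_embed k s b u = X_rel k s b `` {\<lambda>_. u}"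
proof -
  assume u: "u \<in> schwartz"
  have "X_dist k s b (v n) u = X_dist k s b u (v n)" if "v \<in> X_cauchy k s b" for v n
    using that by (intro X_dist_commute X_cauchy_X_fun schwartz_X_fun k u)
  then show ?thesis
    unfolding X_embed_def X_dist_def[symmetric] using X_cauchy_const[OF u] by (auto simp: X_rel_iff)
qed

end

section \<open>Extension of locally Lipschitz maps\<close>

text \<open>A map on the Schwartz class that is Lipschitz on bounded sets extends to the completion. The extension sends the class of \<open>u\<^sub>n\<close>
  to the class of a Schwartz sequence that approximates \<open>N u\<^sub>n\<close>; such a detour is needed because \<open>N u\<^sub>n\<close> itself may not be
  Schwartz. Both estimates pass to the limit, and the Lipschitz bound gives continuity.\<close>

lemma X_extension_exists:
  assumes k: "\<bar>k\<bar> \<le> 1" and C: "0 \<le> C"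
    and N: "\<And>u. u \<in> schwartz \<Longrightarrow> N u \<in> X_fun k s b'"
    and dens: "\<And>u e. u \<in> schwartz \<Longrightarrow> 0 < e \<Longrightarrow> \<exists>v\<in>schwartz. X_dist k s b' v (N u) < e"
    and lip: "\<And>u v. u \<in> schwartz \<Longrightarrow> v \<in> schwartz \<Longrightarrow>
       X_dist k s b' (N u) (N v) \<le> C * X_dist k s b u v * (X_norm k s b u + X_norm k s b v) ^ p"
    and growth: "\<And>u. u \<in> schwartz \<Longrightarrow> X_norm k s b' (N u) \<le> C * X_norm k s b u ^ Suc p"
  obtains T where "X_extension k s b b' N T"
    "\<And>U. U \<in> X_space k s b \<Longrightarrow> X_space_norm k s b' (T U) \<le> C * X_space_norm k s b U ^ Suc p"
proof -
  let ?d = "X_dist k s b" and ?d' = "X_dist k s b'"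
  let ?S = "X_space k s b" and ?S' = "X_space k s b'"
  note memD = X_space_memD[OF k, where s=s and b=b]
  note fun' = X_cauchy_X_fun[OF k, where s=s and b=b']
  have sch: "u n \<in> schwartz" if "u \<in> X_cauchy k s c" for u n c using that unfolding X_cauchy_iff by blast
  \<comment> \<open>\<open>v\<close> is a Cauchy sequence of Schwartz functions asymptotic to \<open>N u\<^sub>n\<close>.\<close>
  define represents where "represents v u \<longleftrightarrow> v \<in> X_cauchy k s b' \<and> (\<lambda>n. ?d' (v n) (N (u n))) \<longlonglongrightarrow> 0" for v u
  define T where "T U = {v. \<exists>u\<in>U. represents v u}" for U

  have ex_rep: "\<exists>v. represents v u" if u: "u \<in> X_cauchy k s b" for u
  proof -
    have "\<forall>n. \<exists>v. v \<in> schwartz \<and> ?d' v (N (u n)) < inverse (real (Suc n))"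
      using dens[OF sch[OF u]] by (simp add: Bex_def)
    from choice[OF this] obtain v where v: "\<And>n. v n \<in> schwartz" "\<And>n. ?d' (v n) (N (u n)) < inverse (real (Suc n))" by blast
    have Nf: "N (u n) \<in> X_fun k s b'" "v n \<in> X_fun k s b'" for n
      by (rule N[OF sch[OF u]], rule schwartz_X_fun[OF k v(1)])
    have lim: "(\<lambda>n. ?d' (v n) (N (u n))) \<longlonglongrightarrow> 0"
      by (rule Lim_null_comparison[OF always_eventually LIMSEQ_inverse_real_of_nat]) (use v(2) in \<open>auto intro: less_imp_le\<close>)
    obtain R where R: "0 < R" "\<And>n. X_norm k s b (u n) \<le> R"
    proof -
      have "convergent (\<lambda>n. X_norm k s b (u n))"
        using X_dist_convergent[OF k u X_cauchy_const[OF schwartz_zero]] by simp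
      then have "Bseq (\<lambda>n. X_norm k s b (u n))" by (rule convergent_imp_Bseq)
      then show ?thesis using that by (auto simp: Bseq_def)
    qed
    define K where "K = C * (R + R) ^ p + 1"
    have K: "0 < K" using C R by (simp add: K_def add_nonneg_pos)
    have "v \<in> X_cauchy k s b'"
      unfolding X_cauchy_iff
    proof (intro conjI allI impI v(1))
      fix e :: real assume e: "0 < e"
      then have "0 < e / 3 / K" using K by simp
      then obtain N1 where N1: "\<And>m n. N1 \<le> m \<Longrightarrow> N1 \<le> n \<Longrightarrow> ?d (u m) (u n) < e / 3 / K"
        using u unfolding X_cauchy_iff by blast
      have "0 < e / 3" using e by simp
      from order_tendstoD(2)[OF lim this] obtain N2 where N2: "\<And>n. N2 \<le> n \<Longrightarrow> ?d' (v n) (N (u n)) < e / 3"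
        unfolding eventually_sequentially by blast
      have "?d' (v m) (v n) < e" if "max N1 N2 \<le> m" "max N1 N2 \<le> n" for m n
      proof -
        have "?d' (N (u m)) (N (u n)) \<le> C * ?d (u m) (u n) * (X_norm k s b (u m) + X_norm k s b (u n)) ^ p"
          by (rule lip[OF sch[OF u] sch[OF u]])
        also have "\<dots> \<le> C * ?d (u m) (u n) * (R + R) ^ p"
          using C R by (intro mult_left_mono power_mono add_mono) auto
        also have "\<dots> \<le> K * ?d (u m) (u n)" by (simp add: K_def algebra_simps)
        also have "\<dots> \<le> K * (e / 3 / K)" using N1[of m n] that K by (intro mult_left_mono) auto
        also have "\<dots> = e / 3" using K by simp
        finally have 1: "?d' (N (u m)) (N (u n)) \<le> e / 3" .
        have "?d' (v m) (v n) \<le> ?d' (v m) (N (u m)) + (?d' (N (u m)) (N (u n)) + ?d' (N (u n)) (v n))"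
          using X_dist_triangle[OF Nf(2)[of m] Nf(1)[of m] Nf(2)[of n]] X_dist_triangle[OF Nf(1)[of m] Nf(1)[of n] Nf(2)[of n]] by linarith
        then show ?thesis using 1 N2[of m] N2[of n] that X_dist_commute[OF Nf(1)[of n] Nf(2)[of n]] by simp
      qed
      then show "\<exists>N. \<forall>m\<ge>N. \<forall>n\<ge>N. ?d' (v m) (v n) < e" by blast
    qed
    then show ?thesis using lim unfolding represents_def by blast
  qed

  have N_lim: "(\<lambda>n. ?d' (N (u n)) (N (w n))) \<longlonglongrightarrow> 0" if uw: "(u, w) \<in> X_rel k s b" for u w
  proof (rule Lim_null_comparison)
    have u: "u \<in> X_cauchy k s b" and w: "w \<in> X_cauchy k s b" and 0: "(\<lambda>n. ?d (u n) (w n)) \<longlonglongrightarrow> 0"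
      using uw by (auto simp: X_rel_iff)
    show "\<forall>\<^sub>F n in sequentially. norm (?d' (N (u n)) (N (w n))) \<le> C * ?d (u n) (w n) * (X_norm k s b (u n) + X_norm k s b (w n)) ^ p"
      using lip[OF sch[OF u] sch[OF w]] by (intro always_eventually allI) simp
    obtain a where a: "(\<lambda>n. X_norm k s b (u n)) \<longlonglongrightarrow> a"
      using X_dist_convergent[OF k u X_cauchy_const[OF schwartz_zero]] by (auto simp: convergent_def)
    obtain c where c: "(\<lambda>n. X_norm k s b (w n)) \<longlonglongrightarrow> c"
      using X_dist_convergent[OF k w X_cauchy_const[OF schwartz_zero]] by (auto simp: convergent_def)
    have "(\<lambda>n. C * ?d (u n) (w n) * (X_norm k s b (u n) + X_norm k s b (w n)) ^ p) \<longlonglongrightarrow> C * 0 * (a + c) ^ p"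
      by (intro tendsto_intros 0 a c)
    then show "(\<lambda>n. C * ?d (u n) (w n) * (X_norm k s b (u n) + X_norm k s b (w n)) ^ p) \<longlonglongrightarrow> 0" by simp
  qed

  have T_eq: "T U = X_rel k s b' `` {v}" if U: "U \<in> ?S" and u: "u \<in> U" and v: "represents v u" for U u v
  proof
    have vc: "v \<in> X_cauchy k s b'" and vl: "(\<lambda>n. ?d' (v n) (N (u n))) \<longlonglongrightarrow> 0" using v unfolding represents_def by auto
    note uc = memD(1)[OF U u]
    show "T U \<subseteq> X_rel k s b' `` {v}"
    proof
      fix v' assume "v' \<in> T U"
      then obtain w where w: "w \<in> U" and v'c: "v' \<in> X_cauchy k s b'" and v'l: "(\<lambda>n. ?d' (v' n) (N (w n))) \<longlonglongrightarrow> 0"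
        unfolding T_def represents_def by blast
      note wc = memD(1)[OF U w]
      have uw: "(u, w) \<in> X_rel k s b" using memD(2)[OF U u] w by blast
      have "(\<lambda>n. ?d' (v n) (v' n)) \<longlonglongrightarrow> 0"
      proof (rule Lim_null_comparison)
        show "\<forall>\<^sub>F n in sequentially. norm (?d' (v n) (v' n)) \<le> ?d' (v n) (N (u n)) + (?d' (N (u n)) (N (w n)) + ?d' (v' n) (N (w n)))"
        proof (intro always_eventually allI)
          fix n
          note f = fun'[OF vc, of n] fun'[OF v'c, of n] N[OF sch[OF uc, of n]] N[OF sch[OF wc, of n]]
          show "norm (?d' (v n) (v' n)) \<le> ?d' (v n) (N (u n)) + (?d' (N (u n)) (N (w n)) + ?d' (v' n) (N (w n)))"
            using X_dist_triangle[OF f(1,3,2)] X_dist_triangle[OF f(3,4,2)] X_dist_commute[OF f(2,4)] by simp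
        qed
        have "(\<lambda>n. ?d' (v n) (N (u n)) + (?d' (N (u n)) (N (w n)) + ?d' (v' n) (N (w n)))) \<longlonglongrightarrow> 0 + (0 + 0)"
          by (intro tendsto_add vl v'l N_lim[OF uw])
        then show "(\<lambda>n. ?d' (v n) (N (u n)) + (?d' (N (u n)) (N (w n)) + ?d' (v' n) (N (w n)))) \<longlonglongrightarrow> 0" by simp
      qed
      then show "v' \<in> X_rel k s b' `` {v}" using vc v'c by (simp add: X_rel_iff)
    qed
    show "X_rel k s b' `` {v} \<subseteq> T U"
    proof
      fix v' assume "v' \<in> X_rel k s b' `` {v}"
      then have v'c: "v' \<in> X_cauchy k s b'" and v'l: "(\<lambda>n. ?d' (v n) (v' n)) \<longlonglongrightarrow> 0" by (auto simp: X_rel_iff)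
      have "(\<lambda>n. ?d' (v' n) (N (u n))) \<longlonglongrightarrow> 0"
      proof (rule Lim_null_comparison)
        show "\<forall>\<^sub>F n in sequentially. norm (?d' (v' n) (N (u n))) \<le> ?d' (v n) (v' n) + ?d' (v n) (N (u n))"
        proof (intro always_eventually allI)
          fix n
          note f = fun'[OF vc, of n] fun'[OF v'c, of n] N[OF sch[OF uc, of n]]
          show "norm (?d' (v' n) (N (u n))) \<le> ?d' (v n) (v' n) + ?d' (v n) (N (u n))"
            using X_dist_triangle[OF f(2,1,3)] X_dist_commute[OF f(1,2)] by simp
        qed
        have "(\<lambda>n. ?d' (v n) (v' n) + ?d' (v n) (N (u n))) \<longlonglongrightarrow> 0 + 0" by (intro tendsto_add vl v'l)
        then show "(\<lambda>n. ?d' (v n) (v' n) + ?d' (v n) (N (u n))) \<longlonglongrightarrow> 0" by simp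
      qed
      then show "v' \<in> T U" using u v'c unfolding T_def represents_def by blast
    qed
  qed
  have T_rep: "\<exists>u v. u \<in> U \<and> represents v u \<and> v \<in> T U \<and> T U \<in> ?S'" if U: "U \<in> ?S" for U
  proof -
    obtain u where u: "u \<in> U" using X_space_cases[OF k U] by blast
    obtain v where v: "represents v u" using ex_rep[OF memD(1)[OF U u]] by blast
    then have "v \<in> T U" "T U \<in> ?S'"
      using u X_class_in_space[OF k, of v s b'] T_eq[OF U u v] unfolding T_def represents_def by auto
    with u v show ?thesis by blast
  qed

  have T_norm: "X_space_norm k s b' (T U) \<le> C * X_space_norm k s b U ^ Suc p" if U: "U \<in> ?S" for U
  proof -
    obtain u v where u: "u \<in> U" and v: "represents v u" "v \<in> T U" "T U \<in> ?S'" using T_rep[OF U] by blast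
    have vc: "v \<in> X_cauchy k s b'" and vl: "(\<lambda>n. ?d' (v n) (N (u n))) \<longlonglongrightarrow> 0" using v unfolding represents_def by auto
    note uc = memD(1)[OF U u]
    show ?thesis
    proof (rule LIMSEQ_le)
      show "(\<lambda>n. X_norm k s b' (v n)) \<longlonglongrightarrow> X_space_norm k s b' (T U)" by (rule X_space_norm_limit[OF k v(3,2)])
      have "(\<lambda>n. ?d' (v n) (N (u n)) + C * X_norm k s b (u n) ^ Suc p) \<longlonglongrightarrow> 0 + C * X_space_norm k s b U ^ Suc p"
        by (intro tendsto_add vl tendsto_mult tendsto_const tendsto_power X_space_norm_limit[OF k U u])
      then show "(\<lambda>n. ?d' (v n) (N (u n)) + C * X_norm k s b (u n) ^ Suc p) \<longlonglongrightarrow> C * X_space_norm k s b U ^ Suc p" by simp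
      have "X_norm k s b' (v n) \<le> ?d' (v n) (N (u n)) + C * X_norm k s b (u n) ^ Suc p" for n
      proof -
        have "X_dist k s b' (v n) (\<lambda>_. 0) \<le> ?d' (v n) (N (u n)) + X_dist k s b' (N (u n)) (\<lambda>_. 0)"
          by (intro X_dist_triangle fun' vc N sch[OF uc] schwartz_X_fun k schwartz_zero)
        then show ?thesis using growth[OF sch[OF uc], of n] by simp
      qed
      then show "\<exists>N'. \<forall>n\<ge>N'. X_norm k s b' (v n) \<le> ?d' (v n) (N (u n)) + C * X_norm k s b (u n) ^ Suc p" by blast
    qed
  qed

  have T_lip: "X_space_dist k s b' (T U) (T V) \<le> C * X_space_dist k s b U V * (X_space_norm k s b U + X_space_norm k s b V) ^ p"
    if U: "U \<in> ?S" and V: "V \<in> ?S" for U V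
  proof -
    obtain u u' where u: "u \<in> U" and u': "represents u' u" "u' \<in> T U" "T U \<in> ?S'" using T_rep[OF U] by blast
    obtain v v' where v: "v \<in> V" and v': "represents v' v" "v' \<in> T V" "T V \<in> ?S'" using T_rep[OF V] by blast
    have u'c: "u' \<in> X_cauchy k s b'" and u'l: "(\<lambda>n. ?d' (u' n) (N (u n))) \<longlonglongrightarrow> 0" using u' unfolding represents_def by auto
    have v'c: "v' \<in> X_cauchy k s b'" and v'l: "(\<lambda>n. ?d' (v' n) (N (v n))) \<longlonglongrightarrow> 0" using v' unfolding represents_def by auto
    note uc = memD(1)[OF U u] and vc = memD(1)[OF V v]
    let ?g = "\<lambda>n. ?d' (u' n) (N (u n)) + (C * ?d (u n) (v n) * (X_norm k s b (u n) + X_norm k s b (v n)) ^ p + ?d' (v' n) (N (v n)))"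
    show ?thesis
    proof (rule LIMSEQ_le)
      show "(\<lambda>n. ?d' (u' n) (v' n)) \<longlonglongrightarrow> X_space_dist k s b' (T U) (T V)"
        by (rule X_space_dist_limit[OF k u'(3,2) v'(3,2)])
      have "?g \<longlonglongrightarrow> 0 + (C * X_space_dist k s b U V * (X_space_norm k s b U + X_space_norm k s b V) ^ p + 0)"
        by (intro tendsto_add u'l v'l tendsto_mult tendsto_const tendsto_power X_space_norm_limit[OF k U u] X_space_norm_limit[OF k V v] X_space_dist_limit[OF k U u V v])
      then show "?g \<longlonglongrightarrow> C * X_space_dist k s b U V * (X_space_norm k s b U + X_space_norm k s b V) ^ p" by simp
      have "?d' (u' n) (v' n) \<le> ?g n" for n
      proof -
        note f = fun'[OF u'c, of n] fun'[OF v'c, of n] N[OF sch[OF uc, of n]] N[OF sch[OF vc, of n]]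
        show ?thesis
          using X_dist_triangle[OF f(1,3,2)] X_dist_triangle[OF f(3,4,2)] X_dist_commute[OF f(2,4)] lip[OF sch[OF uc, of n] sch[OF vc, of n]] by linarith
      qed
      then show "\<exists>N'. \<forall>n\<ge>N'. ?d' (u' n) (v' n) \<le> ?g n" by blast
    qed
  qed

  have "X_extension k s b b' N T"
    unfolding X_extension_def
  proof (intro conjI ballI)
    fix u assume u: "u \<in> schwartz"
    show "N u \<in> X_fun k s b'" by (rule N[OF u])
    have c: "(\<lambda>_. u) \<in> X_cauchy k s b" by (rule X_cauchy_const[OF u])
    have U: "X_embed k s b u = X_rel k s b `` {\<lambda>_. u}" "X_embed k s b u \<in> ?S" "(\<lambda>_. u) \<in> X_embed k s b u"
      using X_embed_schwartz[OF k u] X_class_in_space[OF k c] equiv_class_self[OF X_rel_equiv[OF k] c] by auto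
    obtain v where v: "represents v (\<lambda>_. u)" using ex_rep[OF c] by blast
    have "T (X_embed k s b u) = X_rel k s b' `` {v}" by (rule T_eq[OF U(2,3) v])
    also have "\<dots> = X_embed k s b' (N u)"
    proof -
      have vc: "v \<in> X_cauchy k s b'" and vl: "(\<lambda>n. ?d' (v n) (N u)) \<longlonglongrightarrow> 0" using v unfolding represents_def by auto
      have "(\<lambda>n. ?d' (v n) (w n)) \<longlonglongrightarrow> 0 \<longleftrightarrow> (\<lambda>n. ?d' (w n) (N u)) \<longlonglongrightarrow> 0" if wc: "w \<in> X_cauchy k s b'" for w
      proof -
        note f = fun'[OF vc] fun'[OF wc] N[OF u]
        have s: "(\<lambda>n. ?d' (v n) (N u) + g n) \<longlonglongrightarrow> 0" if "g \<longlonglongrightarrow> 0" for g using tendsto_add[OF vl that] by simp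
        have 1: "norm (?d' (w n) (N u)) \<le> ?d' (v n) (N u) + ?d' (v n) (w n)" for n
          using X_dist_triangle[OF f(2)[of n] f(1)[of n] f(3)] X_dist_commute[OF f(1)[of n] f(2)[of n]] by simp
        have 2: "norm (?d' (v n) (w n)) \<le> ?d' (v n) (N u) + ?d' (w n) (N u)" for n
          using X_dist_triangle[OF f(1)[of n] f(3) f(2)[of n]] X_dist_commute[OF f(2)[of n] f(3)] by simp
        show ?thesis
        proof
          assume L: "(\<lambda>n. ?d' (v n) (w n)) \<longlonglongrightarrow> 0"
          show "(\<lambda>n. ?d' (w n) (N u)) \<longlonglongrightarrow> 0"
            by (rule Lim_null_comparison[OF always_eventually s[OF L]]) (rule allI, rule 1)
        next
          assume L: "(\<lambda>n. ?d' (w n) (N u)) \<longlonglongrightarrow> 0"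
          show "(\<lambda>n. ?d' (v n) (w n)) \<longlonglongrightarrow> 0"
            by (rule Lim_null_comparison[OF always_eventually s[OF L]]) (rule allI, rule 2)
        qed
      qed
      then show ?thesis unfolding X_embed_def X_dist_def[symmetric] using vc by (auto simp: X_rel_iff)
    qed
    finally show "T (X_embed k s b u) = X_embed k s b' (N u)" .
  next
    show "continuous_map (X_topology k s b) (X_topology k s b') T"
      unfolding X_topology_def Metric_space.metric_continuous_map[OF X_metric_space[OF k] X_metric_space[OF k]]
    proof (intro conjI ballI allI impI)
      show "T ` ?S \<subseteq> ?S'" using T_rep by blast
      fix U and e :: real assume U: "U \<in> ?S" and e: "0 < e"
      define R where "R = X_space_norm k s b U"
      have R: "0 \<le> R" unfolding R_def by (rule X_space_norm_nonneg[OF k U])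
      \<comment> \<open>A Lipschitz constant on the ball of radius \<open>R + 1\<close>, made positive by adding 1.\<close>
      define K where "K = C * (R + (R + 1)) ^ p + 1"
      have K: "0 < K" using C R by (simp add: K_def add_nonneg_pos)
      show "\<exists>\<delta>>0. \<forall>V. V \<in> ?S \<and> X_space_dist k s b U V < \<delta> \<longrightarrow> X_space_dist k s b' (T U) (T V) < e"
      proof (intro exI conjI allI impI)
        show "0 < min 1 (e / K)" using e K by simp
        fix V assume "V \<in> ?S \<and> X_space_dist k s b U V < min 1 (e / K)"
        then have V: "V \<in> ?S" and d: "X_space_dist k s b U V < 1" "X_space_dist k s b U V < e / K" by auto
        have d0: "0 \<le> X_space_dist k s b U V" using Metric_space.nonneg[OF X_metric_space[OF k]] .
        have nV: "X_space_norm k s b V \<le> R + 1" using X_space_norm_le_dist[OF k U V] d(1) by (simp add: R_def)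
        have "X_space_dist k s b' (T U) (T V) \<le> C * X_space_dist k s b U V * (R + X_space_norm k s b V) ^ p"
          unfolding R_def by (rule T_lip[OF U V])
        also have "\<dots> \<le> C * X_space_dist k s b U V * (R + (R + 1)) ^ p"
          using C d0 R nV X_space_norm_nonneg[OF k V] by (intro mult_left_mono power_mono add_mono) auto
        also have "\<dots> \<le> K * X_space_dist k s b U V" using d0 by (simp add: K_def algebra_simps)
        also have "\<dots> < K * (e / K)" using d(2) K by (intro mult_strict_left_mono)
        also have "\<dots> = e" using K by simp
        finally show "X_space_dist k s b' (T U) (T V) < e" .
      qed
    qed
  qed
  then show ?thesis using T_norm by (rule that)
qed

section \<open>The nonlinear estimates\<close>

lemma dx_diff: "(\<And>z. u differentiable (at z)) \<Longrightarrow> (\<And>z. v differentiable (at z)) \<Longrightarrow> dx (\<lambda>z. u z - v z) = (\<lambda>z. dx u z - dx v z)"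
  by (rule dx_eqI) (intro has_vector_derivative_diff has_dx)

lemma dx_dx_diff:
  assumes u: "u \<in> schwartz" and v: "v \<in> schwartz"
  shows "dx (dx (\<lambda>z. u z - v z)) = (\<lambda>z. dx (dx u) z - dx (dx v) z)"
proof -
  have "dx (\<lambda>z. u z - v z) = (\<lambda>z. dx u z - dx v z)"
    by (rule dx_diff) (rule schwartzD(1)[OF u], rule schwartzD(1)[OF v])
  moreover have "dx (\<lambda>z. dx u z - dx v z) = (\<lambda>z. dx (dx u) z - dx (dx v) z)"
    by (rule dx_diff) (rule schwartzD(1)[OF schwartz_dx[OF u]], rule schwartzD(1)[OF schwartz_dx[OF v]])
  ultimately show ?thesis by simp
qed

lemma X_norm_cong_fourier:
  "(\<And>\<zeta>. fourier u \<zeta> = fourier v \<zeta>) \<Longrightarrow> X_norm k s b u = X_norm k s b v"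
  by (simp add: X_norm_def)

lemma X_dist_phi_op:
  assumes k: "\<bar>k\<bar> \<le> 1" and g: "g \<in> schwartz" and h: "h \<in> schwartz"
  shows "X_dist k s b (phi_op k g) (phi_op k h) = X_norm k s b (phi_op k (\<lambda>z. g z - h z))"
  unfolding X_dist_def
  by (rule X_norm_cong_fourier)
    (simp add: fourier_eq_ft ft_linear(2)[OF phi_op_props(1)[OF k g] phi_op_props(1)[OF k h]] phi_op_props(2)[OF k]
      schwartz_diff g h ft_linear(2)[OF schwartz_integrable[OF g] schwartz_integrable[OF h]] right_diff_distrib)

lemma X_norm_phi_op_add:
  assumes k: "\<bar>k\<bar> \<le> 1" and g: "g \<in> schwartz" and h: "h \<in> schwartz"
  shows "X_norm k s b (phi_op k (\<lambda>z. g z + h z)) \<le> X_norm k s b (phi_op k g) + X_norm k s b (phi_op k h)"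
proof -
  have "X_norm k s b (phi_op k (\<lambda>z. g z + h z)) = X_norm k s b (\<lambda>z. phi_op k g z + phi_op k h z)"
    by (rule X_norm_cong_fourier)
      (simp add: fourier_eq_ft ft_linear(1)[OF phi_op_props(1)[OF k g] phi_op_props(1)[OF k h]] phi_op_props(2)[OF k]
        schwartz_add g h ft_linear(1)[OF schwartz_integrable[OF g] schwartz_integrable[OF h]] distrib_left)
  also have "\<dots> \<le> X_norm k s b (phi_op k g) + X_norm k s b (phi_op k h)"
    by (intro X_norm_triangle phi_op_X_fun k g h)
  finally show ?thesis .
qed

text \<open>This reduces the estimates for Schwartz functions to inequalities between nonnegative functions: the signs and
  phases of the transform have disappeared on the right.\<close>

lemma X_norm_phi_op_le:
  assumes k: "\<bar>k\<bar> \<le> 1" and g: "g \<in> schwartz" and G: "\<And>\<zeta>. ennreal (norm (ft g \<zeta>)) \<le> G \<zeta>"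
  shows "ennreal ((X_norm k s b (phi_op k g))\<^sup>2) \<le>
    (\<integral>\<^sup>+\<zeta>. (ennreal (X_weight k s b \<zeta> * (2 * \<bar>fst \<zeta>\<bar> / (jbracket (fst \<zeta>))\<^sup>2)) * G \<zeta>)\<^sup>2 \<partial>lborel)"
  unfolding X_nn_eq_X_norm[OF phi_op_X_fun[OF k g], symmetric] X_nn_def
proof (intro nn_integral_mono power_mono)
  fix \<zeta> :: "real \<times> real"
  let ?M = "2 * \<bar>fst \<zeta>\<bar> / (jbracket (fst \<zeta>))\<^sup>2"
  have "norm (fourier (phi_op k g) \<zeta>) = phi_multiplier k (fst \<zeta>) * norm (ft g \<zeta>)"
    using phi_multiplier_props(4)[OF k, of "fst \<zeta>"]
    unfolding fourier_eq_ft phi_op_props(2)[OF k g] phi_multiplier_def[symmetric] norm_mult norm_minus_cancel norm_of_real by simp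
  also have "\<dots> \<le> ?M * norm (ft g \<zeta>)"
    unfolding phi_multiplier_def by (intro mult_right_mono sq_div_phi_le k) simp
  finally have "X_weight k s b \<zeta> * norm (fourier (phi_op k g) \<zeta>) \<le> (X_weight k s b \<zeta> * ?M) * norm (ft g \<zeta>)"
    using mult_left_mono[OF _ X_weight_nonneg] by (simp only: mult.assoc)
  then have "ennreal (X_weight k s b \<zeta> * norm (fourier (phi_op k g) \<zeta>)) \<le> ennreal ((X_weight k s b \<zeta> * ?M) * norm (ft g \<zeta>))"
    by (rule ennreal_leI)
  then have "ennreal (X_weight k s b \<zeta>) * ennreal (norm (fourier (phi_op k g) \<zeta>)) \<le> ennreal (X_weight k s b \<zeta> * ?M) * ennreal (norm (ft g \<zeta>))"
    by (simp only: ennreal_mult[OF X_weight_nonneg norm_ge_zero] ennreal_mult''[OF norm_ge_zero])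
  also have "\<dots> \<le> ennreal (X_weight k s b \<zeta> * ?M) * G \<zeta>" by (intro mult_left_mono G) simp
  finally show "ennreal (X_weight k s b \<zeta>) * ennreal (norm (fourier (phi_op k g) \<zeta>)) \<le> ennreal (X_weight k s b \<zeta> * ?M) * G \<zeta>" .
qed simp

lemma X_nn_schwartz:
  assumes "\<bar>k\<bar> \<le> 1" "u \<in> schwartz"
  shows "X_nn k s b (\<lambda>\<zeta>. ennreal (norm (ft u \<zeta>))) = ennreal ((X_norm k s b u)\<^sup>2)"
  using X_nn_eq_X_norm[OF schwartz_X_fun[OF assms]] by (simp add: fourier_eq_ft)

text \<open>Polarised form of the quadratic estimate, as needed for differences. The two factors play different roles: the
  derivatives fall on the second one.\<close>

lemma bilinear_estimate:
  assumes k: "\<bar>k\<bar> \<le> 1" and s0: "1 / 2 < b" "b \<le> s0" "s0 \<le> 5 / 8" "s0 \<le> s"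
  obtains C where "0 \<le> C" "\<And>u v. u \<in> schwartz \<Longrightarrow> v \<in> schwartz \<Longrightarrow>
    X_norm k s (b - 1) (phi_op k (\<lambda>z. u z * dx (dx v) z)) \<le> C * (X_norm k s b u * X_norm k s b v)"
proof -
  obtain C where C: "C < \<infinity>" and est: "\<And>F G. F \<in> borel_measurable borel \<Longrightarrow> G \<in> borel_measurable borel \<Longrightarrow>
    (\<integral>\<^sup>+\<zeta>. (ennreal (X_weight k s (b - 1) \<zeta> * (2 * \<bar>fst \<zeta>\<bar> / (jbracket (fst \<zeta>))\<^sup>2)) *
        (\<integral>\<^sup>+z. F z * (ennreal ((fst (\<zeta> - z))\<^sup>2) * G (\<zeta> - z)) \<partial>lborel))\<^sup>2 \<partial>lborel)
      \<le> C * (X_nn k s b F * X_nn k s b G)"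
    using quad_estimate[OF k s0] by blast
  obtain c where c: "C = ennreal c" "0 \<le> c" using C by (cases C) auto
  have "X_norm k s (b - 1) (phi_op k (\<lambda>z. u z * dx (dx v) z)) \<le> sqrt c * (X_norm k s b u * X_norm k s b v)"
    if u: "u \<in> schwartz" and v: "v \<in> schwartz" for u v
  proof -
    let ?g = "\<lambda>z. u z * dx (dx v) z"
    let ?F = "\<lambda>\<zeta>. ennreal (norm (ft u \<zeta>))" and ?G = "\<lambda>\<zeta>. ennreal (norm (ft v \<zeta>))"
    have g: "?g \<in> schwartz" by (intro schwartz_mult schwartz_dx u v)
    have [measurable]: "ft u \<in> borel_measurable borel" "ft v \<in> borel_measurable borel"
      by (intro schwartz_ft_measurable u v)+
    have G: "ennreal (norm (ft ?g \<zeta>)) \<le> (\<integral>\<^sup>+z. ?F z * (ennreal ((fst (\<zeta> - z))\<^sup>2) * ?G (\<zeta> - z)) \<partial>lborel)" for \<zeta>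
    proof -
      have "ennreal (norm (ft ?g \<zeta>)) \<le> (\<integral>\<^sup>+z. ?F z * ennreal (norm (ft (dx (dx v)) (\<zeta> - z))) \<partial>lborel)"
        by (intro norm_schwartz_ft_mult_le u schwartz_dx v)
      also have "\<dots> = (\<integral>\<^sup>+z. ?F z * (ennreal ((fst (\<zeta> - z))\<^sup>2) * ?G (\<zeta> - z)) \<partial>lborel)"
      proof (intro nn_integral_cong)
        fix z
        have "norm (ft (dx (dx v)) (\<zeta> - z)) = (fst (\<zeta> - z))\<^sup>2 * norm (ft v (\<zeta> - z))"
          unfolding ft_dx_dx[OF v] norm_mult norm_minus_cancel norm_of_real by simp
        then show "?F z * ennreal (norm (ft (dx (dx v)) (\<zeta> - z))) = ?F z * (ennreal ((fst (\<zeta> - z))\<^sup>2) * ?G (\<zeta> - z))"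
          by (simp only: ennreal_mult[OF zero_le_power2 norm_ge_zero])
      qed
      finally show ?thesis .
    qed
    have "ennreal ((X_norm k s (b - 1) (phi_op k ?g))\<^sup>2) \<le> C * (X_nn k s b ?F * X_nn k s b ?G)"
      by (rule order_trans[OF X_norm_phi_op_le[OF k g G] est]) measurable
    also have "\<dots> = ennreal (c * ((X_norm k s b u)\<^sup>2 * (X_norm k s b v)\<^sup>2))"
      unfolding X_nn_schwartz[OF k u] X_nn_schwartz[OF k v] c(1) using c(2) by (simp add: ennreal_mult)
    finally have "(X_norm k s (b - 1) (phi_op k ?g))\<^sup>2 \<le> c * ((X_norm k s b u)\<^sup>2 * (X_norm k s b v)\<^sup>2)"
      using c(2) by (subst (asm) ennreal_le_iff) auto
    also have "\<dots> = (sqrt c * (X_norm k s b u * X_norm k s b v))\<^sup>2"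
      using c(2) by (simp add: power_mult_distrib)
    finally show ?thesis by (rule power2_le_imp_le) (use c(2) in simp)
  qed
  then show ?thesis using that[of "sqrt c"] c(2) by simp
qed

lemma trilinear_estimate:
  assumes k: "\<bar>k\<bar> \<le> 1" and s: "1 / 2 < s" and b: "1 / 2 < b" "b \<le> 1"
  obtains C where "0 \<le> C" "\<And>u v w. u \<in> schwartz \<Longrightarrow> v \<in> schwartz \<Longrightarrow> w \<in> schwartz \<Longrightarrow>
    X_norm k s (b - 1) (phi_op k (\<lambda>z. u z * (v z * w z))) \<le> C * (X_norm k s b u * X_norm k s b v * X_norm k s b w)"
proof -
  obtain C where C: "C < \<infinity>" and est: "\<And>F G H. F \<in> borel_measurable borel \<Longrightarrow> G \<in> borel_measurable borel \<Longrightarrow> H \<in> borel_measurable borel \<Longrightarrow>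
    (\<integral>\<^sup>+\<zeta>. (ennreal (X_weight k s (b - 1) \<zeta> * (2 * \<bar>fst \<zeta>\<bar> / (jbracket (fst \<zeta>))\<^sup>2)) *
        (\<integral>\<^sup>+z. F z * (\<integral>\<^sup>+y. G y * H (\<zeta> - z - y) \<partial>lborel) \<partial>lborel))\<^sup>2 \<partial>lborel)
      \<le> C * (X_nn k s b F * X_nn k s b G * X_nn k s b H)"
    using cubic_estimate[OF s b] by blast
  obtain c where c: "C = ennreal c" "0 \<le> c" using C by (cases C) auto
  have "X_norm k s (b - 1) (phi_op k (\<lambda>z. u z * (v z * w z))) \<le> sqrt c * (X_norm k s b u * X_norm k s b v * X_norm k s b w)"
    if u: "u \<in> schwartz" and v: "v \<in> schwartz" and w: "w \<in> schwartz" for u v w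
  proof -
    let ?g = "\<lambda>z. u z * (v z * w z)"
    let ?F = "\<lambda>\<zeta>. ennreal (norm (ft u \<zeta>))" and ?G = "\<lambda>\<zeta>. ennreal (norm (ft v \<zeta>))" and ?H = "\<lambda>\<zeta>. ennreal (norm (ft w \<zeta>))"
    have vw: "(\<lambda>z. v z * w z) \<in> schwartz" by (intro schwartz_mult v w)
    have g: "?g \<in> schwartz" by (intro schwartz_mult u vw)
    have [measurable]: "ft u \<in> borel_measurable borel" "ft v \<in> borel_measurable borel" "ft w \<in> borel_measurable borel"
      by (intro schwartz_ft_measurable u v w)+
    have G: "ennreal (norm (ft ?g \<zeta>)) \<le> (\<integral>\<^sup>+z. ?F z * (\<integral>\<^sup>+y. ?G y * ?H (\<zeta> - z - y) \<partial>lborel) \<partial>lborel)" for \<zeta>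
    proof -
      have "ennreal (norm (ft ?g \<zeta>)) \<le> (\<integral>\<^sup>+z. ?F z * ennreal (norm (ft (\<lambda>z. v z * w z) (\<zeta> - z))) \<partial>lborel)"
        by (intro norm_schwartz_ft_mult_le u vw)
      also have "\<dots> \<le> (\<integral>\<^sup>+z. ?F z * (\<integral>\<^sup>+y. ?G y * ?H (\<zeta> - z - y) \<partial>lborel) \<partial>lborel)"
        by (intro nn_integral_mono mult_left_mono norm_schwartz_ft_mult_le v w) simp
      finally show ?thesis .
    qed
    have "ennreal ((X_norm k s (b - 1) (phi_op k ?g))\<^sup>2) \<le> C * (X_nn k s b ?F * X_nn k s b ?G * X_nn k s b ?H)"
      by (rule order_trans[OF X_norm_phi_op_le[OF k g G] est]) measurable
    also have "\<dots> = ennreal (c * ((X_norm k s b u)\<^sup>2 * (X_norm k s b v)\<^sup>2 * (X_norm k s b w)\<^sup>2))"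
      unfolding X_nn_schwartz[OF k u] X_nn_schwartz[OF k v] X_nn_schwartz[OF k w] c(1) using c(2) by (simp add: ennreal_mult)
    finally have "(X_norm k s (b - 1) (phi_op k ?g))\<^sup>2 \<le> c * ((X_norm k s b u)\<^sup>2 * (X_norm k s b v)\<^sup>2 * (X_norm k s b w)\<^sup>2)"
      using c(2) by (subst (asm) ennreal_le_iff) auto
    also have "\<dots> = (sqrt c * (X_norm k s b u * X_norm k s b v * X_norm k s b w))\<^sup>2"
      using c(2) by (simp add: power_mult_distrib)
    finally show ?thesis by (rule power2_le_imp_le) (use c(2) in simp)
  qed
  then show ?thesis using that[of "sqrt c"] c(2) by simp
qed

text \<open>With \<open>d = u - v\<close>, \<open>u u\<^sub>x\<^sub>x - v v\<^sub>x\<^sub>x = d u\<^sub>x\<^sub>x + v d\<^sub>x\<^sub>x\<close>, and the bilinear estimate gives the Lipschitz bound.\<close>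

lemma op_quad_extension:
  assumes k: "\<bar>k\<bar> \<le> 1" and s0: "1 / 2 < b" "b \<le> s0" "s0 \<le> 5 / 8" "s0 \<le> s"
  obtains C T where "0 \<le> C" "X_extension k s b (b - 1) (op_quad k) T"
    "\<And>U. U \<in> X_space k s b \<Longrightarrow> X_space_norm k s (b - 1) (T U) \<le> C * (X_space_norm k s b U)\<^sup>2"
proof -
  obtain C where C: "0 \<le> C" and est: "\<And>u v. u \<in> schwartz \<Longrightarrow> v \<in> schwartz \<Longrightarrow>
    X_norm k s (b - 1) (phi_op k (\<lambda>z. u z * dx (dx v) z)) \<le> C * (X_norm k s b u * X_norm k s b v)"
    using bilinear_estimate[OF k s0] by blast
  have sq: "(\<lambda>z. u z * dx (dx v) z) \<in> schwartz" if "u \<in> schwartz" "v \<in> schwartz" for u v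
    using that by (intro schwartz_mult schwartz_dx)
  show ?thesis
  proof (rule X_extension_exists[OF k C, of "op_quad k" s "b - 1" b 1])
    fix u assume u: "u \<in> schwartz"
    show "op_quad k u \<in> X_fun k s (b - 1)"
      unfolding op_quad_eq by (intro phi_op_X_fun k sq u)
    show "\<exists>v\<in>schwartz. X_dist k s (b - 1) v (op_quad k u) < e" if "0 < e" for e
      unfolding op_quad_eq X_dist_def by (intro phi_op_density k sq u that)
    show "X_norm k s (b - 1) (op_quad k u) \<le> C * X_norm k s b u ^ Suc 1"
      using est[OF u u] by (simp add: op_quad_eq power2_eq_square)
  next
    fix u v assume u: "u \<in> schwartz" and v: "v \<in> schwartz"
    define d where "d z = u z - v z" for z
    have d: "d \<in> schwartz" unfolding d_def by (intro schwartz_diff u v)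
    have dd: "dx (dx d) = (\<lambda>z. dx (dx u) z - dx (dx v) z)" unfolding d_def by (rule dx_dx_diff[OF u v])
    have "X_dist k s (b - 1) (op_quad k u) (op_quad k v)
       = X_norm k s (b - 1) (phi_op k (\<lambda>z. u z * dx (dx u) z - v z * dx (dx v) z))"
      unfolding op_quad_eq by (rule X_dist_phi_op[OF k sq[OF u u] sq[OF v v]])
    also have "(\<lambda>z. u z * dx (dx u) z - v z * dx (dx v) z) = (\<lambda>z. d z * dx (dx u) z + v z * dx (dx d) z)"
      unfolding dd by (simp add: d_def algebra_simps)
    also have "X_norm k s (b - 1) (phi_op k \<dots>) \<le> X_norm k s (b - 1) (phi_op k (\<lambda>z. d z * dx (dx u) z)) + X_norm k s (b - 1) (phi_op k (\<lambda>z. v z * dx (dx d) z))"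
      by (rule X_norm_phi_op_add[OF k sq[OF d u] sq[OF v d]])
    also have "\<dots> \<le> C * (X_norm k s b d * X_norm k s b u) + C * (X_norm k s b v * X_norm k s b d)"
      by (intro add_mono est d u v)
    also have "\<dots> = C * X_dist k s b u v * (X_norm k s b u + X_norm k s b v) ^ 1"
      by (simp add: X_dist_def d_def[symmetric] algebra_simps)
    finally show "X_dist k s (b - 1) (op_quad k u) (op_quad k v) \<le> C * X_dist k s b u v * (X_norm k s b u + X_norm k s b v) ^ 1" .
  next
    fix T assume "X_extension k s b (b - 1) (op_quad k) T"
      "\<And>U. U \<in> X_space k s b \<Longrightarrow> X_space_norm k s (b - 1) (T U) \<le> C * X_space_norm k s b U ^ Suc 1"
    then show thesis using that[OF C] by (simp add: power2_eq_square)
  qed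
qed

text \<open>With \<open>d = u - v\<close>, \<open>u\<^sup>3 - v\<^sup>3 = d (u\<^sup>2 + u v + v\<^sup>2)\<close>, and the trilinear estimate gives the Lipschitz bound.\<close>

lemma op_cubic_extension:
  assumes k: "\<bar>k\<bar> \<le> 1" and s: "1 / 2 < s" and b: "1 / 2 < b" "b \<le> 1"
  obtains C T where "0 \<le> C" "X_extension k s b (b - 1) (op_cubic k) T"
    "\<And>U. U \<in> X_space k s b \<Longrightarrow> X_space_norm k s (b - 1) (T U) \<le> C * (X_space_norm k s b U) ^ 3"
proof -
  obtain C where C: "0 \<le> C" and est: "\<And>u v w. u \<in> schwartz \<Longrightarrow> v \<in> schwartz \<Longrightarrow> w \<in> schwartz \<Longrightarrow>
    X_norm k s (b - 1) (phi_op k (\<lambda>z. u z * (v z * w z))) \<le> C * (X_norm k s b u * X_norm k s b v * X_norm k s b w)"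
    using trilinear_estimate[OF k s b] by blast
  have sq: "(\<lambda>z. u z * (v z * w z)) \<in> schwartz" if "u \<in> schwartz" "v \<in> schwartz" "w \<in> schwartz" for u v w
    using that by (intro schwartz_mult)
  have oc: "op_cubic k u = phi_op k (\<lambda>z. u z * (u z * u z))" for u
    unfolding op_cubic_eq by (simp add: power3_eq_cube mult.assoc)
  show ?thesis
  proof (rule X_extension_exists[OF k C, of "op_cubic k" s "b - 1" b 2])
    fix u assume u: "u \<in> schwartz"
    show "op_cubic k u \<in> X_fun k s (b - 1)"
      unfolding oc by (intro phi_op_X_fun k sq u)
    show "\<exists>v\<in>schwartz. X_dist k s (b - 1) v (op_cubic k u) < e" if "0 < e" for e
      unfolding oc X_dist_def by (intro phi_op_density k sq u that)
    show "X_norm k s (b - 1) (op_cubic k u) \<le> C * X_norm k s b u ^ Suc 2"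
      using est[OF u u u] by (simp add: oc power3_eq_cube mult.assoc)
  next
    fix u v assume u: "u \<in> schwartz" and v: "v \<in> schwartz"
    define d where "d z = u z - v z" for z
    have d: "d \<in> schwartz" unfolding d_def by (intro schwartz_diff u v)
    let ?n = "X_norm k s b" and ?N = "\<lambda>g. X_norm k s (b - 1) (phi_op k g)"
    have "X_dist k s (b - 1) (op_cubic k u) (op_cubic k v) = ?N (\<lambda>z. u z * (u z * u z) - v z * (v z * v z))"
      unfolding oc by (rule X_dist_phi_op[OF k sq[OF u u u] sq[OF v v v]])
    also have "(\<lambda>z. u z * (u z * u z) - v z * (v z * v z)) = (\<lambda>z. d z * (u z * u z) + (d z * (u z * v z) + d z * (v z * v z)))"
      by (simp add: d_def algebra_simps)
    also have "?N \<dots> \<le> ?N (\<lambda>z. d z * (u z * u z)) + ?N (\<lambda>z. d z * (u z * v z) + d z * (v z * v z))"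
      by (intro X_norm_phi_op_add k schwartz_add sq d u v)
    also have "\<dots> \<le> ?N (\<lambda>z. d z * (u z * u z)) + (?N (\<lambda>z. d z * (u z * v z)) + ?N (\<lambda>z. d z * (v z * v z)))"
      by (intro add_left_mono X_norm_phi_op_add k sq d u v)
    also have "\<dots> \<le> C * (?n d * ?n u * ?n u) + (C * (?n d * ?n u * ?n v) + C * (?n d * ?n v * ?n v))"
      by (intro add_mono est d u v)
    also have "\<dots> = C * ?n d * (?n u * ?n u + ?n u * ?n v + ?n v * ?n v)" by (simp add: algebra_simps)
    also have "\<dots> \<le> C * ?n d * (?n u + ?n v)\<^sup>2"
      using C by (intro mult_left_mono) (auto simp: power2_eq_square algebra_simps)
    finally show "X_dist k s (b - 1) (op_cubic k u) (op_cubic k v) \<le> C * X_dist k s b u v * (?n u + ?n v) ^ 2"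
      by (simp add: X_dist_def d_def[symmetric])
  next
    fix T assume "X_extension k s b (b - 1) (op_cubic k) T"
      "\<And>U. U \<in> X_space k s b \<Longrightarrow> X_space_norm k s (b - 1) (T U) \<le> C * X_space_norm k s b U ^ Suc 2"
    then show thesis using that[OF C] by (simp add: numeral_3_eq_3 numeral_2_eq_2)
  qed
qed

theorem proposition1p6:
  fixes k s :: real
  assumes "k \<in> {1, - 1}" and "s > 1 / 2"
  shows "\<exists>b0 > 1 / 2. \<forall>b. 1 / 2 < b \<and> b \<le> b0 \<longrightarrow>
    (\<exists>Q K. X_extension k s b (b - 1) (op_quad k) Q \<and>
           X_extension k s b (b - 1) (op_cubic k) K \<and>
       (\<exists>C > 0. \<forall>u \<in> X_space k s b.
          X_space_norm k s (b - 1) (Q u) \<le> C * (X_space_norm k s b u)\<^sup>2 \<and>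
          X_space_norm k s (b - 1) (K u) \<le> C * (X_space_norm k s b u) ^ 3))"
proof -
  have k: "\<bar>k\<bar> \<le> 1" using assms(1) by auto
  \<comment> \<open>\<open>5/8\<close> comes from the output weight: \<open>2 b + 2 s\<^sub>0 - 4 \<le> - 3/2\<close> must hold for \<open>b \<le> s\<^sub>0\<close>.\<close>
  define b0 where "b0 = min s (5 / 8)"
  have b0: "1 / 2 < b0" "b0 \<le> 5 / 8" "b0 \<le> s" using assms(2) by (auto simp: b0_def)
  show ?thesis
  proof (intro exI[of _ b0] conjI allI impI b0(1))
    fix b assume b: "1 / 2 < b \<and> b \<le> b0"
    then have b1: "1 / 2 < b" "b \<le> b0" "b \<le> 1" using b0 by auto
    obtain C1 Q where Q: "0 \<le> C1" "X_extension k s b (b - 1) (op_quad k) Q"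
      "\<And>U. U \<in> X_space k s b \<Longrightarrow> X_space_norm k s (b - 1) (Q U) \<le> C1 * (X_space_norm k s b U)\<^sup>2"
      using op_quad_extension[OF k b1(1,2) b0(2,3)] by metis
    obtain C2 K where K: "0 \<le> C2" "X_extension k s b (b - 1) (op_cubic k) K"
      "\<And>U. U \<in> X_space k s b \<Longrightarrow> X_space_norm k s (b - 1) (K U) \<le> C2 * (X_space_norm k s b U) ^ 3"
      using op_cubic_extension[OF k assms(2) b1(1,3)] by metis
    have "X_space_norm k s (b - 1) (Q U) \<le> (C1 + C2 + 1) * (X_space_norm k s b U)\<^sup>2 \<and>
          X_space_norm k s (b - 1) (K U) \<le> (C1 + C2 + 1) * (X_space_norm k s b U) ^ 3" if U: "U \<in> X_space k s b" for U
    proof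
      note n = X_space_norm_nonneg[OF k U]
      have "C1 * (X_space_norm k s b U)\<^sup>2 \<le> (C1 + C2 + 1) * (X_space_norm k s b U)\<^sup>2"
        using Q(1) K(1) by (intro mult_right_mono) auto
      with Q(3)[OF U] show "X_space_norm k s (b - 1) (Q U) \<le> (C1 + C2 + 1) * (X_space_norm k s b U)\<^sup>2" by linarith
      have "C2 * (X_space_norm k s b U) ^ 3 \<le> (C1 + C2 + 1) * (X_space_norm k s b U) ^ 3"
        using Q(1) K(1) n by (intro mult_right_mono) auto
      with K(3)[OF U] show "X_space_norm k s (b - 1) (K U) \<le> (C1 + C2 + 1) * (X_space_norm k s b U) ^ 3" by linarith
    qed
    moreover have "0 < C1 + C2 + 1" using Q(1) K(1) by simp
    ultimately show "\<exists>Q K. X_extension k s b (b - 1) (op_quad k) Q \<and> X_extension k s b (b - 1) (op_cubic k) K \<and>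
       (\<exists>C > 0. \<forall>u \<in> X_space k s b. X_space_norm k s (b - 1) (Q u) \<le> C * (X_space_norm k s b u)\<^sup>2 \<and>
          X_space_norm k s (b - 1) (K u) \<le> C * (X_space_norm k s b u) ^ 3)"
      using Q(2) K(2) by blast
  qed
qed

end
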